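(* Let $G_\theta=\mathbb{R}^s\times(\mathbb{R}^k\ltimes_\theta\mathbb{H}^q)$ be a hyper-Kähler Lie group as described in the context, with $s+k=4p$ and $\theta$ a real $q\times k$ matrix of rank $k$. Let $L\subset\mathbb{R}^k$ be the connected closed abelian subgroup with Lie algebra $\mathfrak{l}=\operatorname{span}_{\mathbb{R}}\{e_1,\dots,e_l\}$, assumed isotropic with respect to $\omega_\alpha$ for each $\alpha=1,2,3$, acting on $G_\theta$ by left translations $(V,(X,W))\mapsto(V+X,\theta(V)W)$. Let $\mu^\theta:G_\theta\to\mathfrak{l}^*\otimes\operatorname{Im}\mathbb{H}\cong(\operatorname{Im}\mathbb{H})^l$ be its hyper-Kähler moment map. Then: 1. The expression of the moment map is $$\mu^\theta(X,W)=\Big(-\operatorname{Im}X_1+\tfrac12\sum_{\beta=1}^q\theta_\beta^1\,\overline{W_\beta}\,iW_\beta,\ \dots,\ -\operatorname{Im}X_l+\tfrac12\sum_{\beta=1}^q\theta_\beta^l\,\overline{W_\beta}\,iW_\beta\Big),\qquad (X,W)\in G_\theta.$$ 2. There are diffeomorphisms $$L\backslash(\mu^\theta)^{-1}(0)\cong\mathbb{R}^{4p+4q-4l},\qquad L\backslash G_\theta\cong\mathbb{R}^{4p+4q-l}.$$ 3. The torus $T^q$ acts on $L\backslash(\mu^\theta)^{-1}(0)$ (by the action induced by $\varphi:T^q\times G_\theta\to G_\theta$, $\varphi(B,(X,W))=(X,BW)$) by tri-holomorphic isometries. If $l=p=q$, the action of $T^q$ on the $4q$-dimensional quotient has a unique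 fixed point.
   Context: $\theta=(\theta_\beta^\alpha)$ has rows $\theta_1,\dots,\theta_q\in\mathbb{R}^k$; $\langle\cdot,\cdot\rangle$ is the Euclidean inner product on $\mathbb{R}^k$, and $e_1,\dots,e_k$ is the standard orthonormal basis of $\mathbb{R}^k$. For $T\in\mathbb{R}^k$ and $W=(W_1,\dots,W_q)\in\mathbb{H}^q$ put $$\rho_\theta(T)W=(\langle T,\theta_1\rangle\, iW_1,\dots,\langle T,\theta_q\rangle\, iW_q),\qquad \theta(T)W=(e^{i\langle T,\theta_1\rangle}W_1,\dots,e^{i\langle T,\theta_q\rangle}W_q),$$ extended to $\mathbb{R}^s\times\mathbb{R}^k=\mathbb{R}^{4p}$ by letting $\mathbb{R}^s$ act trivially. $G_\theta$ is the simply connected Lie group with underlying manifold $\mathbb{R}^{4p}\times\mathbb{H}^q$ and product $(X,W)\cdot(X',W')=(X+X',\,W+\theta(X)W')$. Its left invariant hyper-Kähler structure: $g$ is the Euclidean metric on $\mathbb{R}^{4p}\times\mathbb{H}^q$; $J_1,J_2,J_3=J_1J_2$ are given on $\mathbb{H}^q$ by right multiplication by $-i,-j,-k$, and on $\mathbb{R}^{4p}$ by a triple of orthogonal constant endomorphisms satisfying the quaternion relations; $\omega_\alpha(\cdot,\cdot)=g(J_\alpha\cdot,\cdot)$. Identify $\mathbb{R}^{4p}\cong\mathbb{H}^p$ so that $J_1,J_2,J_3$ become right multiplication by $-i,-j,-k$, using a quaternionic basis of $\mathbb{R}^{4p}$ whose first $l$ elements are $e_1,\dots,e_l$ and such that,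 denoting the basis $e_1,\dots,e_p$ (for indices larger than $l$ these need not be the vectors of the basis of $\mathbb{R}^k$), $\{e_\alpha,e_\alpha i,e_\alpha j,e_\alpha k\}_{1\le\alpha\le p}$ is orthonormal; this is possible because $\mathfrak{l}$ is isotropic. Write $X=\sum_{\alpha=1}^p e_\alpha X_\alpha$ with $X_\alpha\in\mathbb{H}$. $\operatorname{Im}$ of a quaternion is its imaginary part. The hyper-Kähler moment map is the $L$-equivariant map $\mu^\theta=\mu_1^\theta i+\mu_2^\theta j+\mu_3^\theta k$ with $\mu^\theta_\alpha(X,W)(V)=\omega_\alpha(V,X)+\frac12\omega_\alpha(\rho_\theta(V)W,W)$ for $V\in\mathfrak{l}$ (so $d(\mu^\theta_\alpha(\cdot)(V))=\omega_\alpha(\mathcal{X}_V,\cdot)$, with $\mathcal{X}_V$ the vector field generated by $V$). The identification $\mathfrak{l}^*\otimes\operatorname{Im}\mathbb{H}\cong(\operatorname{Im}\mathbb{H})^l$ is by evaluation on $e_1,\dots,e_l$. $L\backslash(\mu^\theta)^{-1}(0)$ carries the hyper-Kähler structure given by the hyper-Kähler quotient construction. $T^q\subset Sp(q)$ is the maximal torus of elements $B=\operatorname{diag}(B(\phi_1),\dots,B(\phi_q))$, $\phi_\beta\in\mathbb{R}$, acting on $\mathbb{H}^q\cong\mathbb{R}^{4q}$ by $BW=(e^{i\phi_1}W_1,\dots,e^{i\phi_q}W_q)$. An isometry is tri-holomorphic if it preserves the three complex structures. *)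

theory Defs
  imports "HOL-Analysis.Analysis"
begin

section \<open>Quaternions\<close>

datatype quat = Quat (qRe: real) (qI: real) (qJ: real) (qK: real)

lemma quat_eqI: "qRe x = qRe y \<Longrightarrow> qI x = qI y \<Longrightarrow> qJ x = qJ y \<Longrightarrow> qK x = qK y \<Longrightarrow> x = y"
  by (cases x; cases y) auto

lemma quat_eq_iff: "x = y \<longleftrightarrow> qRe x = qRe y \<and> qI x = qI y \<and> qJ x = qJ y \<and> qK x = qK y"
  by (cases x; cases y) auto

instantiation quat :: ring_1
begin
definition "0 = Quat 0 0 0 0"
definition "1 = Quat 1 0 0 0"
definition "x + y = Quat (qRe x + qRe y) (qI x + qI y) (qJ x + qJ y) (qK x + qK y)"
definition "x - y = Quat (qRe x - qRe y) (qI x - qI y) (qJ x - qJ y) (qK x - qK y)"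
definition "- x = Quat (- qRe x) (- qI x) (- qJ x) (- qK x)"
definition "x * y = Quat
  (qRe x * qRe y - qI x * qI y - qJ x * qJ y - qK x * qK y)
  (qRe x * qI y + qI x * qRe y + qJ x * qK y - qK x * qJ y)
  (qRe x * qJ y - qI x * qK y + qJ x * qRe y + qK x * qI y)
  (qRe x * qK y + qI x * qJ y - qJ x * qI y + qK x * qRe y)"
instance
  by standard
    (auto simp: zero_quat_def one_quat_def plus_quat_def minus_quat_def uminus_quat_def
      times_quat_def algebra_simps)
end

lemma quat_zero_sel [simp]: "qRe 0 = 0" "qI 0 = 0" "qJ 0 = 0" "qK 0 = 0"
  and quat_one_sel [simp]: "qRe 1 = 1" "qI 1 = 0" "qJ 1 = 0" "qK 1 = 0"
  and quat_add_sel [simp]: "qRe (x + y) = qRe x + qRe y" "qI (x + y) = qI x + qI y"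
    "qJ (x + y) = qJ x + qJ y" "qK (x + y) = qK x + qK y"
  and quat_diff_sel [simp]: "qRe (x - y) = qRe x - qRe y" "qI (x - y) = qI x - qI y"
    "qJ (x - y) = qJ x - qJ y" "qK (x - y) = qK x - qK y"
  and quat_minus_sel [simp]: "qRe (- x) = - qRe x" "qI (- x) = - qI x"
    "qJ (- x) = - qJ x" "qK (- x) = - qK x"
  by (simp_all add: zero_quat_def one_quat_def plus_quat_def minus_quat_def uminus_quat_def)

lemma quat_mult_sel [simp]:
  "qRe (x * y) = qRe x * qRe y - qI x * qI y - qJ x * qJ y - qK x * qK y"
  "qI (x * y) = qRe x * qI y + qI x * qRe y + qJ x * qK y - qK x * qJ y"
  "qJ (x * y) = qRe x * qJ y - qI x * qK y + qJ x * qRe y + qK x * qI y"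
  "qK (x * y) = qRe x * qK y + qI x * qJ y - qJ x * qI y + qK x * qRe y"
  by (simp_all add: times_quat_def)

instantiation quat :: real_algebra_1
begin
definition "r *\<^sub>R x = Quat (r * qRe x) (r * qI x) (r * qJ x) (r * qK x)"
instance
  by standard (auto simp: scaleR_quat_def quat_eq_iff algebra_simps)
end

lemma quat_scaleR_sel [simp]: "qRe (r *\<^sub>R x) = r * qRe x" "qI (r *\<^sub>R x) = r * qI x"
    "qJ (r *\<^sub>R x) = r * qJ x" "qK (r *\<^sub>R x) = r * qK x"
  by (simp_all add: scaleR_quat_def)

instantiation quat :: real_inner
begin
definition "inner x y = qRe x * qRe y + qI x * qI y + qJ x * qJ y + qK x * qK y"
  for x y :: quat
definition "norm x = sqrt (inner x x)" for x :: quat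
definition "sgn x = x /\<^sub>R norm x" for x :: quat
definition "dist x y = norm (x - y)" for x y :: quat
definition [code del]:
  "(uniformity :: (quat \<times> quat) filter) = (INF e\<in>{0<..}. principal {(x, y). dist x y < e})"
definition [code del]:
  "open (U :: quat set) \<longleftrightarrow> (\<forall>x\<in>U. eventually (\<lambda>(x', y). x' = x \<longrightarrow> y \<in> U) uniformity)"
instance
proof
  fix x y z :: quat and r :: real and U :: "quat set"
  show "inner x x = 0 \<longleftrightarrow> x = 0"
    by (auto simp: inner_quat_def quat_eq_iff add_nonneg_eq_0_iff)
qed (auto simp: inner_quat_def norm_quat_def sgn_quat_def dist_quat_def uniformity_quat_def
      open_quat_def algebra_simps)
end

abbreviation "qi \<equiv> Quat 0 1 0 0"
abbreviation "qj \<equiv> Quat 0 0 1 0"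
abbreviation "qk \<equiv> Quat 0 0 0 1"

instantiation quat :: euclidean_space
begin
definition "Basis = {1, qi, qj, qk}"
instance
proof
  fix u v :: quat
  show "(Basis :: quat set) \<noteq> {}" "finite (Basis :: quat set)"
    by (auto simp: Basis_quat_def)
  show "u \<in> Basis \<Longrightarrow> v \<in> Basis \<Longrightarrow> inner u v = (if u = v then 1 else 0)"
    by (auto simp: Basis_quat_def inner_quat_def quat_eq_iff)
  show "(\<forall>u\<in>Basis. inner v u = 0) \<longleftrightarrow> v = 0"
    by (auto simp: Basis_quat_def inner_quat_def quat_eq_iff[of v 0])
qed
end

definition qcnj :: "quat \<Rightarrow> quat"
  where "qcnj x = Quat (qRe x) (- qI x) (- qJ x) (- qK x)"

definition qIm :: "quat \<Rightarrow> quat"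
  where "qIm x = Quat 0 (qI x) (qJ x) (qK x)"

text \<open>\<open>e\<^sup>i\<^sup>t\<close>\<close>
definition qcis :: "real \<Rightarrow> quat"
  where "qcis t = Quat (cos t) (sin t) 0 0"

text \<open>The imaginary units \<open>i, j, k\<close>, numbered by \<open>1, 2, 3\<close>.\<close>
definition qunit :: "nat \<Rightarrow> quat"
  where "qunit \<alpha> = (if \<alpha> = 1 then qi else if \<alpha> = 2 then qj else qk)"


section \<open>Smooth spaces, quotients and tangent vectors\<close>

fun Ck_on :: "nat \<Rightarrow> 'a::euclidean_space set \<Rightarrow> ('a \<Rightarrow> 'b::real_normed_vector) \<Rightarrow> bool" where
  "Ck_on 0 U f \<longleftrightarrow> continuous_on U f"
| "Ck_on (Suc n) U f \<longleftrightarrow> (\<forall>x\<in>U. f differentiable at x) \<and>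
     (\<forall>v. Ck_on n U (\<lambda>x. frechet_derivative f (at x) v))"

text \<open>Infinite differentiability; the set \<open>U\<close> is always meant to be open.\<close>
definition smooth_on :: "'a::euclidean_space set \<Rightarrow> ('a \<Rightarrow> 'b::real_normed_vector) \<Rightarrow> bool"
  where "smooth_on U f \<longleftrightarrow> (\<forall>n. Ck_on n U f)"

text \<open>Smoothness on an arbitrary subset of a Euclidean space: local extendability to smooth maps.\<close>
definition smooth_on_subset :: "'a::euclidean_space set \<Rightarrow> ('a \<Rightarrow> 'b::real_normed_vector) \<Rightarrow> bool"
  where "smooth_on_subset S f \<longleftrightarrow>
    (\<forall>x\<in>S. \<exists>U g. open U \<and> x \<in> U \<and> smooth_on U g \<and> (\<forall>y\<in>S \<inter> U. g y = f y))"

text \<open>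
  Smooth structures are represented by their sheaf of smooth real functions (a functional structure
  in the sense of Bredon): a topology together with, for every open set \<open>U\<close>, the set of functions
  that are smooth on \<open>U\<close>. Only the values on \<open>U\<close> of a function in \<open>sp_funs X U\<close> are relevant.
  A smooth manifold of dimension \<open>n\<close> is such a space that is locally isomorphic to \<open>\<real>\<^sup>n\<close>.
\<close>
record 'a smooth_space =
  sp_top :: "'a topology"
  sp_funs :: "'a set \<Rightarrow> ('a \<Rightarrow> real) set"

abbreviation sp_points :: "'a smooth_space \<Rightarrow> 'a set"
  where "sp_points X \<equiv> topspace (sp_top X)"

text \<open>Globally defined smooth functions.\<close>
abbreviation sp_global :: "'a smooth_space \<Rightarrow> ('a \<Rightarrow> real) set"
  where "sp_global X \<equiv> sp_funs X (sp_points X)"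

text \<open>For an embedded submanifold \<open>S\<close> this is its usual smooth structure.\<close>
definition subset_space :: "'a::euclidean_space set \<Rightarrow> 'a smooth_space"
  where "subset_space S = \<lparr>sp_top = top_of_set S, sp_funs = (\<lambda>U. {f. smooth_on_subset U f})\<rparr>"

definition quotient_topology :: "'a topology \<Rightarrow> ('a \<Rightarrow> 'b) \<Rightarrow> 'b topology"
  where "quotient_topology T \<pi> =
    topology (\<lambda>U. U \<subseteq> \<pi> ` topspace T \<and> openin T {x \<in> topspace T. \<pi> x \<in> U})"

lemma openin_quotient_topology:
  "openin (quotient_topology T \<pi>) U \<longleftrightarrow>
     U \<subseteq> \<pi> ` topspace T \<and> openin T {x \<in> topspace T. \<pi> x \<in> U}"
proof -
  have "istopology (\<lambda>U. U \<subseteq> \<pi> ` topspace T \<and> openin T {x \<in> topspace T. \<pi> x \<in> U})"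
    unfolding istopology_def
  proof (intro conjI allI impI; (elim conjE)?)
    fix A B
    assume "openin T {x \<in> topspace T. \<pi> x \<in> A}" "openin T {x \<in> topspace T. \<pi> x \<in> B}"
    then have "openin T ({x \<in> topspace T. \<pi> x \<in> A} \<inter> {x \<in> topspace T. \<pi> x \<in> B})"
      by blast
    then show "openin T {x \<in> topspace T. \<pi> x \<in> A \<inter> B}"
      by (rule back_subst) auto
  next
    fix \<K> assume *: "\<forall>K\<in>\<K>. K \<subseteq> \<pi> ` topspace T \<and> openin T {x \<in> topspace T. \<pi> x \<in> K}"
    then have "openin T (\<Union>K\<in>\<K>. {x \<in> topspace T. \<pi> x \<in> K})"
      by blast
    then show "openin T {x \<in> topspace T. \<pi> x \<in> \<Union>\<K>}"
      by (rule back_subst) auto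
  qed auto
  then show ?thesis
    by (simp add: quotient_topology_def topology_inverse')
qed

lemma topspace_quotient_topology: "topspace (quotient_topology T \<pi>) = \<pi> ` topspace T"
proof -
  have "{x \<in> topspace T. \<pi> x \<in> \<pi> ` topspace T} = topspace T"
    by auto
  then have "openin (quotient_topology T \<pi>) (\<pi> ` topspace T)"
    by (simp add: openin_quotient_topology)
  then show ?thesis
    by (metis openin_quotient_topology openin_subset openin_topspace subset_antisym)
qed

text \<open>
  A function on (an open subset of) the quotient is smooth iff its pull-back is. Whenever the
  quotient manifold exists, i.e. there is a smooth structure making \<open>\<pi>\<close> a smooth
  submersion, that structure is this one.
\<close>
definition quotient_space :: "'a smooth_space \<Rightarrow> ('a \<Rightarrow> 'b) \<Rightarrow> 'b smooth_space"
  where "quotient_space X \<pi> =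
    \<lparr>sp_top = quotient_topology (sp_top X) \<pi>,
     sp_funs = (\<lambda>U. {f. f \<circ> \<pi> \<in> sp_funs X {x \<in> sp_points X. \<pi> x \<in> U}})\<rparr>"

definition smooth_map :: "'a smooth_space \<Rightarrow> 'b smooth_space \<Rightarrow> ('a \<Rightarrow> 'b) \<Rightarrow> bool"
  where "smooth_map X Y F \<longleftrightarrow> continuous_map (sp_top X) (sp_top Y) F \<and>
    (\<forall>U f. openin (sp_top Y) U \<longrightarrow> f \<in> sp_funs Y U \<longrightarrow>
       f \<circ> F \<in> sp_funs X {x \<in> sp_points X. F x \<in> U})"

definition diffeomorphism :: "'a smooth_space \<Rightarrow> 'b smooth_space \<Rightarrow> ('a \<Rightarrow> 'b) \<Rightarrow> bool"
  where "diffeomorphism X Y F \<longleftrightarrow> smooth_map X Y F \<and>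
    (\<exists>G. smooth_map Y X G \<and> (\<forall>x\<in>sp_points X. G (F x) = x) \<and> (\<forall>y\<in>sp_points Y. F (G y) = y))"

definition diffeomorphic :: "'a smooth_space \<Rightarrow> 'b smooth_space \<Rightarrow> bool"
  where "diffeomorphic X Y \<longleftrightarrow> (\<exists>F. diffeomorphism X Y F)"

text \<open>
  Tangent vectors of a smooth space are derivations of its algebra of smooth functions, namely the
  velocities at time \<open>0\<close> of smooth curves. They are set to \<open>0\<close> outside the algebra, so that equality
  of tangent vectors is equality of derivations.
\<close>
type_synonym 'a derivation = "('a \<Rightarrow> real) \<Rightarrow> real"

definition velocity :: "'a smooth_space \<Rightarrow> (real \<Rightarrow> 'a) \<Rightarrow> 'a derivation"
  where "velocity X c = (\<lambda>f. if f \<in> sp_global X then deriv (\<lambda>t. f (c t)) 0 else 0)"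

definition tangent_space :: "'a smooth_space \<Rightarrow> 'a \<Rightarrow> 'a derivation set"
  where "tangent_space X x =
    {velocity X c | c. smooth_map (subset_space (UNIV :: real set)) X c \<and> c 0 = x}"

text \<open>The differential of a smooth map \<open>F\<close> into \<open>Y\<close>, acting on derivations.\<close>
definition differential :: "'b smooth_space \<Rightarrow> ('a \<Rightarrow> 'b) \<Rightarrow> 'a derivation \<Rightarrow> 'b derivation"
  where "differential Y F D = (\<lambda>f. if f \<in> sp_global Y then D (f \<circ> F) else 0)"

text \<open>The tangent space of a submanifold \<open>S\<close> at \<open>x\<close> as a subspace of the ambient vector space.\<close>
definition tangent_vectors :: "'a::euclidean_space set \<Rightarrow> 'a \<Rightarrow> 'a set"
  where "tangent_vectors S x =
    {v. \<exists>c. smooth_on (UNIV :: real set) c \<and> (\<forall>t. c t \<in> S) \<and> c 0 = x \<and>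
       (c has_vector_derivative v) (at 0)}"

text \<open>
  The derivation of \<open>subset_space S\<close> at \<open>x\<close> given by a vector \<open>v\<close> tangent to \<open>S\<close>. A derivative of
  \<open>f\<close> within \<open>S\<close> need not be unique, but its value on vectors tangent to \<open>S\<close> is.
\<close>
definition dirderiv :: "'a::euclidean_space set \<Rightarrow> 'a \<Rightarrow> 'a \<Rightarrow> 'a derivation"
  where "dirderiv S x v =
    (\<lambda>f. if f \<in> sp_global (subset_space S) then frechet_derivative f (at x within S) v else 0)"


section \<open>The group and its hyper-Kaehler structure\<close>

text \<open>
  \<open>\<real>\<^sup>s \<times> \<real>\<^sup>k = \<real>\<^sup>4\<^sup>p\<close> is the type \<open>real ^ 'm\<close>, where \<open>CARD('m) = 4 * p\<close>; the injection
  \<open>\<kappa> :: 'k \<Rightarrow> 'm\<close> selects the coordinates of the factor \<open>\<real>\<^sup>k\<close>, and the remaining \<open>s\<close> coordinates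
  are those of \<open>\<real>\<^sup>s\<close>. In this way \<open>s = 0\<close> is allowed. The bijection
  \<open>en :: nat \<Rightarrow> 'k\<close> from \<open>{1..k}\<close> numbers the coordinates of \<open>\<real>\<^sup>k\<close>.
\<close>
type_synonym ('m, 'q) G = "(real ^ 'm) \<times> (quat ^ 'q)"

definition proj_k :: "('k \<Rightarrow> 'm) \<Rightarrow> real ^ 'm \<Rightarrow> real ^ ('k::finite)"
  where "proj_k \<kappa> X = (\<chi> a. X $ \<kappa> a)"

definition e_vec :: "('k \<Rightarrow> 'm) \<Rightarrow> (nat \<Rightarrow> 'k) \<Rightarrow> nat \<Rightarrow> real ^ ('m::finite)"
  where "e_vec \<kappa> en \<alpha> = axis (\<kappa> (en \<alpha>)) 1"

definition rho :: "real ^ 'k ^ 'q \<Rightarrow> ('k \<Rightarrow> 'm) \<Rightarrow> real ^ 'm \<Rightarrow> quat ^ 'q \<Rightarrow> quat ^ ('q::finite)"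
  where "rho \<theta> \<kappa> T W = (\<chi> \<beta>. (proj_k \<kappa> T \<bullet> \<theta> $ \<beta>) *\<^sub>R (qi * W $ \<beta>))"

definition theta_act :: "real ^ 'k ^ 'q \<Rightarrow> ('k \<Rightarrow> 'm) \<Rightarrow> real ^ 'm \<Rightarrow> quat ^ 'q \<Rightarrow> quat ^ ('q::finite)"
  where "theta_act \<theta> \<kappa> T W = (\<chi> \<beta>. qcis (proj_k \<kappa> T \<bullet> \<theta> $ \<beta>) * W $ \<beta>)"

definition G_mult :: "real ^ 'k ^ 'q \<Rightarrow> ('k \<Rightarrow> 'm) \<Rightarrow> ('m, 'q) G \<Rightarrow> ('m, 'q) G \<Rightarrow> ('m::finite, 'q::finite) G"
  where "G_mult \<theta> \<kappa> = (\<lambda>(X, W) (X', W'). (X + X', W + theta_act \<theta> \<kappa> X W'))"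

definition quaternionic_triple :: "(nat \<Rightarrow> 'a::real_inner \<Rightarrow> 'a) \<Rightarrow> bool"
  where "quaternionic_triple J \<longleftrightarrow>
    (\<forall>\<alpha>\<in>{1, 2, 3}. orthogonal_transformation (J \<alpha>) \<and> (\<forall>v. J \<alpha> (J \<alpha> v) = - v)) \<and>
    (\<forall>v. J 3 v = J 1 (J 2 v)) \<and> (\<forall>v. J 2 (J 1 v) = - J 3 v)"

definition J_H :: "nat \<Rightarrow> quat ^ 'q \<Rightarrow> quat ^ ('q::finite)"
  where "J_H \<alpha> W = (\<chi> \<beta>. W $ \<beta> * (- qunit \<alpha>))"

text \<open>
  The tangent bundle of the group is trivialised by its underlying vector space. In this
  trivialisation the left invariant metric is \<open>inner\<close>, and the left invariant complex structures are
  constant, since left multiplication by \<open>e\<^sup>i\<^sup>t\<close> commutes with right multiplications.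
\<close>
definition J_G :: "(nat \<Rightarrow> real ^ 'm \<Rightarrow> real ^ 'm) \<Rightarrow> nat \<Rightarrow> ('m, 'q) G \<Rightarrow> ('m::finite, 'q::finite) G"
  where "J_G J \<alpha> = (\<lambda>(X, W). (J \<alpha> X, J_H \<alpha> W))"

definition omega :: "('a \<Rightarrow> 'a) \<Rightarrow> 'a \<Rightarrow> 'a::real_inner \<Rightarrow> real"
  where "omega I u v = I u \<bullet> v"

definition isotropic :: "(nat \<Rightarrow> 'a \<Rightarrow> 'a) \<Rightarrow> 'a::real_inner set \<Rightarrow> bool"
  where "isotropic J V \<longleftrightarrow> (\<forall>\<alpha>\<in>{1, 2, 3}. \<forall>u\<in>V. \<forall>v\<in>V. omega (J \<alpha>) u v = 0)"

text \<open>
  The Lie algebra \<open>\<l>\<close>. As the exponential map of \<open>\<real>\<^sup>k\<close> is the identity, this set is also the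
  underlying set of the subgroup \<open>L\<close>.
\<close>
definition L_set :: "('k \<Rightarrow> 'm) \<Rightarrow> (nat \<Rightarrow> 'k) \<Rightarrow> nat \<Rightarrow> (real ^ ('m::finite)) set"
  where "L_set \<kappa> en l = span (e_vec \<kappa> en ` {1..l})"

definition L_orbit ::
    "real ^ 'k ^ 'q \<Rightarrow> ('k \<Rightarrow> 'm) \<Rightarrow> (nat \<Rightarrow> 'k) \<Rightarrow> nat \<Rightarrow> ('m, 'q) G \<Rightarrow> ('m::finite, 'q::finite) G set"
  where "L_orbit \<theta> \<kappa> en l x = {G_mult \<theta> \<kappa> (V, 0) x | V. V \<in> L_set \<kappa> en l}"

lemma G_mult_L: "G_mult \<theta> \<kappa> (V, 0) (X, W) = (V + X, theta_act \<theta> \<kappa> V W)"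
  by (simp add: G_mult_def)

text \<open>
  The moment map; \<open>\<l>\<^sup>* \<otimes> Im \<H>\<close> is regarded as the space of linear maps from
  \<open>\<l>\<close> to \<open>Im \<H>\<close>, so only arguments \<open>V \<in> \<l>\<close> are relevant.
\<close>
definition mu_comp :: "real ^ 'k ^ 'q \<Rightarrow> ('k \<Rightarrow> 'm) \<Rightarrow> (nat \<Rightarrow> real ^ 'm \<Rightarrow> real ^ 'm) \<Rightarrow> nat \<Rightarrow>
    ('m::finite, 'q::finite) G \<Rightarrow> real ^ 'm \<Rightarrow> real"
  where "mu_comp \<theta> \<kappa> J \<alpha> = (\<lambda>(X, W) V.
    omega (J \<alpha>) V X + (1 / 2) * omega (J_H \<alpha>) (rho \<theta> \<kappa> V W) W)"

definition mu :: "real ^ 'k ^ 'q \<Rightarrow> ('k \<Rightarrow> 'm) \<Rightarrow> (nat \<Rightarrow> real ^ 'm \<Rightarrow> real ^ 'm) \<Rightarrow>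
    ('m::finite, 'q::finite) G \<Rightarrow> real ^ 'm \<Rightarrow> quat"
  where "mu \<theta> \<kappa> J x V = mu_comp \<theta> \<kappa> J 1 x V *\<^sub>R qi + mu_comp \<theta> \<kappa> J 2 x V *\<^sub>R qj
    + mu_comp \<theta> \<kappa> J 3 x V *\<^sub>R qk"

text \<open>The vector field generated by \<open>V \<in> \<l>\<close>.\<close>
definition fundamental_field :: "real ^ 'k ^ 'q \<Rightarrow> ('k \<Rightarrow> 'm) \<Rightarrow> real ^ 'm \<Rightarrow>
    ('m::finite, 'q::finite) G \<Rightarrow> ('m, 'q) G"
  where "fundamental_field \<theta> \<kappa> V = (\<lambda>(X, W). (V, rho \<theta> \<kappa> V W))"

lemma fundamental_field:
  "((\<lambda>t. G_mult \<theta> \<kappa> (t *\<^sub>R V, 0) x) has_vector_derivative fundamental_field \<theta> \<kappa> V x) (at 0)"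
proof -
  obtain X W where x: "x = (X, W)" by fastforce
  have proj: "proj_k \<kappa> (t *\<^sub>R V) \<bullet> \<theta> $ \<beta> = t * (proj_k \<kappa> V \<bullet> \<theta> $ \<beta>)" for t \<beta>
    by (simp add: proj_k_def inner_vec_def sum_distrib_left mult.assoc)
  have qc: "qcis r * w = cos r *\<^sub>R w + sin r *\<^sub>R (qi * w)" for r w
    by (simp add: quat_eq_iff qcis_def)
  have 1: "((\<lambda>t. t *\<^sub>R V + X) has_vector_derivative V) (at 0)"
    by (auto intro!: derivative_eq_intros simp: has_vector_derivative_def)
  have comp: "((\<lambda>t. qcis (t * a) * w) has_vector_derivative a *\<^sub>R (qi * w)) (at 0)" for a w
    unfolding qc has_vector_derivative_def
    by (auto intro!: derivative_eq_intros)
  have 2: "((\<lambda>t. theta_act \<theta> \<kappa> (t *\<^sub>R V) W) has_vector_derivative rho \<theta> \<kappa> V W) (at 0)"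
    unfolding has_vector_derivative_def
  proof (subst has_derivative_componentwise_within, rule ballI)
    fix b :: "quat ^ 'b" assume "b \<in> Basis"
    then obtain \<beta> u where b: "b = axis \<beta> u" by (auto simp: Basis_vec_def)
    have "((\<lambda>t. (qcis (t * (proj_k \<kappa> V \<bullet> \<theta> $ \<beta>)) * W $ \<beta>) \<bullet> u) has_derivative
        (\<lambda>t. (t *\<^sub>R ((proj_k \<kappa> V \<bullet> \<theta> $ \<beta>) *\<^sub>R (qi * W $ \<beta>))) \<bullet> u)) (at 0)"
      using comp unfolding has_vector_derivative_def by (rule has_derivative_inner_left)
    then show "((\<lambda>t. theta_act \<theta> \<kappa> (t *\<^sub>R V) W \<bullet> b) has_derivative
        (\<lambda>t. (t *\<^sub>R rho \<theta> \<kappa> V W) \<bullet> b)) (at 0)"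
      by (simp add: b inner_axis theta_act_def rho_def proj del: scaleR_scaleR)
  qed
  show ?thesis
    unfolding x G_mult_L fundamental_field_def prod.case
    using 1 2 by (rule has_vector_derivative_Pair)
qed

text \<open>The defining properties of a moment map.\<close>

lemma mu_comp_has_derivative:
  fixes J :: "nat \<Rightarrow> real ^ 'm::finite \<Rightarrow> real ^ 'm" and x :: "('m, 'q::finite) G"
  shows "((\<lambda>x. mu_comp \<theta> \<kappa> J \<alpha> x V) has_derivative
    omega (J_G J \<alpha>) (fundamental_field \<theta> \<kappa> V x)) (at x)"
proof -
  let ?B = "\<lambda>U W :: quat ^ 'q. J_H \<alpha> (rho \<theta> \<kappa> V U) \<bullet> W"
  have B_eq: "?B U W = (\<Sum>\<beta>\<in>UNIV. (proj_k \<kappa> V \<bullet> \<theta> $ \<beta>) *\<^sub>R ((qi * U $ \<beta> * (- qunit \<alpha>)) \<bullet> W $ \<beta>))" for U W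
    by (simp add: inner_vec_def J_H_def rho_def scaleR_sum_right)
  have sym: "?B U W = ?B W U" for U W
    unfolding B_eq
    by (rule sum.cong) (auto simp: inner_quat_def qunit_def algebra_simps)
  have lin: "linear (\<lambda>U. J_H \<alpha> (rho \<theta> \<kappa> V U))"
    by (rule linearI) (auto simp: vec_eq_iff J_H_def rho_def algebra_simps)
  then have bl: "bounded_linear (\<lambda>U. J_H \<alpha> (rho \<theta> \<kappa> V U))"
    by (simp add: linear_conv_bounded_linear)
  have "((\<lambda>x. J \<alpha> V \<bullet> fst x + (1 / 2) * ?B (snd x) (snd x)) has_derivative
      (\<lambda>u. J \<alpha> V \<bullet> fst u + (1 / 2) * (?B (snd x) (snd u) + ?B (snd u) (snd x)))) (at x)"
    by (rule derivative_eq_intros bounded_linear.has_derivative[OF bl] refl | simp)+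
  moreover have "omega (J_G J \<alpha>) (fundamental_field \<theta> \<kappa> V x) =
      (\<lambda>u. J \<alpha> V \<bullet> fst u + (1 / 2) * (?B (snd x) (snd u) + ?B (snd u) (snd x)))"
    by (simp add: fun_eq_iff omega_def J_G_def fundamental_field_def split_def inner_prod_def
        sym[of "snd u" "snd x" for u])
  ultimately show ?thesis
    by (simp add: mu_comp_def omega_def split_def)
qed

lemma mu_comp_invariant:
  assumes "omega (J \<alpha>) V V' = 0"
  shows "mu_comp \<theta> \<kappa> J \<alpha> (G_mult \<theta> \<kappa> (V', 0) x) V = mu_comp \<theta> \<kappa> J \<alpha> x V"
proof -
  obtain X W where x: "x = (X, W)" by fastforce
  have q: "(qi * (qcis t * w) * (- qunit \<alpha>)) \<bullet> (qcis t * w) = (qi * w * (- qunit \<alpha>)) \<bullet> w" for t w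
  proof -
    have *: "qi * (qcis t * w) = qcis t * (qi * w)"
      by (simp add: quat_eq_iff qcis_def algebra_simps)
    have "(qcis t * u) \<bullet> (qcis t * v) = ((cos t)\<^sup>2 + (sin t)\<^sup>2) * (u \<bullet> v)" for u v
      by (simp only: inner_quat_def quat_mult_sel qcis_def quat.sel) algebra
    then show ?thesis
      unfolding * mult.assoc by simp
  qed
  show ?thesis
    using assms q
    by (simp add: x G_mult_L mu_comp_def omega_def inner_vec_def J_H_def rho_def theta_act_def
        distrib_left sum.distrib)
qed

definition mu_zero :: "real ^ 'k ^ 'q \<Rightarrow> ('k \<Rightarrow> 'm) \<Rightarrow> (nat \<Rightarrow> 'k) \<Rightarrow> nat \<Rightarrow>
    (nat \<Rightarrow> real ^ 'm \<Rightarrow> real ^ 'm) \<Rightarrow> ('m::finite, 'q::finite) G set"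
  where "mu_zero \<theta> \<kappa> en l J = {x. \<forall>V\<in>L_set \<kappa> en l. mu \<theta> \<kappa> J x V = 0}"

text \<open>
  The right \<open>\<H>\<close>-module structure on \<open>\<real>\<^sup>4\<^sup>p\<close> for which the three complex structures are right
  multiplication by \<open>-i, -j, -k\<close>; \<open>qscale J v h\<close> is \<open>v h\<close>.
\<close>
definition qscale :: "(nat \<Rightarrow> 'a \<Rightarrow> 'a) \<Rightarrow> 'a::real_vector \<Rightarrow> quat \<Rightarrow> 'a"
  where "qscale J v h = qRe h *\<^sub>R v - qI h *\<^sub>R J 1 v - qJ h *\<^sub>R J 2 v - qK h *\<^sub>R J 3 v"

definition quaternionic_basis ::
    "(nat \<Rightarrow> 'a \<Rightarrow> 'a) \<Rightarrow> (nat \<Rightarrow> 'a) \<Rightarrow> nat \<Rightarrow> nat \<Rightarrow> (nat \<Rightarrow> 'a::real_inner) \<Rightarrow> bool"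
  where "quaternionic_basis J e l p b \<longleftrightarrow>
    (\<forall>\<alpha>\<in>{1..l}. b \<alpha> = e \<alpha>) \<and>
    (\<forall>\<alpha>\<in>{1..p}. \<forall>\<beta>\<in>{1..p}. \<forall>h\<in>{1, qi, qj, qk}. \<forall>h'\<in>{1, qi, qj, qk}.
       qscale J (b \<alpha>) h \<bullet> qscale J (b \<beta>) h' = (if \<alpha> = \<beta> \<and> h = h' then 1 else 0)) \<and>
    span {qscale J (b \<alpha>) h | \<alpha> h. \<alpha> \<in> {1..p} \<and> h \<in> {1, qi, qj, qk}} = UNIV"


section \<open>The hyper-Kaehler quotient and the torus action\<close>

text \<open>The quotient of an \<open>L\<close>-invariant submanifold \<open>M\<close> of the group; its points are the orbits.\<close>
definition L_quotient :: "real ^ 'k ^ 'q \<Rightarrow> ('k \<Rightarrow> 'm) \<Rightarrow> (nat \<Rightarrow> 'k) \<Rightarrow> nat \<Rightarrow>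
    ('m::finite, 'q::finite) G set \<Rightarrow> ('m, 'q) G set smooth_space"
  where "L_quotient \<theta> \<kappa> en l M = quotient_space (subset_space M) (L_orbit \<theta> \<kappa> en l)"

text \<open>Vectors tangent to \<open>M\<close> at \<open>x\<close> and orthogonal to the fibre through \<open>x\<close> of the projection \<open>\<pi>\<close>.\<close>
definition horizontal :: "('a \<Rightarrow> 'a set) \<Rightarrow> 'a::euclidean_space set \<Rightarrow> 'a \<Rightarrow> 'a set"
  where "horizontal \<pi> M x = {v \<in> tangent_vectors M x. \<forall>u\<in>tangent_vectors (\<pi> x) x. u \<bullet> v = 0}"

definition d_proj :: "('a \<Rightarrow> 'a set) \<Rightarrow> 'a::euclidean_space set \<Rightarrow> 'a \<Rightarrow> 'a \<Rightarrow> 'a set derivation"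
  where "d_proj \<pi> M x v = differential (quotient_space (subset_space M) \<pi>) \<pi> (dirderiv M x v)"

text \<open>
  The structure (metric \<open>g\<close> and complex structures \<open>I\<close>) on the quotient of \<open>M\<close> provided by
  the hyper-Kaehler quotient construction: horizontal spaces are invariant under the complex
  structures \<open>J\<close> of the ambient space, and the differential of the projection restricted to
  horizontal spaces transports the metric and the complex structures to the quotient.
\<close>
definition hyperkaehler_quotient_structure ::
    "('a \<Rightarrow> 'a set) \<Rightarrow> 'a::euclidean_space set \<Rightarrow> (nat \<Rightarrow> 'a \<Rightarrow> 'a) \<Rightarrow>
     ('a set \<Rightarrow> 'a set derivation \<Rightarrow> 'a set derivation \<Rightarrow> real) \<Rightarrow>
     (nat \<Rightarrow> 'a set \<Rightarrow> 'a set derivation \<Rightarrow> 'a set derivation) \<Rightarrow> bool"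
  where "hyperkaehler_quotient_structure \<pi> M J g I \<longleftrightarrow>
    (\<forall>x\<in>M. \<forall>v\<in>horizontal \<pi> M x.
       (\<forall>w\<in>horizontal \<pi> M x. g (\<pi> x) (d_proj \<pi> M x v) (d_proj \<pi> M x w) = v \<bullet> w) \<and>
       (\<forall>\<alpha>\<in>{1, 2, 3}. J \<alpha> v \<in> horizontal \<pi> M x \<and>
          I \<alpha> (\<pi> x) (d_proj \<pi> M x v) = d_proj \<pi> M x (J \<alpha> v)))"

definition triholomorphic_isometry ::
    "'a smooth_space \<Rightarrow> ('a \<Rightarrow> 'a derivation \<Rightarrow> 'a derivation \<Rightarrow> real) \<Rightarrow>
     (nat \<Rightarrow> 'a \<Rightarrow> 'a derivation \<Rightarrow> 'a derivation) \<Rightarrow> ('a \<Rightarrow> 'a) \<Rightarrow> bool"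
  where "triholomorphic_isometry Q g I F \<longleftrightarrow> diffeomorphism Q Q F \<and>
    (\<forall>y\<in>sp_points Q. \<forall>D\<in>tangent_space Q y.
       (\<forall>D'\<in>tangent_space Q y.
          g (F y) (differential Q F D) (differential Q F D') = g y D D') \<and>
       (\<forall>\<alpha>\<in>{1, 2, 3}. I \<alpha> (F y) (differential Q F D) = differential Q F (I \<alpha> y D)))"

definition torus :: "(quat ^ 'q ^ ('q::finite)) set"
  where "torus = {(\<chi> \<beta> \<gamma>. if \<beta> = \<gamma> then qcis (\<phi> \<beta>) else 0) | \<phi> :: 'q \<Rightarrow> real. True}"

definition torus_act :: "quat ^ 'q ^ 'q \<Rightarrow> ('m, 'q) G \<Rightarrow> ('m::finite, 'q::finite) G"
  where "torus_act B = (\<lambda>(X, W). (X, B *v W))"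

text \<open>The map induced on orbits.\<close>
definition torus_act_quot :: "quat ^ 'q ^ 'q \<Rightarrow> ('m, 'q) G set \<Rightarrow> ('m::finite, 'q::finite) G set"
  where "torus_act_quot B y = torus_act B ` y"

end

theory Submission
  imports Defs
begin

text \<open>
  Left translation by \<open>V \<in> L\<close> is \<open>(X, W) \<mapsto> (V + X, \<theta>(V)W)\<close>. Because it translates the coordinates of
  \<open>X\<close> along \<open>e\<^sub>1, \<dots>, e\<^sub>l\<close>, the points at which these coordinates vanish form a global slice. The map
  \<open>to_slice\<close> moves every point within its orbit to this slice. It is smooth on the whole group, is
  constant on orbits and preserves the zero level \<open>M\<close> of the moment map, so that it induces a
  global smooth section of either quotient.

  Isotropy makes \<open>e\<^sub>1, \<dots>, e\<^sub>l\<close> orthonormal over the quaternions (\<open>qscale_inner\<close>), so the \<open>4 l\<close> vectors \<open>e\<^sub>\<alpha> h\<close>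
  with \<open>h \<in> {1, i, j, k}\<close> are orthonormal; a quaternionic Gram-Schmidt process extends them to a
  basis (\<open>quaternionic_basis_exists\<close>). The \<open>\<alpha>\<close>-th component of \<open>\<mu>\<close> along \<open>h \<noteq> 1\<close> is a quadratic function of
  \<open>W\<close> minus the coordinate of \<open>X\<close> along \<open>e\<^sub>\<alpha> h\<close>. This is the formula for \<open>\<mu>\<close>
  (\<open>moment_map_formula\<close>), and it shows that \<open>\<mu> = 0\<close> can be solved for these \<open>3 l\<close> coordinates.
  The solution is a smooth retraction \<open>retract\<close> of the group onto \<open>M\<close>. The slice of the whole
  group is a linear space of dimension \<open>4 p + 4 q - l\<close>, the slice of \<open>M\<close> a graph over a linear space of
  dimension \<open>4 p + 4 q - 4 l\<close>, and the slices are charts of the quotients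
  (\<open>diffeomorphic_quotient_slice\<close>).

  For the geometry of the quotient, tangent vectors of \<open>M\<close> are those orthogonal to \<open>J\<^sub>a \<xi>\<^sub>V\<close>
  (\<open>tangent_vectors_M\<close>) and those of the orbits are the \<open>\<xi>\<^sub>V\<close> (\<open>tangent_vectors_orb\<close>), where \<open>\<xi>\<^sub>V\<close> is the
  field generated by \<open>V \<in> L\<close>. Horizontal spaces are thus invariant under the complex structures. The
  projection is injective on them, because the derivative of \<open>to_slice\<close> has only vertical
  vectors in its kernel (\<open>dpi_inj_hor\<close>). Every tangent vector of the quotient is the image of a horizontal one,
  because curves lift along the section (\<open>tangent_space_Q\<close>). Horizontal spaces at points of one orbit are related by a
  phase rotation \<open>W\<^sub>\<beta> \<mapsto> e\<^sup>i\<^sup>\<phi> W\<^sub>\<beta>\<close> with \<open>\<phi>\<close> depending on \<open>\<beta>\<close>, an isometry commuting with the complex structures; so the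
  quotient structure is well defined (\<open>hyperkaehler_quotient_structure_exists\<close>). The torus acts by
  phase rotations too, and the same facts make it act by tri-holomorphic isometries.

  Finally, an orbit fixed by the torus has \<open>W = 0\<close>, and for \<open>l = p\<close> the equations \<open>\<mu> = 0\<close> then leave
  only \<open>X \<in> L\<close>, the orbit of the origin (\<open>unique_fixed_point\<close>).
\<close>

section \<open>Calculus of smooth maps\<close>

lemma Ck_on_cong:
  assumes "open U" "\<And>x. x \<in> U \<Longrightarrow> f x = g x" "Ck_on n U f"
  shows "Ck_on n U g"
  using assms(2,3)
proof (induction n arbitrary: f g)
  case 0
  then show ?case by (metis Ck_on.simps(1) continuous_on_cong)
next
  case (Suc n)
  have d: "g differentiable at x \<and> frechet_derivative g (at x) = frechet_derivative f (at x)"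
    if "x \<in> U" for x
  proof -
    have "(f has_derivative frechet_derivative f (at x)) (at x)"
      using Suc.prems(2) that frechet_derivative_works by auto
    then have "(g has_derivative frechet_derivative f (at x)) (at x)"
      using has_derivative_transform_within_open[OF _ \<open>open U\<close> that] Suc.prems(1) by blast
    then show ?thesis
      using differentiableI frechet_derivative_at by metis
  qed
  have "Ck_on n U (\<lambda>x. frechet_derivative g (at x) v)" for v
    using Suc.IH[of "\<lambda>x. frechet_derivative f (at x) v"] Suc.prems(2) d by auto
  then show ?case using d by simp
qed

text \<open>
  The recursive clause of \<open>Ck_on\<close> refers to \<open>frechet_derivative\<close>; this form accepts any known
  derivative instead.
\<close>
lemma Ck_on_SucI:
  assumes "open U" "\<And>x. x \<in> U \<Longrightarrow> (f has_derivative f' x) (at x)"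
    and "\<And>v. Ck_on n U (\<lambda>x. f' x v)"
  shows "Ck_on (Suc n) U f"
proof -
  have "f differentiable at x \<and> f' x = frechet_derivative f (at x)" if "x \<in> U" for x
    using assms(2)[OF that] differentiableI frechet_derivative_at by metis
  then have "Ck_on n U (\<lambda>x. frechet_derivative f (at x) v)" for v
    using Ck_on_cong[OF assms(1) _ assms(3)[of v]] by simp
  then show ?thesis
    using assms(2) by (auto intro: differentiableI)
qed

lemma Ck_on_Suc_has_derivative:
  "Ck_on (Suc n) U f \<Longrightarrow> x \<in> U \<Longrightarrow> (f has_derivative frechet_derivative f (at x)) (at x)"
  by (simp add: frechet_derivative_works)

lemma Ck_on_SucD: "Ck_on (Suc n) U f \<Longrightarrow> Ck_on n U f"
proof (induction n arbitrary: f)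
  case 0
  then show ?case
    by (auto intro!: continuous_at_imp_continuous_on differentiable_imp_continuous_within)
next
  case (Suc n)
  then show ?case by (metis Ck_on.simps(2))
qed

lemma Ck_on_subset: "Ck_on n U f \<Longrightarrow> V \<subseteq> U \<Longrightarrow> Ck_on n V f"
  by (induction n arbitrary: f) (auto intro: continuous_on_subset)

lemma Ck_on_local:
  assumes "open U" "\<And>x. x \<in> U \<Longrightarrow> \<exists>V. open V \<and> x \<in> V \<and> Ck_on n V f"
  shows "Ck_on n U f"
  using assms(2)
proof (induction n arbitrary: f)
  case 0
  show ?case
  proof -
    have "isCont f x" if "x \<in> U" for x
      using "0.prems"[OF that] continuous_on_eq_continuous_at by auto
    then show ?thesis by (simp add: continuous_at_imp_continuous_on)
  qed
next
  case (Suc n)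
  have "f differentiable at x" if "x \<in> U" for x
    using Suc.prems[OF that] by auto
  moreover have "Ck_on n U (\<lambda>x. frechet_derivative f (at x) v)" for v
    by (rule Suc.IH) (metis Suc.prems Ck_on.simps(2))
  ultimately show ?case by simp
qed

lemma Ck_on_const: "open U \<Longrightarrow> Ck_on n U (\<lambda>x. c)"
proof (induction n arbitrary: c)
  case (Suc n)
  show ?case by (rule Ck_on_SucI[where f' = "\<lambda>x v. 0"]) (use Suc in auto)
qed simp

lemma Ck_on_bounded_linear: "open U \<Longrightarrow> bounded_linear f \<Longrightarrow> Ck_on n U f"
proof (cases n)
  case 0
  assume "bounded_linear f"
  with 0 show ?thesis by (simp add: linear_continuous_on)
next
  case (Suc m)
  assume "open U" "bounded_linear f"
  then show ?thesis unfolding Suc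
    by (intro Ck_on_SucI[where f' = "\<lambda>x. f"] Ck_on_const bounded_linear_imp_has_derivative)
qed

lemma Ck_on_add:
  assumes "open U" "Ck_on n U f" "Ck_on n U g"
  shows "Ck_on n U (\<lambda>x. f x + g x)"
  using assms(2,3)
proof (induction n arbitrary: f g)
  case 0
  then show ?case by (simp add: continuous_on_add)
next
  case (Suc n)
  show ?case
  proof (rule Ck_on_SucI[OF assms(1)])
    show "((\<lambda>x. f x + g x) has_derivative
        (\<lambda>v. frechet_derivative f (at x) v + frechet_derivative g (at x) v)) (at x)" if "x \<in> U" for x
      using Suc.prems that by (intro has_derivative_add Ck_on_Suc_has_derivative)
    show "Ck_on n U (\<lambda>x. frechet_derivative f (at x) v + frechet_derivative g (at x) v)" for v
      using Suc by simp
  qed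
qed

lemma Ck_on_sum:
  assumes "open U" "\<And>i. i \<in> I \<Longrightarrow> Ck_on n U (f i)"
  shows "Ck_on n U (\<lambda>x. \<Sum>i\<in>I. f i x)"
  using assms(2)
  by (induction I rule: infinite_finite_induct)
    (simp_all add: Ck_on_const Ck_on_add assms(1))

lemma Ck_on_bilinear:
  assumes "bounded_bilinear pr" "open U" "Ck_on n U f" "Ck_on n U g"
  shows "Ck_on n U (\<lambda>x. pr (f x) (g x))"
  using assms(3,4)
proof (induction n arbitrary: f g)
  case 0
  then show ?case using bounded_bilinear.continuous_on[OF assms(1)] by simp
next
  case (Suc n)
  show ?case
  proof (rule Ck_on_SucI[OF assms(2)])
    show "((\<lambda>x. pr (f x) (g x)) has_derivative (\<lambda>v. pr (f x) (frechet_derivative g (at x) v)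
        + pr (frechet_derivative f (at x) v) (g x))) (at x)" if "x \<in> U" for x
      using Suc.prems that
      by (intro bounded_bilinear.FDERIV[OF assms(1)] Ck_on_Suc_has_derivative)
    show "Ck_on n U (\<lambda>x. pr (f x) (frechet_derivative g (at x) v)
        + pr (frechet_derivative f (at x) v) (g x))" for v
      using Suc by (intro Ck_on_add[OF assms(2)] Suc.IH) (simp_all add: Ck_on_SucD del: Ck_on.simps(2), simp_all)
  qed
qed

text \<open>
  By the chain rule the derivative of the composition in direction \<open>v\<close> is \<open>Dg (f x) (Df x v)\<close>.
  Expanding \<open>Df x v\<close> in the standard basis turns it into a sum of products of functions \<open>Df x v \<bullet> b\<close>
  and compositions \<open>Dg (f x) b\<close> with fixed directions, to which the induction hypothesis applies.
\<close>
lemma Ck_on_compose: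
  fixes f :: "'a::euclidean_space \<Rightarrow> 'b::euclidean_space" and g :: "'b \<Rightarrow> 'c::real_normed_vector"
  assumes "open U" "open V" "f ` U \<subseteq> V" "Ck_on n U f" "Ck_on n V g"
  shows "Ck_on n U (\<lambda>x. g (f x))"
  using assms(4,5)
proof (induction n arbitrary: g)
  case 0
  then show ?case using assms(3) continuous_on_compose2 by auto
next
  case (Suc n)
  show ?case
  proof (rule Ck_on_SucI[OF assms(1)])
    fix x assume x: "x \<in> U"
    then have df: "(f has_derivative frechet_derivative f (at x)) (at x)"
      and dg: "(g has_derivative frechet_derivative g (at (f x))) (at (f x))"
      using Suc.prems assms(3) by (blast intro: Ck_on_Suc_has_derivative)+
    let ?D = "frechet_derivative g (at (f x))"
    have lin: "linear ?D" using dg by (rule has_derivative_linear)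
    have D_eq: "?D w = (\<Sum>b\<in>Basis. (w \<bullet> b) *\<^sub>R ?D b)" for w
    proof -
      have "?D w = ?D (\<Sum>b\<in>Basis. (w \<bullet> b) *\<^sub>R b)" by (simp add: euclidean_representation)
      then show ?thesis using lin by (simp add: linear_sum linear_scale)
    qed
    have eq: "(\<lambda>v. ?D (frechet_derivative f (at x) v)) = (\<lambda>v. \<Sum>b\<in>Basis.
        (frechet_derivative f (at x) v \<bullet> b) *\<^sub>R frechet_derivative g (at (f x)) b)"
      by (intro ext D_eq)
    show "((\<lambda>x. g (f x)) has_derivative (\<lambda>v. \<Sum>b\<in>Basis.
        (frechet_derivative f (at x) v \<bullet> b) *\<^sub>R frechet_derivative g (at (f x)) b)) (at x)"
      using has_derivative_compose[OF df dg] unfolding eq .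
  next
    fix v
    have "Ck_on n U (\<lambda>x. frechet_derivative f (at x) v \<bullet> b)" for b
      using Suc.prems(1)
      by (intro Ck_on_bilinear[OF bounded_bilinear_inner assms(1)] Ck_on_const assms(1)) simp
    moreover have "Ck_on n U (\<lambda>x. frechet_derivative g (at (f x)) b)" for b
      using Suc.prems by (intro Suc.IH Ck_on_SucD[of n U f]) simp_all
    ultimately show "Ck_on n U (\<lambda>x. \<Sum>b\<in>Basis.
        (frechet_derivative f (at x) v \<bullet> b) *\<^sub>R frechet_derivative g (at (f x)) b)"
      by (intro Ck_on_sum Ck_on_bilinear[OF bounded_bilinear_scaleR] assms(1))
  qed
qed

lemma smooth_on_bounded_linear: "bounded_linear f \<Longrightarrow> smooth_on UNIV f"
  by (simp add: smooth_on_def Ck_on_bounded_linear)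

lemma smooth_on_linear:
  fixes f :: "'a::euclidean_space \<Rightarrow> 'b::real_normed_vector"
  shows "linear f \<Longrightarrow> smooth_on UNIV f"
  by (simp add: linear_conv_bounded_linear smooth_on_bounded_linear)

lemma smooth_on_const: "smooth_on UNIV (\<lambda>x. c)"
  by (simp add: smooth_on_def Ck_on_const)

lemma smooth_on_add:
  "smooth_on UNIV f \<Longrightarrow> smooth_on UNIV g \<Longrightarrow> smooth_on UNIV (\<lambda>x. f x + g x)"
  by (simp add: smooth_on_def Ck_on_add)

lemma smooth_on_sum:
  "(\<And>i. i \<in> I \<Longrightarrow> smooth_on UNIV (f i)) \<Longrightarrow> smooth_on UNIV (\<lambda>x. \<Sum>i\<in>I. f i x)"
  by (simp add: smooth_on_def Ck_on_sum)

lemma smooth_on_bilinear: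
  "bounded_bilinear pr \<Longrightarrow> smooth_on UNIV f \<Longrightarrow> smooth_on UNIV g \<Longrightarrow>
    smooth_on UNIV (\<lambda>x. pr (f x) (g x))"
  by (simp add: smooth_on_def Ck_on_bilinear)

lemma smooth_on_compose:
  fixes f :: "'a::euclidean_space \<Rightarrow> 'b::euclidean_space" and g :: "'b \<Rightarrow> 'c::real_normed_vector"
  shows "smooth_on UNIV g \<Longrightarrow> smooth_on UNIV f \<Longrightarrow> smooth_on UNIV (\<lambda>x. g (f x))"
  unfolding smooth_on_def using Ck_on_compose[of UNIV UNIV f _ g] by simp

lemma smooth_on_linear_compose:
  fixes f :: "'a::euclidean_space \<Rightarrow> 'b::euclidean_space" and g :: "'b \<Rightarrow> 'c::real_normed_vector"
  shows "linear g \<Longrightarrow> smooth_on UNIV f \<Longrightarrow> smooth_on UNIV (\<lambda>x. g (f x))"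
  by (simp add: smooth_on_linear smooth_on_compose)

lemma smooth_on_has_derivative:
  "smooth_on U f \<Longrightarrow> x \<in> U \<Longrightarrow> (f has_derivative frechet_derivative f (at x)) (at x)"
  unfolding smooth_on_def using Ck_on_Suc_has_derivative by blast

lemma smooth_on_continuous_on: "smooth_on U f \<Longrightarrow> continuous_on U f"
  unfolding smooth_on_def using Ck_on.simps(1) by blast

lemma smooth_on_Pair:
  fixes f :: "'a::euclidean_space \<Rightarrow> 'b::euclidean_space" and g :: "'a \<Rightarrow> 'c::euclidean_space"
  assumes "smooth_on UNIV f" "smooth_on UNIV g"
  shows "smooth_on UNIV (\<lambda>x. (f x, g x))"
proof -
  have "smooth_on UNIV (\<lambda>x. (f x, 0) + (0, g x))"
    by (intro smooth_on_add smooth_on_linear_compose[OF _ assms(1), of "\<lambda>y. (y, 0)"]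
        smooth_on_linear_compose[OF _ assms(2), of "\<lambda>y. (0, y)"]) (auto intro!: linearI)
  then show ?thesis by simp
qed

lemma vec_eq_sum_axis: "(x :: 'b::real_vector ^ 'n::finite) = (\<Sum>\<beta>\<in>UNIV. axis \<beta> (x $ \<beta>))"
  by (simp add: vec_eq_iff axis_def)

lemma linear_axis: "linear (axis \<beta> :: 'b::real_vector \<Rightarrow> 'b ^ 'n::finite)"
  by (intro linearI) (auto simp: axis_def vec_eq_iff)

lemma smooth_on_vec:
  fixes f :: "'a::euclidean_space \<Rightarrow> 'b::euclidean_space ^ 'n::finite"
  assumes "\<And>\<beta>. smooth_on UNIV (\<lambda>x. f x $ \<beta>)"
  shows "smooth_on UNIV f"
proof -
  have "smooth_on UNIV (\<lambda>x. \<Sum>\<beta>\<in>UNIV. axis \<beta> (f x $ \<beta>))"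
    by (intro smooth_on_sum smooth_on_linear_compose[OF linear_axis assms])
  then show ?thesis by (simp flip: vec_eq_sum_axis)
qed

lemma smooth_on_componentwise:
  fixes f :: "'a::euclidean_space \<Rightarrow> 'b::euclidean_space"
  assumes "\<And>b. b \<in> Basis \<Longrightarrow> smooth_on UNIV (\<lambda>x. f x \<bullet> b)"
  shows "smooth_on UNIV f"
proof -
  have "smooth_on UNIV (\<lambda>x. \<Sum>b\<in>Basis. (f x \<bullet> b) *\<^sub>R b)"
    by (intro smooth_on_sum smooth_on_bilinear[OF bounded_bilinear_scaleR] assms smooth_on_const)
  then show ?thesis by (simp add: euclidean_representation)
qed

lemma smooth_on_imp_subset: "smooth_on UNIV f \<Longrightarrow> smooth_on_subset S f"
  unfolding smooth_on_subset_def by blast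

lemma smooth_on_subset_cong:
  "(\<And>x. x \<in> S \<Longrightarrow> f x = g x) \<Longrightarrow> smooth_on_subset S f \<longleftrightarrow> smooth_on_subset S g"
  unfolding smooth_on_subset_def by (intro ball_cong refl) auto

lemma smooth_on_subset_compose:
  fixes f :: "'a::euclidean_space \<Rightarrow> 'b::euclidean_space" and g :: "'b \<Rightarrow> 'c::real_normed_vector"
  assumes "smooth_on_subset T g" "smooth_on UNIV f" "f ` S \<subseteq> T"
  shows "smooth_on_subset S (g \<circ> f)"
  unfolding smooth_on_subset_def
proof
  fix x assume x: "x \<in> S"
  then obtain U h where U: "open U" "f x \<in> U" "smooth_on U h" "\<forall>y\<in>T \<inter> U. h y = g y"
    using assms(1,3) unfolding smooth_on_subset_def by blast
  have "open (f -` U)"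
    using continuous_open_vimage[OF \<open>open U\<close>] smooth_on_continuous_on[OF assms(2)]
    by (simp add: continuous_on_open_vimage \<open>open U\<close>)
  moreover have "smooth_on (f -` U) (\<lambda>x. h (f x))"
    unfolding smooth_on_def
  proof
    fix n
    show "Ck_on n (f -` U) (\<lambda>x. h (f x))"
    proof (rule Ck_on_compose[OF \<open>open (f -` U)\<close> \<open>open U\<close>])
      show "Ck_on n (f -` U) f" "Ck_on n U h"
        using assms(2) U(3) unfolding smooth_on_def by (blast intro: Ck_on_subset[of n UNIV f])+
    qed auto
  qed
  ultimately show "\<exists>U g'. open U \<and> x \<in> U \<and> smooth_on U g' \<and> (\<forall>y\<in>S \<inter> U. g' y = (g \<circ> f) y)"
    using U assms(3) x by (intro exI[of _ "f -` U"] exI[of _ "\<lambda>x. h (f x)"]) auto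
qed

text \<open>
  Local extensions of a function on the whole space are restrictions of the function itself.
\<close>
lemma smooth_on_subset_UNIV: "smooth_on_subset UNIV f \<Longrightarrow> smooth_on UNIV f"
  unfolding smooth_on_def
proof
  fix n
  assume f: "smooth_on_subset UNIV f"
  show "Ck_on n UNIV f"
  proof (rule Ck_on_local)
    fix x :: 'a
    obtain U g where "open U" "x \<in> U" "smooth_on U g" "\<forall>y\<in>U. g y = f y"
      using f unfolding smooth_on_subset_def by (metis Int_UNIV_left UNIV_I)
    then show "\<exists>V. open V \<and> x \<in> V \<and> Ck_on n V f"
      using Ck_on_cong[of U g f n] unfolding smooth_on_def by blast
  qed simp
qed

lemma smooth_on_subset_differentiable:
  assumes "smooth_on_subset S f" "x \<in> S"
  shows "f differentiable (at x within S)"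
proof -
  obtain U g where U: "open U" "x \<in> U" "smooth_on U g" "\<forall>y\<in>S \<inter> U. g y = f y"
    using assms unfolding smooth_on_subset_def by blast
  have "(g has_derivative frechet_derivative g (at x)) (at x within S \<inter> U)"
    using smooth_on_has_derivative[OF U(3,2)] has_derivative_at_withinI by blast
  then have "(f has_derivative frechet_derivative g (at x)) (at x within S \<inter> U)"
    by (rule has_derivative_transform[rotated 2]) (use U assms(2) in auto)
  then have "(f has_derivative frechet_derivative g (at x)) (at x within S)"
    using at_within_nhd[of x U S "S \<inter> U"] U(1,2) by auto
  then show ?thesis by (rule differentiableI)
qed

lemma bounded_bilinear_quat_mult: "bounded_bilinear ((*) :: quat \<Rightarrow> quat \<Rightarrow> quat)"
  unfolding bilinear_conv_bounded_bilinear[symmetric] bilinear_def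
  by (auto intro!: linearI simp: algebra_simps)

lemma qcis_eq: "qcis t = cos t *\<^sub>R 1 + sin t *\<^sub>R qi"
  by (simp add: quat_eq_iff qcis_def)

lemma qcis_has_derivative: "(qcis has_derivative (\<lambda>h. h *\<^sub>R (qi * qcis t))) (at t)"
proof -
  have "((\<lambda>t. cos t *\<^sub>R 1 + sin t *\<^sub>R qi) has_derivative (\<lambda>h. h *\<^sub>R (qi * qcis t))) (at t)"
    by (auto intro!: derivative_eq_intros simp: quat_eq_iff qcis_def)
  then show ?thesis by (simp add: qcis_eq[abs_def])
qed

text \<open>
  The derivative of \<open>c e\<^sup>i\<^sup>t\<close> is \<open>(c i) e\<^sup>i\<^sup>t\<close>, a function of the same form. Carrying an arbitrary left
  factor through the induction therefore makes the hypothesis apply to the derivative.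
\<close>
lemma smooth_on_qcis: "smooth_on UNIV qcis"
proof -
  have "Ck_on n UNIV (\<lambda>t. c * qcis t)" for n c
  proof (induction n arbitrary: c)
    case 0
    have "continuous_on UNIV qcis"
      by (rule continuous_at_imp_continuous_on) (metis has_derivative_continuous qcis_has_derivative)
    then show ?case
      using bounded_bilinear.continuous_on[OF bounded_bilinear_quat_mult, of UNIV "\<lambda>t. c" qcis]
      by (simp add: continuous_on_const)
  next
    case (Suc n)
    show ?case
    proof (rule Ck_on_SucI)
      show "((\<lambda>t. c * qcis t) has_derivative (\<lambda>h. (h *\<^sub>R (c * qi)) * qcis t)) (at t)" for t
        using bounded_linear.has_derivative[OF bounded_bilinear.bounded_linear_right[OF
            bounded_bilinear_quat_mult] qcis_has_derivative]
        by (simp add: mult.assoc)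
      show "Ck_on n UNIV (\<lambda>t. (h *\<^sub>R (c * qi)) * qcis t)" for h
        by (rule Suc.IH)
    qed simp
  qed
  from this[of _ 1] show ?thesis by (simp add: smooth_on_def)
qed

section \<open>Maps between smooth spaces and their quotients\<close>

lemma subset_space_sel [simp]:
  "sp_top (subset_space S) = top_of_set S"
  "f \<in> sp_funs (subset_space S) U \<longleftrightarrow> smooth_on_subset U f"
  by (simp_all add: subset_space_def)

lemma quotient_space_points [simp]:
  "sp_points (quotient_space X \<pi>) = \<pi> ` sp_points X"
  by (simp add: quotient_space_def topspace_quotient_topology)

lemma quotient_space_funs:
  "f \<in> sp_funs (quotient_space X \<pi>) U \<longleftrightarrow> f \<circ> \<pi> \<in> sp_funs X {x \<in> sp_points X. \<pi> x \<in> U}"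
  by (simp add: quotient_space_def)

lemma quotient_space_global:
  "f \<in> sp_global (quotient_space X \<pi>) \<longleftrightarrow> f \<circ> \<pi> \<in> sp_global X"
proof -
  have "{x \<in> sp_points X. \<pi> x \<in> \<pi> ` sp_points X} = sp_points X" by auto
  then show ?thesis by (simp add: quotient_space_funs)
qed

lemma smooth_map_image: "smooth_map X Y F \<Longrightarrow> x \<in> sp_points X \<Longrightarrow> F x \<in> sp_points Y"
  unfolding smooth_map_def by (metis continuous_map_def Pi_iff)

lemma smooth_map_pullback_global:
  assumes "smooth_map X Y F" "f \<in> sp_global Y"
  shows "f \<circ> F \<in> sp_global X"
proof -
  have "{x \<in> sp_points X. F x \<in> sp_points Y} = sp_points X"
    using smooth_map_image[OF assms(1)] by blast
  then show ?thesis
    using assms unfolding smooth_map_def by (metis openin_topspace)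
qed

lemma smooth_map_compose:
  assumes F: "smooth_map X Y F" and G: "smooth_map Y Z G"
  shows "smooth_map X Z (G \<circ> F)"
  unfolding smooth_map_def
proof (intro conjI allI impI)
  show "continuous_map (sp_top X) (sp_top Z) (G \<circ> F)"
    using F G unfolding smooth_map_def by (blast intro: continuous_map_compose)
next
  fix U f assume "openin (sp_top Z) U" "f \<in> sp_funs Z U"
  then have "openin (sp_top Y) {y \<in> sp_points Y. G y \<in> U}"
    and "f \<circ> G \<in> sp_funs Y {y \<in> sp_points Y. G y \<in> U}"
    using G unfolding smooth_map_def by (blast intro: openin_continuous_map_preimage)+
  then have "f \<circ> G \<circ> F \<in> sp_funs X {x \<in> sp_points X. F x \<in> {y \<in> sp_points Y. G y \<in> U}}"
    using F unfolding smooth_map_def by blast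
  moreover have "{x \<in> sp_points X. F x \<in> {y \<in> sp_points Y. G y \<in> U}}
      = {x \<in> sp_points X. (G \<circ> F) x \<in> U}"
    using smooth_map_image[OF F] by auto
  ultimately show "f \<circ> (G \<circ> F) \<in> sp_funs X {x \<in> sp_points X. (G \<circ> F) x \<in> U}"
    by (simp add: comp_assoc)
qed

lemma smooth_map_projection: "smooth_map X (quotient_space X \<pi>) \<pi>"
  unfolding smooth_map_def
  by (auto simp: continuous_map_def quotient_space_funs topspace_quotient_topology
      quotient_space_def openin_quotient_topology)

text \<open>
  The universal property of the quotient: together with \<open>smooth_map_projection\<close> it reduces every
  smoothness question about quotients to one about maps between subsets of Euclidean spaces.
\<close>
lemma smooth_map_from_quotient:
  assumes "smooth_map X Y (F \<circ> \<pi>)"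
  shows "smooth_map (quotient_space X \<pi>) Y F"
  unfolding smooth_map_def
proof (intro conjI allI impI)
  show "continuous_map (sp_top (quotient_space X \<pi>)) (sp_top Y) F"
    unfolding continuous_map_def
  proof (intro conjI allI impI)
    show "F \<in> sp_points (quotient_space X \<pi>) \<rightarrow> sp_points Y"
      using smooth_map_image[OF assms] by auto
  next
    fix U assume "openin (sp_top Y) U"
    then have "openin (sp_top X) {x \<in> sp_points X. (F \<circ> \<pi>) x \<in> U}"
      using assms unfolding smooth_map_def by (blast intro: openin_continuous_map_preimage)
    moreover have "{x \<in> sp_points X. (F \<circ> \<pi>) x \<in> U} =
        {x \<in> sp_points X. \<pi> x \<in> {y \<in> \<pi> ` sp_points X. F y \<in> U}}"
      by auto
    ultimately show "openin (sp_top (quotient_space X \<pi>)) {y \<in> sp_points (quotient_space X \<pi>). F y \<in> U}"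
      by (auto simp: quotient_space_def openin_quotient_topology topspace_quotient_topology)
  qed
next
  fix U f assume "openin (sp_top Y) U" "f \<in> sp_funs Y U"
  then have "f \<circ> (F \<circ> \<pi>) \<in> sp_funs X {x \<in> sp_points X. (F \<circ> \<pi>) x \<in> U}"
    using assms unfolding smooth_map_def by blast
  moreover have "{x \<in> sp_points X. (F \<circ> \<pi>) x \<in> U} =
      {x \<in> sp_points X. \<pi> x \<in> {y \<in> \<pi> ` sp_points X. F y \<in> U}}"
    by auto
  ultimately show "f \<circ> F \<in> sp_funs (quotient_space X \<pi>) {y \<in> sp_points (quotient_space X \<pi>). F y \<in> U}"
    by (simp add: quotient_space_funs comp_assoc)
qed

lemma smooth_map_subset_space:
  fixes A :: "'a::euclidean_space \<Rightarrow> 'b::euclidean_space"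
  assumes "smooth_on UNIV A" "A ` S \<subseteq> T" "\<And>x. x \<in> S \<Longrightarrow> F x = A x"
  shows "smooth_map (subset_space S) (subset_space T) F"
  unfolding smooth_map_def
proof (intro conjI allI impI)
  have "continuous_on S A"
    using smooth_on_continuous_on[OF assms(1)] continuous_on_subset by blast
  then have "continuous_on S F" using assms(3) by (metis continuous_on_cong)
  then show "continuous_map (sp_top (subset_space S)) (sp_top (subset_space T)) F"
    using assms(2,3) by (auto simp: continuous_map_subtopology_eu continuous_map_in_subtopology)
next
  fix U f assume "openin (sp_top (subset_space T)) U" "f \<in> sp_funs (subset_space T) U"
  then have "smooth_on_subset {x \<in> S. F x \<in> U} (f \<circ> A)"
    using assms by (auto intro!: smooth_on_subset_compose[of U])
  then show "f \<circ> F \<in> sp_funs (subset_space S) {x \<in> sp_points (subset_space S). F x \<in> U}"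
    using assms(3) smooth_on_subset_cong[of "{x \<in> S. F x \<in> U}" "f \<circ> A" "f \<circ> F"] by simp
qed

text \<open>
  The linear coordinates of the ambient space are smooth functions on the subset, so a curve that
  is smooth in the sense of pull-backs has smooth coordinates.
\<close>
lemma smooth_curve_in_subset:
  fixes c :: "real \<Rightarrow> 'a::euclidean_space"
  assumes "smooth_map (subset_space UNIV) (subset_space S) c"
  shows "smooth_on UNIV c" "c t \<in> S"
proof -
  show "smooth_on UNIV c"
  proof (rule smooth_on_componentwise)
    fix b :: 'a
    have "(\<lambda>x. x \<bullet> b) \<in> sp_global (subset_space S)"
      by (simp add: smooth_on_imp_subset smooth_on_bounded_linear bounded_linear_inner_left)
    from smooth_map_pullback_global[OF assms this] show "smooth_on UNIV (\<lambda>t. c t \<bullet> b)"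
      by (auto simp: comp_def intro: smooth_on_subset_UNIV)
  qed
  show "c t \<in> S"
    using smooth_map_image[OF assms, of t] by simp
qed

lemma smooth_map_cong:
  assumes "\<And>x. x \<in> S \<Longrightarrow> F x = G x" "smooth_map (subset_space S) Y F"
  shows "smooth_map (subset_space S) Y G"
  unfolding smooth_map_def
proof (intro conjI allI impI)
  show "continuous_map (sp_top (subset_space S)) (sp_top Y) G"
    using assms unfolding smooth_map_def by (auto intro: continuous_map_eq)
next
  fix U f assume "openin (sp_top Y) U" "f \<in> sp_funs Y U"
  then have "smooth_on_subset {x \<in> S. F x \<in> U} (f \<circ> F)"
    using assms(2) unfolding smooth_map_def by simp
  moreover have "{x \<in> S. F x \<in> U} = {x \<in> S. G x \<in> U}"
    using assms(1) by auto
  ultimately show "f \<circ> G \<in> sp_funs (subset_space S) {x \<in> sp_points (subset_space S). G x \<in> U}"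
    using assms(1) smooth_on_subset_cong[of "{x \<in> S. G x \<in> U}" "f \<circ> F" "f \<circ> G"] by simp
qed

lemma smooth_map_descends:
  fixes A :: "'a::euclidean_space \<Rightarrow> 'b::euclidean_space"
  assumes "smooth_on UNIV A" "A ` M \<subseteq> N" "\<And>x. x \<in> M \<Longrightarrow> F (\<pi> x) = \<pi>' (A x)"
  shows "smooth_map (quotient_space (subset_space M) \<pi>) (quotient_space (subset_space N) \<pi>') F"
proof (rule smooth_map_from_quotient)
  have "smooth_map (subset_space M) (quotient_space (subset_space N) \<pi>') (\<pi>' \<circ> A)"
    using smooth_map_subset_space[OF assms(1,2)] smooth_map_projection by (rule smooth_map_compose) simp
  then show "smooth_map (subset_space M) (quotient_space (subset_space N) \<pi>') (F \<circ> \<pi>)"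
    by (rule smooth_map_cong[rotated]) (simp add: assms(3))
qed

text \<open>
  The choice of the representative is immaterial for functions that are constant on the fibres of \<open>\<pi>\<close>
  in \<open>M\<close>, which therefore descend to the quotient.
\<close>
definition on_classes :: "'a set \<Rightarrow> ('a \<Rightarrow> 'b) \<Rightarrow> ('a \<Rightarrow> 'c) \<Rightarrow> 'b \<Rightarrow> 'c"
  where "on_classes M \<pi> f y = f (SOME x. x \<in> M \<and> \<pi> x = y)"

lemma on_classes_eq:
  assumes "x \<in> M" "\<And>x y. x \<in> M \<Longrightarrow> y \<in> M \<Longrightarrow> \<pi> x = \<pi> y \<Longrightarrow> f x = f y"
  shows "on_classes M \<pi> f (\<pi> x) = f x"
proof -
  have "(SOME z. z \<in> M \<and> \<pi> z = \<pi> x) \<in> M \<and> \<pi> (SOME z. z \<in> M \<and> \<pi> z = \<pi> x) = \<pi> x"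
    by (rule someI[of _ x]) (simp add: assms(1))
  then show ?thesis unfolding on_classes_def by (intro assms) auto
qed

text \<open>
  \<open>F\<close> is a global chart of the quotient and \<open>S\<close> parametrises a slice, that is, a set meeting every
  fibre of \<open>\<pi>\<close> in \<open>M\<close> in one point.
\<close>
lemma diffeomorphic_quotient_Euclidean:
  fixes F :: "'a::euclidean_space \<Rightarrow> 'n::euclidean_space" and \<pi> :: "'a \<Rightarrow> 'b"
  assumes F: "smooth_on UNIV F" and S: "smooth_on UNIV S"
    and SM: "\<And>n. S n \<in> M" and FS: "\<And>n. F (S n) = n"
    and SF: "\<And>x. x \<in> M \<Longrightarrow> \<pi> (S (F x)) = \<pi> x"
    and inv: "\<And>x y. x \<in> M \<Longrightarrow> y \<in> M \<Longrightarrow> \<pi> x = \<pi> y \<Longrightarrow> F x = F y"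
  shows "diffeomorphic (quotient_space (subset_space M) \<pi>) (subset_space (UNIV :: 'n set))"
proof -
  define \<Phi> where "\<Phi> = on_classes M \<pi> F"
  have \<Phi>: "\<Phi> (\<pi> x) = F x" if "x \<in> M" for x
    unfolding \<Phi>_def by (rule on_classes_eq[OF that inv])
  have "smooth_map (quotient_space (subset_space M) \<pi>) (subset_space UNIV) \<Phi>"
    by (intro smooth_map_from_quotient smooth_map_subset_space[OF F]) (auto simp: \<Phi>)
  moreover have "smooth_map (subset_space UNIV) (quotient_space (subset_space M) \<pi>) (\<pi> \<circ> S)"
    by (rule smooth_map_compose[OF smooth_map_subset_space[OF S] smooth_map_projection]) (auto simp: SM)
  ultimately show ?thesis
    unfolding diffeomorphic_def diffeomorphism_def
    by (intro exI[of _ \<Phi>] conjI exI[of _ "\<pi> \<circ> S"]) (auto simp: \<Phi> SF SM FS)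
qed

text \<open>
  A map \<open>r\<close> that moves every point to a canonical representative of its class induces a global
  smooth section of \<open>\<pi>\<close>. Composing with it lifts smooth curves from the quotient to \<open>M\<close>.
\<close>
lemma lift_curve_to_slice:
  fixes r :: "'a::euclidean_space \<Rightarrow> 'a" and \<pi> :: "'a \<Rightarrow> 'b"
  assumes r: "smooth_on UNIV r" and rM: "r ` M \<subseteq> M"
    and \<pi>r: "\<And>x. x \<in> M \<Longrightarrow> \<pi> (r x) = \<pi> x"
    and inv: "\<And>x y. x \<in> M \<Longrightarrow> y \<in> M \<Longrightarrow> \<pi> x = \<pi> y \<Longrightarrow> r x = r y"
    and c: "smooth_map (subset_space UNIV) (quotient_space (subset_space M) \<pi>) (c :: real \<Rightarrow> 'b)"
    and x: "x \<in> M" "c 0 = \<pi> x"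
  obtains d where "smooth_on UNIV d" "\<And>t. d t \<in> M" "\<And>t. \<pi> (d t) = c t" "d 0 = r x"
proof -
  define \<sigma> where "\<sigma> = on_classes M \<pi> r"
  have \<sigma>: "\<sigma> (\<pi> x) = r x" if "x \<in> M" for x
    unfolding \<sigma>_def by (rule on_classes_eq[OF that inv])
  have "smooth_map (quotient_space (subset_space M) \<pi>) (subset_space M) \<sigma>"
    by (intro smooth_map_from_quotient smooth_map_subset_space[OF r rM]) (auto simp: \<sigma>)
  then have *: "smooth_map (subset_space UNIV) (subset_space M) (\<sigma> \<circ> c)"
    by (rule smooth_map_compose[OF c])
  have "\<pi> (\<sigma> (c t)) = c t" for t
    using smooth_map_image[OF c, of t] by (auto simp: \<sigma> \<pi>r)
  then show thesis
    using smooth_curve_in_subset[OF *] x \<sigma> by (intro that[of "\<sigma> \<circ> c"]) auto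
qed

text \<open>
  A derivative of \<open>f\<close> within \<open>S\<close> need not be unique, but the chain rule determines its value on the
  velocity of a curve in \<open>S\<close>.
\<close>
lemma dirderiv_along_curve:
  fixes c :: "real \<Rightarrow> 'a::euclidean_space"
  assumes f: "smooth_on_subset S f" and c: "\<And>t. c t \<in> S" "(c has_vector_derivative v) (at 0)"
  shows "((\<lambda>t. f (c t)) has_real_derivative dirderiv S (c 0) v f) (at 0)"
proof -
  let ?D = "frechet_derivative f (at (c 0) within S)"
  have D: "(f has_derivative ?D) (at (c 0) within S)"
    using smooth_on_subset_differentiable[OF f c(1)] frechet_derivative_works by blast
  have "(f has_derivative ?D) (at (c 0) within c ` UNIV)"
    using D c(1) by (metis has_derivative_subset image_subsetI)
  then have "((f \<circ> c) has_derivative (?D \<circ> (\<lambda>t. t *\<^sub>R v))) (at 0)"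
    using c(2) by (intro diff_chain_within) (auto simp: has_vector_derivative_def)
  moreover have "?D \<circ> (\<lambda>t. t *\<^sub>R v) = (*) (?D v)"
    using linear_scale[OF has_derivative_linear[OF D]] by (auto simp: mult.commute)
  ultimately show ?thesis
    using f by (simp add: has_field_derivative_def dirderiv_def comp_def)
qed

text \<open>
  Pushing a tangent vector forward to the quotient is the same as projecting a curve. Identities
  between pushed forward vectors thus become identities between curves in the quotient.
\<close>
lemma d_proj_eq_velocity:
  fixes c :: "real \<Rightarrow> 'a::euclidean_space"
  assumes "\<And>t. c t \<in> M" "(c has_vector_derivative v) (at 0)"
  shows "d_proj \<pi> M (c 0) v = velocity (quotient_space (subset_space M) \<pi>) (\<pi> \<circ> c)"
proof
  fix f
  show "d_proj \<pi> M (c 0) v f = velocity (quotient_space (subset_space M) \<pi>) (\<pi> \<circ> c) f"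
  proof (cases "f \<in> sp_global (quotient_space (subset_space M) \<pi>)")
    case True
    then have "f \<circ> \<pi> \<in> sp_global (subset_space M)"
      by (simp only: quotient_space_global)
    then have "smooth_on_subset M (f \<circ> \<pi>)" by simp
    from DERIV_imp_deriv[OF dirderiv_along_curve[OF this assms]] True show ?thesis
      unfolding d_proj_def differential_def velocity_def by simp
  next
    case False
    then show ?thesis
      unfolding d_proj_def differential_def velocity_def by (simp only: if_False)
  qed
qed

lemma d_proj_add:
  assumes "x \<in> M"
  shows "d_proj \<pi> M x (v + w) f = d_proj \<pi> M x v f + d_proj \<pi> M x w f"
proof (cases "f \<in> sp_global (quotient_space (subset_space M) \<pi>)")
  case True
  then have "f \<circ> \<pi> \<in> sp_global (subset_space M)"
    by (simp only: quotient_space_global)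
  then have *: "smooth_on_subset M (f \<circ> \<pi>)" by simp
  have "linear (frechet_derivative (f \<circ> \<pi>) (at x within M))"
    using smooth_on_subset_differentiable[OF * assms] by (rule linear_frechet_derivative)
  then show ?thesis
    using True * by (simp add: d_proj_def differential_def dirderiv_def linear_add)
next
  case False
  then show ?thesis unfolding d_proj_def differential_def by (simp only: if_False add_0_left)
qed

text \<open>
  The coordinates of an invariant smooth map \<open>r\<close> are smooth functions on the quotient. Two tangent
  vectors with the same image in the quotient differentiate them equally, hence have the same image
  under the derivative of \<open>r\<close>.
\<close>
lemma d_proj_separates:
  fixes r :: "'a::euclidean_space \<Rightarrow> 'b::euclidean_space"
  assumes r: "smooth_on UNIV r" and D: "(r has_derivative D) (at x)"
    and inv: "\<And>x y. x \<in> M \<Longrightarrow> y \<in> M \<Longrightarrow> \<pi> x = \<pi> y \<Longrightarrow> r x = r y"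
    and v: "v \<in> tangent_vectors M x" and w: "w \<in> tangent_vectors M x"
    and eq: "d_proj \<pi> M x v = d_proj \<pi> M x w"
  shows "D v = D w"
proof (rule euclidean_eqI)
  fix b :: 'b
  define f where "f y = on_classes M \<pi> r y \<bullet> b" for y
  have f: "f (\<pi> x) = r x \<bullet> b" if "x \<in> M" for x
    unfolding f_def by (subst on_classes_eq[where f = r, OF that inv]) (assumption | rule refl)+
  have "smooth_on UNIV (\<lambda>x. r x \<bullet> b)"
    by (rule smooth_on_bilinear[OF bounded_bilinear_inner r smooth_on_const])
  then have sm: "smooth_on_subset M (f \<circ> \<pi>)"
    using smooth_on_subset_cong[of M "f \<circ> \<pi>" "\<lambda>x. r x \<bullet> b"] f smooth_on_imp_subset by auto
  then have glob: "f \<in> sp_global (quotient_space (subset_space M) \<pi>)"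
    unfolding quotient_space_global by simp
  have "d_proj \<pi> M x v f = D v \<bullet> b" if vt: "v \<in> tangent_vectors M x" for v
  proof -
    obtain c where c: "\<And>t. c t \<in> M" "c 0 = x" "(c has_vector_derivative v) (at 0)"
      using vt unfolding tangent_vectors_def by blast
    have "((\<lambda>t. (f \<circ> \<pi>) (c t)) has_real_derivative dirderiv M x v (f \<circ> \<pi>)) (at 0)"
      using dirderiv_along_curve[OF sm c(1,3)] c(2) by simp
    then have 1: "((\<lambda>t. r (c t) \<bullet> b) has_real_derivative dirderiv M x v (f \<circ> \<pi>)) (at 0)"
      using f c(1) by simp
    have "((\<lambda>t. r (c t)) has_derivative (\<lambda>t. D (t *\<^sub>R v))) (at 0)"
      using c(2,3) D unfolding has_vector_derivative_def
      by (intro has_derivative_compose[of c _ 0 UNIV r D]) auto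
    then have "((\<lambda>t. r (c t) \<bullet> b) has_derivative (\<lambda>t. D (t *\<^sub>R v) \<bullet> b)) (at 0)"
      by (rule has_derivative_inner_left)
    moreover have "(\<lambda>t. D (t *\<^sub>R v) \<bullet> b) = (*) (D v \<bullet> b)"
      using linear_scale[OF has_derivative_linear[OF D]] by (auto simp: mult.commute)
    ultimately have "((\<lambda>t. r (c t) \<bullet> b) has_real_derivative D v \<bullet> b) (at 0)"
      by (simp add: has_field_derivative_def)
    then have "dirderiv M x v (f \<circ> \<pi>) = D v \<bullet> b"
      using 1 DERIV_unique by blast
    then show ?thesis
      using glob unfolding d_proj_def differential_def by (simp only: if_True)
  qed
  then show "D v \<bullet> b = D w \<bullet> b"
    using v w eq by metis
qed

lemma differential_velocity:
  assumes "smooth_map X Y F"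
  shows "differential Y F (velocity X c) = velocity Y (F \<circ> c)"
  using smooth_map_pullback_global[OF assms]
  by (auto simp: differential_def velocity_def comp_def)

section \<open>Orthonormal families and quaternionic frames\<close>

lemma orthonormal_family_independent:
  fixes u :: "'i \<Rightarrow> 'a::euclidean_space"
  assumes "finite I" "\<And>i j. i \<in> I \<Longrightarrow> j \<in> I \<Longrightarrow> u i \<bullet> u j = (if i = j then 1 else 0)"
  shows "inj_on u I" "independent (u ` I)" "dim (u ` I) = card I" "card I \<le> DIM('a)"
proof -
  show inj: "inj_on u I"
  proof (rule inj_onI)
    fix i j assume "i \<in> I" "j \<in> I" "u i = u j"
    then have "u i \<bullet> u j = 1" using assms(2)[of i i] by simp
    then show "i = j" using assms(2)[of i j] \<open>i \<in> I\<close> \<open>j \<in> I\<close> by (auto split: if_splits)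
  qed
  have "pairwise orthogonal (u ` I)"
    by (auto simp: pairwise_def orthogonal_def assms(2))
  moreover have "0 \<notin> u ` I"
    using assms(2) by force
  ultimately show ind: "independent (u ` I)"
    by (rule pairwise_orthogonal_independent)
  show *: "dim (u ` I) = card I"
    using dim_eq_card_independent[OF ind] card_image[OF inj] by simp
  show "card I \<le> DIM('a)"
    using dim_subset_UNIV[of "u ` I"] * by simp
qed

lemma dim_orthogonal_family:
  fixes u :: "'i \<Rightarrow> 'a::euclidean_space"
  assumes "finite I" "\<And>i j. i \<in> I \<Longrightarrow> j \<in> I \<Longrightarrow> u i \<bullet> u j = (if i = j then 1 else 0)"
  shows "dim {z. \<forall>i\<in>I. z \<bullet> u i = 0} + card I = DIM('a)"
proof -
  have "{z. \<forall>i\<in>I. z \<bullet> u i = 0} = {y \<in> UNIV. \<forall>x\<in>span (u ` I). orthogonal x y}"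
  proof safe
    fix z x assume z: "\<forall>i\<in>I. z \<bullet> u i = 0" and "x \<in> span (u ` I)"
    show "orthogonal x z"
      unfolding orthogonal_commute[of x]
      by (rule orthogonal_to_span[OF \<open>x \<in> _\<close>]) (use z in \<open>auto simp: orthogonal_def\<close>)
  next
    fix z i assume "\<forall>x\<in>span (u ` I). orthogonal x z" "i \<in> I"
    then show "z \<bullet> u i = 0"
      by (metis imageI orthogonal_def inner_commute span_base)
  qed auto
  then show ?thesis
    using dim_subspace_orthogonal_to_vectors[of "span (u ` I)" UNIV]
      orthonormal_family_independent(3)[of I u, OF assms] by simp
qed

lemma inner_sum_orthonormal:
  assumes "finite I" "\<And>i j. i \<in> I \<Longrightarrow> j \<in> I \<Longrightarrow> u i \<bullet> u j = (if i = j then 1 else 0)"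
    and "A \<subseteq> I" "j \<in> I"
  shows "(\<Sum>i\<in>A. f i *\<^sub>R u i) \<bullet> u j = (if j \<in> A then f j else 0)"
proof -
  have "(\<Sum>i\<in>A. f i *\<^sub>R u i) \<bullet> u j = (\<Sum>i\<in>A. if i = j then f i else 0)"
    unfolding inner_sum_left by (rule sum.cong) (use assms in auto)
  then show ?thesis using finite_subset[OF assms(3,1)] by simp
qed

lemma Basis_quat_inner:
  "h \<in> (Basis :: quat set) \<Longrightarrow> h' \<in> Basis \<Longrightarrow> h \<bullet> h' = (if h = h' then 1 else 0)"
  by (simp add: inner_Basis)

lemma DIM_quat [simp]: "DIM(quat) = 4"
  by (simp add: Basis_quat_def one_quat_def)

lemma quaternionic_tripleD:
  assumes "quaternionic_triple J"
  shows "a \<in> {1, 2, 3} \<Longrightarrow> linear (J a)"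
    "a \<in> {1, 2, 3} \<Longrightarrow> J a u \<bullet> J a v = u \<bullet> v"
    "a \<in> {1, 2, 3} \<Longrightarrow> J a (J a v) = - v"
    "J 1 (J 2 v) = J 3 v" "J 2 (J 1 v) = - J 3 v"
  using assms unfolding quaternionic_triple_def orthogonal_transformation_def by auto

lemma quaternionic_triple_skew:
  assumes "quaternionic_triple J" "a \<in> {1, 2, 3}"
  shows "J a u \<bullet> v = - (u \<bullet> J a v)"
proof -
  have "J a u \<bullet> J a (J a v) = u \<bullet> J a v"
    using quaternionic_tripleD(2)[OF assms] .
  then show ?thesis by (simp add: quaternionic_tripleD(3)[OF assms])
qed

lemma quaternionic_triple_products:
  assumes "quaternionic_triple J"
  shows "J 1 (J 3 v) = - J 2 v" "J 3 (J 1 v) = J 2 v" "J 2 (J 3 v) = J 1 v" "J 3 (J 2 v) = - J 1 v"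
proof -
  note D = quaternionic_tripleD[OF assms]
  have neg: "J a (- v) = - J a v" if "a \<in> {1, 2, 3}" for a v
    using D(1)[OF that] by (rule linear_neg)
  show 1: "J 1 (J 3 v) = - J 2 v" for v
    using D(3)[of 1 "J 2 v"] by (simp add: D(4) del: One_nat_def)
  show "J 3 (J 2 v) = - J 1 v" for v
    using D(3)[of 2 v] D(4)[of "J 2 v"] neg[of 1 v] by (simp del: One_nat_def)
  then show "J 2 (J 3 v) = J 1 v"
    using D(5)[of "J 2 v"] D(4) by (simp del: One_nat_def)
  show "J 3 (J 1 v) = J 2 v"
    using D(4)[of "J 1 v"] D(5)[of v] neg[of 1 "J 3 v"] 1 by (simp del: One_nat_def)
qed

text \<open>
  The vectors orthogonal to \<open>u, J\<^sub>1 u, J\<^sub>2 u, J\<^sub>3 u\<close> form a subspace invariant under the triple, since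
  each \<open>J\<^sub>b\<close> is skew and permutes these four vectors up to sign.
\<close>
lemma quaternionic_triple_preserves_orthogonal:
  assumes T: "quaternionic_triple J" and b: "b \<in> {1, 2, 3}"
    and "u \<bullet> v = 0" "\<And>a. a \<in> {1, 2, 3} \<Longrightarrow> J a u \<bullet> v = 0"
  shows "u \<bullet> J b v = 0" "a \<in> {1, 2, 3} \<Longrightarrow> J a u \<bullet> J b v = 0"
proof -
  have *: "J 1 u \<bullet> v = 0" "J 2 u \<bullet> v = 0" "J 3 u \<bullet> v = 0"
    using assms(4) by simp_all
  have "u \<bullet> J b v = - (J b u \<bullet> v)"
    using quaternionic_triple_skew[OF T b] by simp
  then show "u \<bullet> J b v = 0"
    using assms(4)[OF b] by simp
  assume a: "a \<in> {1, 2, 3}"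
  have "J a u \<bullet> J b v = - (J b (J a u) \<bullet> v)"
    using quaternionic_triple_skew[OF T b, of "J a u" v] by simp
  also have "\<dots> = 0"
    using a b quaternionic_triple_products[OF T] quaternionic_tripleD(3-5)[OF T] * assms(3) by auto
  finally show "J a u \<bullet> J b v = 0" .
qed

lemma quaternionic_triple_inner_self:
  "quaternionic_triple J \<Longrightarrow> a \<in> {1, 2, 3} \<Longrightarrow> v \<bullet> J a v = 0"
  using quaternionic_triple_skew[of J a v v] by (simp add: inner_commute)

text \<open>
  If \<open>v\<close> is orthogonal to \<open>J\<^sub>a w\<close> for all \<open>a\<close>, the quaternion valued hermitian product of \<open>v\<close> and \<open>w\<close>
  is real, and it can be pulled out of the real inner product.
\<close>
lemma qscale_inner:
  assumes T: "quaternionic_triple J" and "\<And>a. a \<in> {1, 2, 3} \<Longrightarrow> v \<bullet> J a w = 0"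
  shows "qscale J v h \<bullet> qscale J w h' = (v \<bullet> w) * (h \<bullet> h')"
proof -
  note P = quaternionic_triple_preserves_orthogonal
  have 0: "v \<bullet> J 1 w = 0" "v \<bullet> J 2 w = 0" "v \<bullet> J 3 w = 0"
    using assms(2) by simp_all
  note sk = quaternionic_triple_skew[OF T]
  have 1: "J 1 v \<bullet> w = 0" "J 2 v \<bullet> w = 0" "J 3 v \<bullet> w = 0"
    using 0 by (simp_all add: sk del: One_nat_def)
  have 2: "J a v \<bullet> J b w = - (v \<bullet> J a (J b w))" if "a \<in> {1, 2, 3}" for a b
    using sk[OF that] .
  have 3: "J 1 v \<bullet> J 1 w = v \<bullet> w" "J 2 v \<bullet> J 2 w = v \<bullet> w" "J 3 v \<bullet> J 3 w = v \<bullet> w"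
    using quaternionic_tripleD(2)[OF T] by simp_all
  have 4: "J 1 v \<bullet> J 2 w = 0" "J 1 v \<bullet> J 3 w = 0" "J 2 v \<bullet> J 1 w = 0"
    "J 2 v \<bullet> J 3 w = 0" "J 3 v \<bullet> J 1 w = 0" "J 3 v \<bullet> J 2 w = 0"
    using quaternionic_triple_products[OF T] quaternionic_tripleD(4,5)[OF T] 0 by (simp_all add: 2 del: One_nat_def)
  show ?thesis
    by (simp add: qscale_def inner_diff_left inner_diff_right inner_quat_def 0 1 3 4 algebra_simps
        del: One_nat_def)
qed

lemma qscale_one [simp]: "qscale J v 1 = v"
  by (simp add: qscale_def)

lemma qscale_qunit: "a \<in> {1, 2, 3} \<Longrightarrow> qscale J v (qunit a) = - J a v"
  by (auto simp: qscale_def qunit_def)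

lemma qscale_orthonormal_family:
  assumes "quaternionic_triple J"
    and "\<And>\<alpha> \<beta>. \<alpha> \<in> A \<Longrightarrow> \<beta> \<in> A \<Longrightarrow> b \<alpha> \<bullet> b \<beta> = (if \<alpha> = \<beta> then 1 else 0)"
    and "\<And>\<alpha> \<beta> a. \<alpha> \<in> A \<Longrightarrow> \<beta> \<in> A \<Longrightarrow> a \<in> {1, 2, 3} \<Longrightarrow> b \<alpha> \<bullet> J a (b \<beta>) = 0"
    and "i \<in> A \<times> Basis" "j \<in> A \<times> Basis"
  shows "qscale J (b (fst i)) (snd i) \<bullet> qscale J (b (fst j)) (snd j) = (if i = j then 1 else 0)"
  using assms(2-5)
  by (subst qscale_inner[OF assms(1)]) (auto simp: Basis_quat_inner split: if_splits)

text \<open>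
  One step of the quaternionic Gram-Schmidt process. The \<open>4 n\<close> real vectors of the frame do not span
  the space, so there is a unit vector orthogonal to all of them; orthogonality to \<open>J\<^sub>a (b \<alpha>)\<close>
  gives the remaining relations because \<open>J\<^sub>a\<close> is skew.
\<close>
lemma quaternionic_frame_extend:
  fixes J :: "nat \<Rightarrow> 'a::euclidean_space \<Rightarrow> 'a"
  assumes T: "quaternionic_triple J" and dim: "4 * n < DIM('a)"
    and o: "\<And>\<alpha> \<beta>. \<alpha> \<in> {1..n} \<Longrightarrow> \<beta> \<in> {1..n} \<Longrightarrow> b \<alpha> \<bullet> b \<beta> = (if \<alpha> = \<beta> then 1 else 0)"
    and i: "\<And>\<alpha> \<beta> a. \<alpha> \<in> {1..n} \<Longrightarrow> \<beta> \<in> {1..n} \<Longrightarrow> a \<in> {1, 2, 3} \<Longrightarrow> b \<alpha> \<bullet> J a (b \<beta>) = 0"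
  obtains v where "v \<bullet> v = 1" "\<And>\<alpha>. \<alpha> \<in> {1..n} \<Longrightarrow> b \<alpha> \<bullet> v = 0"
    "\<And>\<alpha> a. \<alpha> \<in> {1..n} \<Longrightarrow> a \<in> {1, 2, 3} \<Longrightarrow> b \<alpha> \<bullet> J a v = 0"
proof -
  define u where "u i = qscale J (b (fst i)) (snd i)" for i
  let ?I = "{1..n} \<times> (Basis :: quat set)"
  let ?C = "{z. \<forall>i\<in>?I. z \<bullet> u i = 0}"
  have "dim ?C + card ?I = DIM('a)"
    by (rule dim_orthogonal_family)
      (use qscale_orthonormal_family[of J "{1..n}" b, OF T o i] in \<open>auto simp: u_def\<close>)
  moreover have "card ?I = 4 * n"
    by (simp add: card_cartesian_product)
  ultimately have "dim ?C \<noteq> 0"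
    using dim by linarith
  then obtain w where w: "w \<in> ?C" "w \<noteq> 0"
    unfolding dim_eq_0 by blast
  define v where "v = w /\<^sub>R norm w"
  have vu: "v \<bullet> u i = 0" if "i \<in> ?I" for i
    using w(1) that unfolding v_def by (cases i) simp
  show thesis
  proof
    show "v \<bullet> v = 1"
      using w(2) by (simp add: v_def dot_square_norm power2_eq_square)
    fix \<alpha> assume \<alpha>: "\<alpha> \<in> {1..n}"
    show "b \<alpha> \<bullet> v = 0"
      using vu[of "(\<alpha>, 1)"] \<alpha> by (simp add: u_def inner_commute Basis_quat_def)
    fix a :: nat assume a: "a \<in> {1, 2, 3}"
    have "qunit a \<in> Basis" by (simp add: qunit_def Basis_quat_def)
    then have "J a (b \<alpha>) \<bullet> v = 0"
      using vu[of "(\<alpha>, qunit a)"] \<alpha> by (simp add: u_def inner_commute qscale_qunit[OF a])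
    then show "b \<alpha> \<bullet> J a v = 0"
      using quaternionic_triple_skew[OF T a] by simp
  qed
qed

text \<open>
  An isotropic orthonormal family is orthonormal over the quaternions. Hence it has at most \<open>p\<close>
  members and extends to a quaternionic orthonormal basis.
\<close>
lemma quaternionic_basis_exists:
  fixes J :: "nat \<Rightarrow> 'a::euclidean_space \<Rightarrow> 'a"
  assumes T: "quaternionic_triple J" and dim: "DIM('a) = 4 * p"
    and o: "\<And>\<alpha> \<beta>. \<alpha> \<in> {1..l} \<Longrightarrow> \<beta> \<in> {1..l} \<Longrightarrow> e \<alpha> \<bullet> e \<beta> = (if \<alpha> = \<beta> then 1 else 0)"
    and i: "\<And>\<alpha> \<beta> a. \<alpha> \<in> {1..l} \<Longrightarrow> \<beta> \<in> {1..l} \<Longrightarrow> a \<in> {1, 2, 3} \<Longrightarrow> e \<alpha> \<bullet> J a (e \<beta>) = 0"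
  shows "l \<le> p" "\<exists>b. quaternionic_basis J e l p b"
proof -
  have "card ({1..l} \<times> (Basis :: quat set)) \<le> DIM('a)"
    by (rule orthonormal_family_independent(4)[of _ "\<lambda>i. qscale J (e (fst i)) (snd i)"])
      (use qscale_orthonormal_family[of J "{1..l}" e, OF T o i] in auto)
  then show l: "l \<le> p" by (simp add: card_cartesian_product dim)
  have "\<exists>b. (\<forall>\<alpha>\<in>{1..l}. b \<alpha> = e \<alpha>) \<and>
      (\<forall>\<alpha>\<in>{1..n}. \<forall>\<beta>\<in>{1..n}. b \<alpha> \<bullet> b \<beta> = (if \<alpha> = \<beta> then 1 else 0)) \<and>
      (\<forall>\<alpha>\<in>{1..n}. \<forall>\<beta>\<in>{1..n}. \<forall>a\<in>{1, 2, 3}. b \<alpha> \<bullet> J a (b \<beta>) = 0)" if "l \<le> n" "n \<le> p" for n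
    using that
  proof (induction n rule: dec_induct)
    case base
    show ?case using o i by (intro exI[of _ e]) blast
  next
    case (step n)
    then obtain b where b: "\<forall>\<alpha>\<in>{1..l}. b \<alpha> = e \<alpha>"
      "\<forall>\<alpha>\<in>{1..n}. \<forall>\<beta>\<in>{1..n}. b \<alpha> \<bullet> b \<beta> = (if \<alpha> = \<beta> then 1 else 0)"
      "\<forall>\<alpha>\<in>{1..n}. \<forall>\<beta>\<in>{1..n}. \<forall>a\<in>{1, 2, 3}. b \<alpha> \<bullet> J a (b \<beta>) = 0"
      by auto
    obtain v where v: "v \<bullet> v = 1" "\<And>\<alpha>. \<alpha> \<in> {1..n} \<Longrightarrow> b \<alpha> \<bullet> v = 0"
      "\<And>\<alpha> a. \<alpha> \<in> {1..n} \<Longrightarrow> a \<in> {1, 2, 3} \<Longrightarrow> b \<alpha> \<bullet> J a v = 0"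
      by (rule quaternionic_frame_extend[OF T, of n b]) (use b step.prems dim in auto)
    have v': "v \<bullet> J a (b \<alpha>) = 0" if "\<alpha> \<in> {1..n}" "a \<in> {1, 2, 3}" for \<alpha> a
      using v(3)[OF that] quaternionic_triple_skew[OF T that(2), of v "b \<alpha>"]
      by (simp add: inner_commute)
    have v2: "v \<bullet> b \<alpha> = 0" if "\<alpha> \<in> {1..n}" for \<alpha>
      using v(2)[OF that] by (simp add: inner_commute)
    let ?b = "b(Suc n := v)"
    have split: P if "\<alpha> \<in> {1..Suc n}" "\<alpha> = Suc n \<Longrightarrow> ?b \<alpha> = v \<Longrightarrow> P"
      "\<alpha> \<in> {1..n} \<Longrightarrow> \<alpha> \<noteq> Suc n \<Longrightarrow> ?b \<alpha> = b \<alpha> \<Longrightarrow> P" for \<alpha> P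
      using that by (cases "\<alpha> = Suc n") auto
    have "\<forall>\<alpha>\<in>{1..l}. ?b \<alpha> = e \<alpha>"
      using b(1) step.hyps by auto
    moreover have "\<forall>\<alpha>\<in>{1..Suc n}. \<forall>\<beta>\<in>{1..Suc n}. ?b \<alpha> \<bullet> ?b \<beta> = (if \<alpha> = \<beta> then 1 else 0)"
    proof (intro ballI)
      fix \<alpha> \<beta> assume *: "\<alpha> \<in> {1..Suc n}" "\<beta> \<in> {1..Suc n}"
      show "?b \<alpha> \<bullet> ?b \<beta> = (if \<alpha> = \<beta> then 1 else 0)"
        by (rule split[OF *(1)]; rule split[OF *(2)])
          (simp_all del: fun_upd_apply atLeastAtMost_iff add: v(1,2) v2 b(2)[rule_format])
    qed
    moreover have "\<forall>\<alpha>\<in>{1..Suc n}. \<forall>\<beta>\<in>{1..Suc n}. \<forall>a\<in>{1, 2, 3}. ?b \<alpha> \<bullet> J a (?b \<beta>) = 0"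
    proof (intro ballI)
      fix \<alpha> \<beta> a :: nat assume *: "\<alpha> \<in> {1..Suc n}" "\<beta> \<in> {1..Suc n}" and a: "a \<in> {1, 2, 3}"
      show "?b \<alpha> \<bullet> J a (?b \<beta>) = 0"
        by (rule split[OF *(1)]; rule split[OF *(2)])
          (simp_all only: v(3)[OF _ a] v'[OF _ a] b(3)[rule_format, OF _ _ a]
            quaternionic_triple_inner_self[OF T a])
    qed
    ultimately show ?case by blast
  qed
  from this[OF l order_refl] obtain b where b': "\<forall>\<alpha>\<in>{1..l}. b \<alpha> = e \<alpha>"
    "\<forall>\<alpha>\<in>{1..p}. \<forall>\<beta>\<in>{1..p}. b \<alpha> \<bullet> b \<beta> = (if \<alpha> = \<beta> then 1 else 0)"
    "\<forall>\<alpha>\<in>{1..p}. \<forall>\<beta>\<in>{1..p}. \<forall>a\<in>{1, 2, 3}. b \<alpha> \<bullet> J a (b \<beta>) = 0"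
    by auto
  have b: "\<forall>\<alpha>\<in>{1..l}. b \<alpha> = e \<alpha>"
    "\<And>\<alpha> \<beta>. \<alpha> \<in> {1..p} \<Longrightarrow> \<beta> \<in> {1..p} \<Longrightarrow> b \<alpha> \<bullet> b \<beta> = (if \<alpha> = \<beta> then 1 else 0)"
    "\<And>\<alpha> \<beta> a. \<alpha> \<in> {1..p} \<Longrightarrow> \<beta> \<in> {1..p} \<Longrightarrow> a \<in> {1, 2, 3} \<Longrightarrow> b \<alpha> \<bullet> J a (b \<beta>) = 0"
    using b' by blast+
  define u where "u i = qscale J (b (fst i)) (snd i)" for i
  let ?I = "{1..p} \<times> (Basis :: quat set)"
  have on: "u i \<bullet> u j = (if i = j then 1 else 0)" if "i \<in> ?I" "j \<in> ?I" for i j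
    unfolding u_def using qscale_orthonormal_family[of J "{1..p}" b, OF T b(2,3) that] .
  have "dim (u ` ?I) = DIM('a)"
    using orthonormal_family_independent(3)[of ?I u] on by (simp add: card_cartesian_product dim)
  then have "span (u ` ?I) = UNIV"
    by (simp add: dim_eq_full)
  moreover have "u ` ?I = {qscale J (b \<alpha>) h | \<alpha> h. \<alpha> \<in> {1..p} \<and> h \<in> {1, qi, qj, qk}}"
  proof -
    have "u ` ?I = {qscale J (b \<alpha>) h | \<alpha> h. \<alpha> \<in> {1..p} \<and> h \<in> Basis}"
      unfolding u_def by force
    then show ?thesis unfolding Basis_quat_def .
  qed
  moreover have "\<forall>\<alpha>\<in>{1..p}. \<forall>\<beta>\<in>{1..p}. \<forall>h\<in>{1, qi, qj, qk}. \<forall>h'\<in>{1, qi, qj, qk}.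
       qscale J (b \<alpha>) h \<bullet> qscale J (b \<beta>) h' = (if \<alpha> = \<beta> \<and> h = h' then 1 else 0)"
  proof (intro ballI)
    fix \<alpha> \<beta> h h' assume "\<alpha> \<in> {1..p}" "\<beta> \<in> {1..p}" "h \<in> {1, qi, qj, qk}" "h' \<in> {1, qi, qj, qk}"
    then show "qscale J (b \<alpha>) h \<bullet> qscale J (b \<beta>) h' = (if \<alpha> = \<beta> \<and> h = h' then 1 else 0)"
      using on[of "(\<alpha>, h)" "(\<beta>, h')"]
      unfolding u_def Basis_quat_def mem_Times_iff fst_conv snd_conv prod.inject by blast
  qed
  ultimately have "quaternionic_basis J e l p b"
    unfolding quaternionic_basis_def using b(1) by simp
  then show "\<exists>b. quaternionic_basis J e l p b" by blast
qed

section \<open>Phase rotations\<close>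

lemma qcis_add: "qcis (s + t) = qcis s * qcis t"
  by (simp add: quat_eq_iff qcis_def cos_add sin_add)

lemma qcis_zero [simp]: "qcis 0 = 1"
  by (simp add: quat_eq_iff qcis_def)

lemma qi_qcis_commute: "qi * (qcis t * w) = qcis t * (qi * w)"
  by (simp add: quat_eq_iff qcis_def algebra_simps)

lemma qcis_mult_inner: "(qcis t * u) \<bullet> (qcis t * v) = u \<bullet> v"
proof -
  have "(qcis t * u) \<bullet> (qcis t * v) = ((cos t)\<^sup>2 + (sin t)\<^sup>2) * (u \<bullet> v)"
    by (simp only: inner_quat_def quat_mult_sel qcis_def quat.sel) algebra
  then show ?thesis by simp
qed

text \<open>
  Both actions on \<open>\<H>\<^sup>q\<close>, that of \<open>\<real>\<^sup>k\<close> through \<open>\<theta>\<close> and that of the torus, are of this form. As left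
  multiplications they commute with each other, with the \<open>J_H\<close> and with \<open>rho\<close>.
\<close>
definition phase :: "('q \<Rightarrow> real) \<Rightarrow> quat ^ 'q \<Rightarrow> quat ^ ('q::finite)"
  where "phase \<phi> W = (\<chi> \<beta>. qcis (\<phi> \<beta>) * W $ \<beta>)"

lemma phase_nth [simp]: "phase \<phi> W $ \<beta> = qcis (\<phi> \<beta>) * W $ \<beta>"
  by (simp add: phase_def)

lemma phase_phase: "phase \<phi> (phase \<psi> W) = phase (\<lambda>\<beta>. \<phi> \<beta> + \<psi> \<beta>) W"
  by (simp add: vec_eq_iff qcis_add mult.assoc)

lemma phase_commute: "phase \<phi> (phase \<psi> W) = phase \<psi> (phase \<phi> W)"
  by (simp add: phase_phase add.commute)

lemma phase_zero [simp]: "phase (\<lambda>\<beta>. 0) W = W"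
  by (simp add: vec_eq_iff)

lemma phase_inverse [simp]: "phase \<phi> (phase (\<lambda>\<beta>. - \<phi> \<beta>) W) = W" "phase (\<lambda>\<beta>. - \<phi> \<beta>) (phase \<phi> W) = W"
  by (simp_all add: phase_phase)

lemma linear_phase: "linear (phase \<phi>)"
  by (intro linearI) (auto simp: vec_eq_iff algebra_simps)

lemma phase_inner: "phase \<phi> U \<bullet> phase \<phi> W = U \<bullet> W"
  by (simp add: inner_vec_def qcis_mult_inner)

lemma phase_J_H: "J_H a (phase \<phi> W) = phase \<phi> (J_H a W)"
  by (simp add: vec_eq_iff J_H_def mult.assoc)

lemma rho_phase: "rho \<theta> \<kappa> V (phase \<phi> W) = phase \<phi> (rho \<theta> \<kappa> V W)"
  by (simp add: vec_eq_iff rho_def qi_qcis_commute)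

lemma theta_act_eq_phase: "theta_act \<theta> \<kappa> V = phase (\<lambda>\<beta>. proj_k \<kappa> V \<bullet> \<theta> $ \<beta>)"
  by (simp add: fun_eq_iff vec_eq_iff theta_act_def)

lemma linear_proj_k: "linear (proj_k \<kappa>)"
  by (intro linearI) (auto simp: vec_eq_iff proj_k_def)

lemma theta_act_add: "theta_act \<theta> \<kappa> (U + V) W = theta_act \<theta> \<kappa> U (theta_act \<theta> \<kappa> V W)"
  by (simp add: theta_act_eq_phase phase_phase linear_add[OF linear_proj_k] inner_add_left)

lemma theta_act_zero: "theta_act \<theta> \<kappa> 0 W = W"
  by (simp add: theta_act_eq_phase linear_0[OF linear_proj_k])

lemma linear_rho: "linear (rho \<theta> \<kappa> V)" "linear (\<lambda>V. rho \<theta> \<kappa> V W)"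
  by (auto intro!: linearI simp: vec_eq_iff rho_def linear_add[OF linear_proj_k]
      linear_scale[OF linear_proj_k] algebra_simps)

lemma linear_J_H: "linear (J_H a)"
  by (intro linearI) (auto simp: vec_eq_iff J_H_def algebra_simps)

lemma smooth_on_theta_act:
  fixes \<theta> :: "real ^ 'k ^ 'q::finite" and \<kappa> :: "'k \<Rightarrow> 'm::finite"
  shows "smooth_on UNIV (\<lambda>z. theta_act \<theta> \<kappa> (fst z) (snd z))"
proof (rule smooth_on_vec)
  fix \<beta>
  have "linear (\<lambda>z :: ('m, 'q) G. proj_k \<kappa> (fst z) \<bullet> \<theta> $ \<beta>)"
    by (intro linearI) (auto simp: linear_add[OF linear_proj_k] linear_scale[OF linear_proj_k]
        inner_add_left)
  moreover have "linear (\<lambda>z :: ('m, 'q) G. snd z $ \<beta>)"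
    by (intro linearI) auto
  ultimately show "smooth_on UNIV (\<lambda>z :: ('m, 'q) G. theta_act \<theta> \<kappa> (fst z) (snd z) $ \<beta>)"
    unfolding theta_act_eq_phase phase_nth
    by (intro smooth_on_bilinear[OF bounded_bilinear_quat_mult] smooth_on_compose[OF smooth_on_qcis]
        smooth_on_linear)
qed

lemma theta_act_has_derivative:
  fixes \<theta> :: "real ^ 'k ^ 'q::finite" and \<kappa> :: "'k \<Rightarrow> 'm::finite"
  shows "((\<lambda>z. theta_act \<theta> \<kappa> (fst z) (snd z)) has_derivative
    (\<lambda>d. theta_act \<theta> \<kappa> V (snd d) + rho \<theta> \<kappa> (fst d) (theta_act \<theta> \<kappa> V W))) (at (V, W))"
proof -
  let ?a = "\<lambda>z \<beta>. proj_k \<kappa> (fst z) \<bullet> \<theta> $ \<beta>"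
  have comp: "((\<lambda>z. qcis (?a z \<beta>) * snd z $ \<beta>) has_derivative
      (\<lambda>d. (theta_act \<theta> \<kappa> V (snd d) + rho \<theta> \<kappa> (fst d) (theta_act \<theta> \<kappa> V W)) $ \<beta>)) (at (V, W))" for \<beta>
  proof -
    have "linear (\<lambda>z :: ('m, 'q) G. ?a z \<beta>)"
      by (intro linearI) (auto simp: linear_add[OF linear_proj_k] linear_scale[OF linear_proj_k]
          inner_add_left)
    then have "((\<lambda>z. ?a z \<beta>) has_derivative (\<lambda>d. ?a d \<beta>)) (at (V, W))"
      by (simp add: linear_conv_bounded_linear bounded_linear_imp_has_derivative)
    from has_derivative_compose[OF this qcis_has_derivative]
    have 1: "((\<lambda>z. qcis (?a z \<beta>)) has_derivative (\<lambda>d. ?a d \<beta> *\<^sub>R (qi * qcis (?a (V, W) \<beta>)))) (at (V, W))" .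
    have "linear (\<lambda>z :: ('m, 'q) G. snd z $ \<beta>)"
      by (intro linearI) auto
    then have 2: "((\<lambda>z. snd z $ \<beta>) has_derivative (\<lambda>d. snd d $ \<beta>)) (at (V, W))"
      by (simp add: linear_conv_bounded_linear bounded_linear_imp_has_derivative)
    show ?thesis
      using bounded_bilinear.FDERIV[OF bounded_bilinear_quat_mult 1 2]
      by (simp add: theta_act_def rho_def mult.assoc)
  qed
  have "((\<lambda>z. \<Sum>\<beta>\<in>UNIV. axis \<beta> (qcis (?a z \<beta>) * snd z $ \<beta>)) has_derivative
      (\<lambda>d. \<Sum>\<beta>\<in>UNIV. axis \<beta> ((theta_act \<theta> \<kappa> V (snd d) + rho \<theta> \<kappa> (fst d) (theta_act \<theta> \<kappa> V W)) $ \<beta>)))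
      (at (V, W))"
    by (rule has_derivative_sum, rule bounded_linear.has_derivative[OF _ comp])
      (simp add: linear_axis flip: linear_conv_bounded_linear)
  moreover have "(\<Sum>\<beta>\<in>UNIV. axis \<beta> (qcis (?a z \<beta>) * snd z $ \<beta>)) = theta_act \<theta> \<kappa> (fst z) (snd z)" for z
    by (subst vec_eq_sum_axis[of "theta_act \<theta> \<kappa> (fst z) (snd z)"]) (simp add: theta_act_def)
  ultimately show ?thesis by (simp only: flip: vec_eq_sum_axis)
qed

text \<open>
  The phase rotations of the whole group; they are the linear parts of the left translations and,
  by \<open>torus_act_eq_phaseG\<close>, exactly the transformations of the torus.
\<close>
definition phaseG :: "('q \<Rightarrow> real) \<Rightarrow> ('m, 'q) G \<Rightarrow> ('m::finite, 'q::finite) G"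
  where "phaseG \<phi> z = (fst z, phase \<phi> (snd z))"

lemma linear_phaseG: "linear (phaseG \<phi>)"
  by (intro linearI) (auto simp: phaseG_def linear_add[OF linear_phase] linear_scale[OF linear_phase])

lemma phaseG_inner: "phaseG \<phi> u \<bullet> phaseG \<phi> v = u \<bullet> v"
  by (simp add: phaseG_def inner_prod_def phase_inner)

lemma phaseG_J_G: "J_G J a (phaseG \<phi> v) = phaseG \<phi> (J_G J a v)"
  by (simp add: phaseG_def J_G_def split_def phase_J_H)

lemma phaseG_inverse: "phaseG \<phi> (phaseG (\<lambda>\<beta>. - \<phi> \<beta>) z) = z" "phaseG (\<lambda>\<beta>. - \<phi> \<beta>) (phaseG \<phi> z) = z"
  by (simp_all add: phaseG_def)

lemma fundamental_field_phase:
  "fundamental_field \<theta> \<kappa> V (X, phase \<phi> (snd x)) = phaseG \<phi> (fundamental_field \<theta> \<kappa> V x)"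
  by (simp add: fundamental_field_def phaseG_def rho_phase split_def)

lemma linear_fundamental_field: "linear (\<lambda>V. fundamental_field \<theta> \<kappa> V x)"
  by (intro linearI) (auto simp: fundamental_field_def split_def linear_add[OF linear_rho(2)]
      linear_scale[OF linear_rho(2)])

lemma torus_act_diagonal:
  "torus_act (\<chi> \<beta> \<gamma>. if \<beta> = \<gamma> then qcis (\<phi> \<beta>) else 0) = phaseG \<phi>" (is "torus_act ?B = _")
proof -
  have "(?B *v W) $ \<beta> = qcis (\<phi> \<beta>) * W $ \<beta>" for W \<beta>
  proof -
    have "(?B *v W) $ \<beta> = (\<Sum>\<gamma>\<in>UNIV. if \<beta> = \<gamma> then qcis (\<phi> \<beta>) * W $ \<gamma> else 0)"
      unfolding matrix_vector_mult_def by (simp add: if_distrib[of "\<lambda>x. x * _"] cong: if_cong)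
    then show ?thesis by simp
  qed
  then show ?thesis
    by (simp add: fun_eq_iff torus_act_def phaseG_def vec_eq_iff)
qed

lemma torus_act_eq_phaseG:
  assumes "B \<in> torus"
  obtains \<phi> where "torus_act B = phaseG \<phi>"
proof -
  obtain \<phi> where "B = (\<chi> \<beta> \<gamma>. if \<beta> = \<gamma> then qcis (\<phi> \<beta>) else 0)"
    using assms unfolding torus_def by blast
  then have "torus_act B = phaseG \<phi>"
    by (simp only: torus_act_diagonal)
  then show thesis by (rule that)
qed

lemma phaseG_in_torus: "\<exists>B\<in>torus. torus_act B = phaseG \<phi>"
proof
  show "torus_act (\<chi> \<beta> \<gamma>. if \<beta> = \<gamma> then qcis (\<phi> \<beta>) else 0) = phaseG \<phi>"
    by (rule torus_act_diagonal)
  show "(\<chi> \<beta> \<gamma>. if \<beta> = \<gamma> then qcis (\<phi> \<beta>) else 0) \<in> torus"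
    unfolding torus_def by blast
qed

lemma quaternionic_triple_J_G:
  fixes J :: "nat \<Rightarrow> real ^ 'm::finite \<Rightarrow> real ^ 'm"
  assumes T: "quaternionic_triple J"
  shows "quaternionic_triple (J_G J :: nat \<Rightarrow> ('m, 'q::finite) G \<Rightarrow> _)"
proof -
  have in_J_H: "J_H a U \<bullet> J_H a W = U \<bullet> W" if "a \<in> {1, 2, 3}" for a and U W :: "quat ^ 'q"
    using that unfolding inner_vec_def
    by (intro sum.cong refl) (auto simp: J_H_def qunit_def inner_quat_def algebra_simps)
  have sq: "J_H a (J_H a W) = - W" if "a \<in> {1, 2, 3}" for a and W :: "quat ^ 'q"
    using that by (auto simp: vec_eq_iff J_H_def qunit_def quat_eq_iff)
  have p: "J_H 3 W = J_H 1 (J_H 2 W)" "J_H 2 (J_H 1 W) = - J_H 3 W" for W :: "quat ^ 'q"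
    by (auto simp: vec_eq_iff J_H_def qunit_def quat_eq_iff)
  have lin: "linear (J_G J a :: ('m, 'q) G \<Rightarrow> _)" if "a \<in> {1, 2, 3}" for a
    using quaternionic_tripleD(1)[OF T that]
    by (intro linearI) (auto simp: J_G_def split_def linear_add linear_scale
        linear_add[OF linear_J_H] linear_scale[OF linear_J_H])
  have "orthogonal_transformation (J_G J a :: ('m, 'q) G \<Rightarrow> _)" if a: "a \<in> {1, 2, 3}" for a
    unfolding orthogonal_transformation_def
    using lin[OF a] quaternionic_tripleD(2)[OF T a] in_J_H[OF a]
    by (simp add: J_G_def split_def inner_prod_def)
  moreover have "J_G J a (J_G J a v) = - v" if a: "a \<in> {1, 2, 3}" for a and v :: "('m, 'q) G"
    using quaternionic_tripleD(3)[OF T a] sq[OF a] by (simp add: J_G_def split_def prod_eq_iff)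
  moreover have "J_G J 3 v = J_G J 1 (J_G J 2 v)" "J_G J 2 (J_G J 1 v) = - J_G J 3 v"
    for v :: "('m, 'q) G"
    using quaternionic_tripleD(4,5)[OF T] p by (simp_all add: J_G_def split_def prod_eq_iff)
  ultimately show ?thesis
    unfolding quaternionic_triple_def by blast
qed

section \<open>The translation action of an isotropic subspace\<close>

locale isotropic_translations =
  fixes \<theta> :: "real ^ 'k ^ 'q::finite"
    and \<kappa> :: "'k::finite \<Rightarrow> 'm::finite"
    and en :: "nat \<Rightarrow> 'k"
    and J :: "nat \<Rightarrow> real ^ 'm \<Rightarrow> real ^ 'm"
    and l :: nat
  assumes inj_coords: "inj \<kappa>" and enum: "bij_betw en {1..CARD('k)} UNIV"
    and triple: "quaternionic_triple J"
    and l_le: "l \<le> CARD('k)"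
    and isotropic: "isotropic J (L_set \<kappa> en l)"
begin

abbreviation "e \<equiv> e_vec \<kappa> en"
abbreviation "L \<equiv> L_set \<kappa> en l"
abbreviation shift :: "real ^ 'm \<Rightarrow> ('m, 'q) G \<Rightarrow> ('m, 'q) G"
  where "shift V x \<equiv> G_mult \<theta> \<kappa> (V, 0) x"
abbreviation orb :: "('m, 'q) G \<Rightarrow> ('m, 'q) G set"
  where "orb \<equiv> L_orbit \<theta> \<kappa> en l"
abbreviation M :: "('m, 'q) G set"
  where "M \<equiv> mu_zero \<theta> \<kappa> en l J"
abbreviation \<xi> :: "real ^ 'm \<Rightarrow> ('m, 'q) G \<Rightarrow> ('m, 'q) G"
  where "\<xi> \<equiv> fundamental_field \<theta> \<kappa>"
abbreviation act :: "real ^ 'm \<Rightarrow> quat ^ 'q \<Rightarrow> quat ^ 'q"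
  where "act \<equiv> theta_act \<theta> \<kappa>"
abbreviation angle :: "real ^ 'm \<Rightarrow> 'q \<Rightarrow> real"
  where "angle V \<equiv> (\<lambda>\<beta>. proj_k \<kappa> V \<bullet> \<theta> $ \<beta>)"

lemma shift_eq: "shift V x = (V + fst x, act V (snd x))"
  by (cases x) (simp add: G_mult_L)

lemma shift_eq_phaseG: "shift V x = (V, 0) + phaseG (angle V) x"
  by (simp add: shift_eq phaseG_def theta_act_eq_phase)

lemma shift_shift: "shift U (shift V x) = shift (U + V) x"
  by (simp add: shift_eq theta_act_add add.assoc)

lemma shift_zero: "shift 0 x = x"
  by (simp add: shift_eq theta_act_zero)

lemma subspace_L: "subspace L"
  by (simp add: L_set_def)

lemma e_in_L: "\<alpha> \<in> {1..l} \<Longrightarrow> e \<alpha> \<in> L"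
  unfolding L_set_def by (intro span_base imageI)

lemma orb_eq_iff: "orb x = orb y \<longleftrightarrow> (\<exists>V\<in>L. y = shift V x)"
proof
  assume "orb x = orb y"
  moreover have "y \<in> orb y"
    unfolding L_orbit_def using subspace_0[OF subspace_L] shift_zero[of y] by force
  ultimately show "\<exists>V\<in>L. y = shift V x"
    unfolding L_orbit_def by blast
next
  assume "\<exists>V\<in>L. y = shift V x"
  then obtain V where V: "V \<in> L" "y = shift V x" by blast
  show "orb x = orb y"
  proof safe
    fix z assume "z \<in> orb x"
    then obtain U where U: "U \<in> L" "z = shift U x" unfolding L_orbit_def by blast
    have "z = shift (U - V) y" by (simp add: U V shift_shift)
    then show "z \<in> orb y" unfolding L_orbit_def using U V subspace_diff[OF subspace_L] by blast
  next
    fix z assume "z \<in> orb y"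
    then obtain U where U: "U \<in> L" "z = shift U y" unfolding L_orbit_def by blast
    have "z = shift (U + V) x" by (simp add: U V shift_shift)
    then show "z \<in> orb x" unfolding L_orbit_def using U V subspace_add[OF subspace_L] by blast
  qed
qed

lemma orb_shift: "V \<in> L \<Longrightarrow> orb (shift V x) = orb x"
  using orb_eq_iff[of x "shift V x"] by auto

lemma e_inner:
  assumes "\<alpha> \<in> {1..l}" "\<beta> \<in> {1..l}"
  shows "e \<alpha> \<bullet> e \<beta> = (if \<alpha> = \<beta> then 1 else 0)"
proof -
  have "\<alpha> \<in> {1..CARD('k)}" "\<beta> \<in> {1..CARD('k)}" using assms l_le by auto
  then have "\<kappa> (en \<alpha>) = \<kappa> (en \<beta>) \<longleftrightarrow> \<alpha> = \<beta>"
    using inj_coords enum unfolding bij_betw_def inj_on_def by blast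
  then show ?thesis by (simp add: e_vec_def inner_axis_axis)
qed

lemma e_J_e:
  assumes "\<alpha> \<in> {1..l}" "\<beta> \<in> {1..l}" "a \<in> {1, 2, 3}"
  shows "e \<alpha> \<bullet> J a (e \<beta>) = 0"
  using isotropic assms e_in_L unfolding isotropic_def omega_def by (metis inner_commute)

text \<open>
  The vectors \<open>e\<^sub>\<alpha>, e\<^sub>\<alpha> i, e\<^sub>\<alpha> j, e\<^sub>\<alpha> k\<close>, indexed by \<open>\<alpha>\<close> and a quaternion unit. Those with unit \<open>1\<close> span the
  Lie algebra of \<open>L\<close>; the others control the moment map.
\<close>
definition fvec :: "nat \<times> quat \<Rightarrow> real ^ 'm"
  where "fvec i = qscale J (e (fst i)) (snd i)"

abbreviation "frame \<equiv> {1..l} \<times> (Basis :: quat set)"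
abbreviation "frameL \<equiv> {1..l} \<times> {1 :: quat}"
abbreviation "frameJ \<equiv> {1..l} \<times> {qi, qj, qk}"

lemma frame_subsets: "frameL \<subseteq> frame" "frameJ \<subseteq> frame" "frame = frameL \<union> frameJ" "frameL \<inter> frameJ = {}"
  by (auto simp: Basis_quat_def quat_eq_iff)

lemma fvec_orthonormal: "i \<in> frame \<Longrightarrow> j \<in> frame \<Longrightarrow> fvec i \<bullet> fvec j = (if i = j then 1 else 0)"
  unfolding fvec_def using qscale_orthonormal_family[of J "{1..l}" e, OF triple e_inner e_J_e] .

definition proj :: "(nat \<times> quat) set \<Rightarrow> real ^ 'm \<Rightarrow> real ^ 'm"
  where "proj A X = (\<Sum>i\<in>A. (X \<bullet> fvec i) *\<^sub>R fvec i)"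

lemma linear_proj: "linear (proj A)"
  unfolding proj_def by (intro linear_compose_sum ballI linearI) (auto simp: inner_add_left scaleR_add_left)

lemma proj_inner: "A \<subseteq> frame \<Longrightarrow> j \<in> frame \<Longrightarrow> proj A X \<bullet> fvec j = (if j \<in> A then X \<bullet> fvec j else 0)"
  unfolding proj_def by (rule inner_sum_orthonormal[of frame fvec]) (simp_all add: fvec_orthonormal)

lemma proj_L_in_L: "proj frameL X \<in> L"
  unfolding proj_def
  by (rule subspace_sum[OF subspace_L], rule subspace_scale[OF subspace_L])
    (auto simp: fvec_def e_in_L)

lemma proj_L_id:
  assumes "V \<in> L"
  shows "proj frameL V = V"
proof -
  have "proj frameL (e \<beta>) = e \<beta>" if \<beta>: "\<beta> \<in> {1..l}" for \<beta>
  proof -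
    have "proj frameL (e \<beta>) = (\<Sum>i\<in>frameL. if i = (\<beta>, 1) then e \<beta> else 0)"
      unfolding proj_def
    proof (rule sum.cong[OF refl])
      fix i assume "i \<in> frameL"
      then show "(e \<beta> \<bullet> fvec i) *\<^sub>R fvec i = (if i = (\<beta>, 1) then e \<beta> else 0)"
        using \<beta> e_inner[OF \<beta>] by (cases i) (auto simp: fvec_def)
    qed
    then show ?thesis using \<beta> by simp
  qed
  then have "e ` {1..l} \<subseteq> {V. proj frameL V = V}" by blast
  moreover have "subspace {V. proj frameL V = V}"
    by (simp add: subspace_def linear_0[OF linear_proj] linear_add[OF linear_proj]
        linear_scale[OF linear_proj])
  ultimately have "L \<subseteq> {V. proj frameL V = V}"
    unfolding L_set_def by (rule span_minimal)
  then show ?thesis using assms by blast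
qed

text \<open>
  As \<open>L\<close> translates the coordinates along \<open>e\<^sub>1, \<dots>, e\<^sub>l\<close>, every orbit meets the slice on which these
  coordinates vanish in exactly one point. This map sends a point to the point of its orbit in the slice.
\<close>
definition to_slice :: "('m, 'q) G \<Rightarrow> ('m, 'q) G"
  where "to_slice x = shift (- proj frameL (fst x)) x"

lemma orb_to_slice: "orb (to_slice x) = orb x"
  unfolding to_slice_def by (intro orb_shift subspace_neg[OF subspace_L] proj_L_in_L)

lemma to_slice_orb:
  assumes "orb x = orb y"
  shows "to_slice x = to_slice y"
proof -
  obtain V where V: "V \<in> L" "y = shift V x" using assms orb_eq_iff by blast
  have "proj frameL (fst y) = V + proj frameL (fst x)"
    using proj_L_id[OF V(1)] by (simp add: V(2) shift_eq linear_add[OF linear_proj])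
  then show ?thesis
    by (simp add: to_slice_def V(2) shift_shift)
qed

lemma proj_fst_to_slice: "proj frameL (fst (to_slice x)) = 0"
proof -
  have "proj frameL (proj frameL (fst x)) = proj frameL (fst x)"
    by (rule proj_L_id[OF proj_L_in_L])
  then show ?thesis
    by (simp add: to_slice_def shift_eq linear_add[OF linear_proj] linear_diff[OF linear_proj])
qed

lemma to_slice_fixed_iff: "to_slice x = x \<longleftrightarrow> proj frameL (fst x) = 0"
proof
  assume "to_slice x = x"
  then show "proj frameL (fst x) = 0" using proj_fst_to_slice[of x] by simp
next
  assume "proj frameL (fst x) = 0"
  then show "to_slice x = x" by (simp add: to_slice_def shift_zero)
qed

lemma linear_minus_proj_fst_snd: "linear (\<lambda>z :: ('m, 'q) G. (- proj A (fst z), snd z))"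
  by (intro linearI) (auto simp: linear_add[OF linear_proj] linear_scale[OF linear_proj])

lemma to_slice_eq: "to_slice = (\<lambda>z. (fst z - proj frameL (fst z), act (- proj frameL (fst z)) (snd z)))"
  by (simp add: fun_eq_iff to_slice_def shift_eq)

lemma smooth_on_to_slice: "smooth_on UNIV to_slice"
proof -
  have "smooth_on UNIV (\<lambda>z :: ('m, 'q) G. fst z - proj frameL (fst z))"
    by (intro smooth_on_linear linearI)
      (auto simp: linear_add[OF linear_proj] linear_scale[OF linear_proj] scaleR_diff_right)
  then show ?thesis
    unfolding to_slice_eq
    using smooth_on_compose[OF smooth_on_theta_act[where \<theta> = \<theta> and \<kappa> = \<kappa>] smooth_on_linear[OF linear_minus_proj_fst_snd]]
    by (intro smooth_on_Pair) auto
qed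

text \<open>
  Up to an isometry, the derivative of \<open>to_slice\<close> subtracts from \<open>d\<close> the vertical vector with the
  same \<open>L\<close>-component. Its kernel therefore consists of vertical vectors, which is what makes the
  projection to the quotient injective on horizontal vectors.
\<close>
lemma to_slice_has_derivative:
  "(to_slice has_derivative (\<lambda>d. phaseG (angle (- proj frameL (fst x))) (d - \<xi> (proj frameL (fst d)) x))) (at x)"
proof -
  let ?V = "- proj frameL (fst x)"
  have lin: "linear (\<lambda>z :: ('m, 'q) G. fst z - proj frameL (fst z))"
    by (intro linearI)
      (auto simp: linear_add[OF linear_proj] linear_scale[OF linear_proj] scaleR_diff_right)
  have 1: "((\<lambda>z :: ('m, 'q) G. fst z - proj frameL (fst z)) has_derivative
      (\<lambda>d. fst d - proj frameL (fst d))) (at x)"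
    using lin by (simp add: linear_conv_bounded_linear bounded_linear_imp_has_derivative)
  have "((\<lambda>z :: ('m, 'q) G. (- proj frameL (fst z), snd z)) has_derivative
      (\<lambda>d. (- proj frameL (fst d), snd d))) (at x)"
    using linear_minus_proj_fst_snd
    by (simp add: linear_conv_bounded_linear bounded_linear_imp_has_derivative)
  from has_derivative_compose[OF this theta_act_has_derivative]
  have 2: "((\<lambda>z. act (- proj frameL (fst z)) (snd z)) has_derivative
      (\<lambda>d. act ?V (snd d) + rho \<theta> \<kappa> (- proj frameL (fst d)) (act ?V (snd x)))) (at x)"
    by simp
  have "(\<lambda>d. (fst d - proj frameL (fst d),
        act ?V (snd d) + rho \<theta> \<kappa> (- proj frameL (fst d)) (act ?V (snd x)))) =
      (\<lambda>d. phaseG (angle ?V) (d - \<xi> (proj frameL (fst d)) x))"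
    by (simp add: fun_eq_iff phaseG_def fundamental_field_def split_def theta_act_eq_phase
        rho_phase linear_diff[OF linear_phase] linear_neg[OF linear_rho(2)] linear_neg[OF linear_phase])
  then show ?thesis
    using has_derivative_Pair[OF 1 2] unfolding to_slice_eq by simp
qed

section \<open>The zero level of the moment map\<close>

lemma mu_inner_qunit: "a \<in> {1, 2, 3} \<Longrightarrow> mu \<theta> \<kappa> J x V \<bullet> qunit a = mu_comp \<theta> \<kappa> J a x V"
  by (auto simp: mu_def qunit_def inner_quat_def)

lemma mu_eq_0_iff: "mu \<theta> \<kappa> J x V = 0 \<longleftrightarrow> (\<forall>a\<in>{1, 2, 3}. mu_comp \<theta> \<kappa> J a x V = 0)"
  by (simp add: mu_def quat_eq_iff)

lemma linear_mu_comp: "a \<in> {1, 2, 3} \<Longrightarrow> linear (mu_comp \<theta> \<kappa> J a x)"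
  by (intro linearI)
    (simp_all add: mu_comp_def split_def omega_def linear_add[OF quaternionic_tripleD(1)[OF triple]]
      linear_scale[OF quaternionic_tripleD(1)[OF triple]] linear_add[OF linear_rho(2)]
      linear_scale[OF linear_rho(2)] linear_add[OF linear_J_H] linear_scale[OF linear_J_H]
      inner_add_left algebra_simps del: insert_iff)

lemma mem_M_iff_mu_comp: "x \<in> M \<longleftrightarrow> (\<forall>V\<in>L. \<forall>a\<in>{1, 2, 3}. mu_comp \<theta> \<kappa> J a x V = 0)"
  by (simp only: mu_zero_def mem_Collect_eq mu_eq_0_iff)

text \<open>
  The moment map is linear on the Lie algebra, which \<open>e\<^sub>1, \<dots>, e\<^sub>l\<close> span.
\<close>
lemma mem_M_iff: "x \<in> M \<longleftrightarrow> (\<forall>\<alpha>\<in>{1..l}. \<forall>a\<in>{1, 2, 3}. mu_comp \<theta> \<kappa> J a x (e \<alpha>) = 0)"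
proof
  assume "x \<in> M"
  then show "\<forall>\<alpha>\<in>{1..l}. \<forall>a\<in>{1, 2, 3}. mu_comp \<theta> \<kappa> J a x (e \<alpha>) = 0"
    using e_in_L unfolding mem_M_iff_mu_comp by blast
next
  assume *: "\<forall>\<alpha>\<in>{1..l}. \<forall>a\<in>{1, 2, 3}. mu_comp \<theta> \<kappa> J a x (e \<alpha>) = 0"
  have "mu_comp \<theta> \<kappa> J a x V = 0" if "V \<in> L" and a: "a \<in> {1, 2, 3}" for V a
    using linear_eq_0_on_span[OF linear_mu_comp[OF a], of "e ` {1..l}" x V] * that
    unfolding L_set_def by blast
  then show "x \<in> M" unfolding mem_M_iff_mu_comp by blast
qed

lemma mem_M_iff_frame: "x \<in> M \<longleftrightarrow> (\<forall>i\<in>frameJ. mu \<theta> \<kappa> J x (e (fst i)) \<bullet> snd i = 0)"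
proof -
  have "qunit 1 = qi" "qunit 2 = qj" "qunit 3 = qk" by (simp_all add: qunit_def)
  then show ?thesis
    unfolding mem_M_iff using mu_inner_qunit[of 1] mu_inner_qunit[of 2] mu_inner_qunit[of 3]
    by (auto simp del: One_nat_def)
qed

lemma shift_in_M:
  assumes "V \<in> L" "x \<in> M"
  shows "shift V x \<in> M"
  unfolding mem_M_iff_mu_comp
proof (intro ballI)
  fix U a assume U: "U \<in> L" and a: "a \<in> {1, 2, 3 :: nat}"
  have "omega (J a) U V = 0" using isotropic U a assms(1) unfolding isotropic_def by blast
  then show "mu_comp \<theta> \<kappa> J a (shift V x) U = 0"
    using mu_comp_invariant assms(2) U a unfolding mem_M_iff_mu_comp by metis
qed

lemma to_slice_in_M: "x \<in> M \<Longrightarrow> to_slice x \<in> M"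
  unfolding to_slice_def by (intro shift_in_M subspace_neg[OF subspace_L] proj_L_in_L)

lemma phaseG_in_M: "x \<in> M \<Longrightarrow> phaseG \<phi> x \<in> M"
  unfolding mem_M_iff
  by (simp add: mu_comp_def phaseG_def split_def omega_def rho_phase phase_J_H phase_inner)

lemma phaseG_shift: "phaseG \<phi> (shift V x) = shift V (phaseG \<phi> x)"
  by (simp add: shift_eq phaseG_def theta_act_eq_phase phase_commute)

lemma phaseG_orb: "phaseG \<phi> ` orb x = orb (phaseG \<phi> x)"
proof -
  have "orb y = (\<lambda>V. shift V y) ` L" for y unfolding L_orbit_def by blast
  then show ?thesis by (simp add: image_image phaseG_shift)
qed

text \<open>
  The moment map is affine in the translation coordinates: a translation lowers its component at
  \<open>(V, h)\<close> by the coordinate of the translation along \<open>V h\<close>. So the equations \<open>\<mu> = 0\<close> can be solved for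
  the coordinates along the frame vectors indexed by \<open>frameJ\<close>.
\<close>
lemma mu_translate:
  assumes "h \<in> {qi, qj, qk}"
  shows "mu \<theta> \<kappa> J (X + Y, W) V \<bullet> h = mu \<theta> \<kappa> J (X, W) V \<bullet> h - Y \<bullet> qscale J V h"
proof -
  have "{qi, qj, qk} = qunit ` {1, 2, 3}" by (auto simp: qunit_def)
  then obtain a where a: "a \<in> {1, 2, 3}" "h = qunit a" using assms by blast
  show ?thesis
    unfolding a(2) mu_inner_qunit[OF a(1)] qscale_qunit[OF a(1)]
    by (simp add: mu_comp_def omega_def inner_add_right inner_add_left inner_commute)
qed

text \<open>
  Adjusting the coordinates along \<open>frameJ\<close> retracts the whole group smoothly onto the zero level. This
  exhibits the level as a graph and produces curves in it with prescribed velocity.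
\<close>
definition retract :: "('m, 'q) G \<Rightarrow> ('m, 'q) G"
  where "retract x = (fst x + (\<Sum>i\<in>frameJ. (mu \<theta> \<kappa> J x (e (fst i)) \<bullet> snd i) *\<^sub>R fvec i), snd x)"

lemma retract_in_M: "retract x \<in> M"
  unfolding mem_M_iff_frame
proof
  fix j assume j: "j \<in> frameJ"
  let ?Y = "\<Sum>i\<in>frameJ. (mu \<theta> \<kappa> J x (e (fst i)) \<bullet> snd i) *\<^sub>R fvec i"
  have "?Y \<bullet> fvec j = mu \<theta> \<kappa> J x (e (fst j)) \<bullet> snd j"
    using inner_sum_orthonormal[of frame fvec frameJ j] fvec_orthonormal frame_subsets(2) j by auto
  then show "mu \<theta> \<kappa> J (retract x) (e (fst j)) \<bullet> snd j = 0"
    using mu_translate[of "snd j" "fst x" ?Y "snd x" "e (fst j)"] j by (auto simp: retract_def fvec_def)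
qed

lemma retract_id:
  assumes "x \<in> M"
  shows "retract x = x"
proof -
  have "(\<Sum>i\<in>frameJ. (mu \<theta> \<kappa> J x (e (fst i)) \<bullet> snd i) *\<^sub>R fvec i) = 0"
    using assms unfolding mem_M_iff_frame by (intro sum.neutral) simp
  then show ?thesis by (simp add: retract_def)
qed

lemma smooth_on_mu: "smooth_on UNIV (\<lambda>x. mu \<theta> \<kappa> J x V)"
proof -
  have "smooth_on UNIV (\<lambda>x :: ('m, 'q) G. mu_comp \<theta> \<kappa> J a x V)" for a
  proof -
    have "linear (\<lambda>x :: ('m, 'q) G. J_H a (rho \<theta> \<kappa> V (snd x)))"
      by (intro linearI) (auto simp: linear_add[OF linear_rho(1)] linear_scale[OF linear_rho(1)]
          linear_add[OF linear_J_H] linear_scale[OF linear_J_H])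
    then show ?thesis
      unfolding mu_comp_def split_def omega_def
      by (intro smooth_on_add smooth_on_bilinear[OF bounded_bilinear_inner]
          smooth_on_bilinear[OF bounded_bilinear_mult] smooth_on_const smooth_on_linear linear_fst linear_snd)
  qed
  then show ?thesis
    unfolding mu_def
    by (intro smooth_on_add smooth_on_bilinear[OF bounded_bilinear_scaleR] smooth_on_const)
qed

lemma smooth_on_retract: "smooth_on UNIV retract"
  unfolding retract_def[abs_def]
  by (intro smooth_on_Pair smooth_on_add smooth_on_sum smooth_on_bilinear[OF bounded_bilinear_scaleR]
      smooth_on_bilinear[OF bounded_bilinear_inner] smooth_on_mu smooth_on_const
      smooth_on_linear linear_fst linear_snd)

section \<open>Tangent and horizontal vectors\<close>

lemma mu_has_derivative:
  "((\<lambda>x. mu \<theta> \<kappa> J x V) has_derivative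
    (\<lambda>d. (J_G J 1 (\<xi> V x) \<bullet> d) *\<^sub>R qi + (J_G J 2 (\<xi> V x) \<bullet> d) *\<^sub>R qj + (J_G J 3 (\<xi> V x) \<bullet> d) *\<^sub>R qk)) (at x)"
  using mu_comp_has_derivative unfolding mu_def omega_def[abs_def]
  by (intro has_derivative_add has_derivative_scaleR_left)

text \<open>
  Since \<open>d\<mu>\<^sub>a(V) = \<omega>\<^sub>a(\<xi>\<^sub>V, \<cdot>)\<close>, a velocity of a curve in the level is orthogonal to \<open>J\<^sub>a \<xi>\<^sub>V\<close>. Conversely the
  derivative of \<open>retract\<close> fixes every such vector \<open>v\<close>, so that \<open>retract (x + t v)\<close> is a curve in the
  level with velocity \<open>v\<close>.
\<close>
lemma tangent_vectors_M:
  assumes x: "x \<in> M"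
  shows "tangent_vectors M x = {v. \<forall>V\<in>L. \<forall>a\<in>{1, 2, 3}. J_G J a (\<xi> V x) \<bullet> v = 0}"
proof (intro set_eqI iffI)
  fix v assume "v \<in> tangent_vectors M x"
  then obtain c where c: "\<forall>t. c t \<in> M" "c 0 = x" "(c has_vector_derivative v) (at 0)"
    unfolding tangent_vectors_def by blast
  have "J_G J a (\<xi> V x) \<bullet> v = 0" if "V \<in> L" "a \<in> {1, 2, 3}" for V a
  proof -
    have "((\<lambda>t. mu_comp \<theta> \<kappa> J a (c t) V) has_derivative
        (\<lambda>t. omega (J_G J a) (\<xi> V x) (t *\<^sub>R v))) (at 0)"
      using has_derivative_compose[of c "\<lambda>t. t *\<^sub>R v" 0 UNIV, OF _ mu_comp_has_derivative] c(2,3)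
      unfolding has_vector_derivative_def by auto
    moreover have "(\<lambda>t. mu_comp \<theta> \<kappa> J a (c t) V) = (\<lambda>t. 0)"
      using c(1) that unfolding mem_M_iff_mu_comp by blast
    ultimately have "((\<lambda>t::real. 0) has_derivative (\<lambda>t. omega (J_G J a) (\<xi> V x) (t *\<^sub>R v))) (at 0)"
      by simp
    from has_derivative_unique[OF this has_derivative_const]
    have "omega (J_G J a) (\<xi> V x) (1 *\<^sub>R v) = 0" by metis
    then show ?thesis by (simp add: omega_def)
  qed
  then show "v \<in> {v. \<forall>V\<in>L. \<forall>a\<in>{1, 2, 3}. J_G J a (\<xi> V x) \<bullet> v = 0}" by blast
next
  fix v assume "v \<in> {v. \<forall>V\<in>L. \<forall>a\<in>{1, 2, 3}. J_G J a (\<xi> V x) \<bullet> v = 0}"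
  then have v: "\<And>V a. V \<in> L \<Longrightarrow> a \<in> {1, 2, 3} \<Longrightarrow> J_G J a (\<xi> V x) \<bullet> v = 0" by blast
  let ?d = "\<lambda>V d. (J_G J 1 (\<xi> V x) \<bullet> d) *\<^sub>R qi + (J_G J 2 (\<xi> V x) \<bullet> d) *\<^sub>R qj + (J_G J 3 (\<xi> V x) \<bullet> d) *\<^sub>R qk"
  let ?D = "\<lambda>d. (fst d + (\<Sum>i\<in>frameJ. (?d (e (fst i)) d \<bullet> snd i) *\<^sub>R fvec i), snd d)"
  have D: "(retract has_derivative ?D) (at x)"
    unfolding retract_def[abs_def]
    by (intro has_derivative_Pair has_derivative_add has_derivative_sum has_derivative_scaleR_left
        has_derivative_inner_left mu_has_derivative has_derivative_fst has_derivative_snd has_derivative_ident)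
  have "?d (e (fst i)) v = 0" if "i \<in> frameJ" for i
  proof -
    have "e (fst i) \<in> L" using that e_in_L by auto
    from v[OF this, of 1] v[OF this, of 2] v[OF this, of 3] show ?thesis
      by (simp del: One_nat_def)
  qed
  then have "(\<Sum>i\<in>frameJ. (?d (e (fst i)) v \<bullet> snd i) *\<^sub>R fvec i) = 0"
    by (intro sum.neutral ballI) (metis inner_zero_left scaleR_zero_left)
  then have Dv: "?D v = v" by simp
  let ?c = "\<lambda>t. retract (x + t *\<^sub>R v)"
  have "((\<lambda>t. x + t *\<^sub>R v) has_derivative (\<lambda>t. t *\<^sub>R v)) (at 0)"
    by (auto intro!: derivative_eq_intros)
  from has_derivative_compose[OF this, of retract ?D] D
  have "(?c has_derivative (\<lambda>t. ?D (t *\<^sub>R v))) (at 0)" by simp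
  moreover have "(\<lambda>t. ?D (t *\<^sub>R v)) = (\<lambda>t. t *\<^sub>R v)"
    using linear_scale[OF has_derivative_linear[OF D], of _ v] unfolding Dv by blast
  ultimately have "(?c has_vector_derivative v) (at 0)"
    unfolding has_vector_derivative_def by simp
  moreover have "smooth_on UNIV ?c"
    by (intro smooth_on_compose[OF smooth_on_retract] smooth_on_add smooth_on_const smooth_on_linear linearI)
      (auto simp: scaleR_add_left)
  ultimately show "v \<in> tangent_vectors M x"
    unfolding tangent_vectors_def using retract_in_M retract_id[OF x]
    by (intro CollectI exI[of _ ?c]) simp
qed

text \<open>
  A curve in the orbit is of the form \<open>V(t) \<cdot> x\<close> with \<open>V(t) \<in> L\<close> recovered from its first component;
  at \<open>V(0) = 0\<close> the chain rule gives \<open>\<xi>\<^bsub>V'(0)\<^esub>\<close>.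
\<close>
lemma tangent_vectors_orb: "tangent_vectors (orb x) x = {\<xi> V x | V. V \<in> L}"
proof (intro set_eqI iffI)
  fix v assume "v \<in> tangent_vectors (orb x) x"
  then obtain c where c: "\<And>t. c t \<in> orb x" "c 0 = x" "(c has_derivative (\<lambda>t. t *\<^sub>R v)) (at 0)"
    unfolding tangent_vectors_def has_vector_derivative_def by blast
  have sh: "fst (c t) - fst x \<in> L \<and> snd (c t) = act (fst (c t) - fst x) (snd x)" for t
  proof -
    obtain V where "V \<in> L" "c t = shift V x" using c(1)[of t] unfolding L_orbit_def by blast
    then show ?thesis by (simp add: shift_eq)
  qed
  have 1: "((\<lambda>t. fst (c t) - fst x) has_derivative (\<lambda>t. t *\<^sub>R fst v)) (at 0)"
    using has_derivative_diff[OF has_derivative_fst[OF c(3)] has_derivative_const[of "fst x"]] by simp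
  have "((\<lambda>t. proj frameL (fst (c t) - fst x)) has_derivative (\<lambda>t. proj frameL (t *\<^sub>R fst v))) (at 0)"
    by (rule bounded_linear.has_derivative[OF _ 1]) (simp add: linear_proj flip: linear_conv_bounded_linear)
  moreover have "proj frameL (fst (c t) - fst x) = fst (c t) - fst x" for t
    using proj_L_id sh by blast
  ultimately have "((\<lambda>t. fst (c t) - fst x) has_derivative (\<lambda>t. proj frameL (t *\<^sub>R fst v))) (at 0)"
    by simp
  from fun_cong[OF has_derivative_unique[OF 1 this], of 1]
  have L: "fst v \<in> L" using proj_L_in_L[of "fst v"] by simp
  have "((\<lambda>t. (fst (c t) - fst x, snd x)) has_derivative (\<lambda>t. (t *\<^sub>R fst v, 0))) (at 0)"
    by (intro has_derivative_Pair 1 has_derivative_const)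
  moreover have "((\<lambda>z. act (fst z) (snd z)) has_derivative
      (\<lambda>d. act 0 (snd d) + rho \<theta> \<kappa> (fst d) (act 0 (snd x)))) (at (fst (c 0) - fst x, snd x))"
    using theta_act_has_derivative[of \<theta> \<kappa> 0 "snd x"] c(2) by simp
  ultimately have "((\<lambda>t. act (fst (fst (c t) - fst x, snd x)) (snd (fst (c t) - fst x, snd x))) has_derivative
      (\<lambda>t. act 0 (snd (t *\<^sub>R fst v, 0)) + rho \<theta> \<kappa> (fst (t *\<^sub>R fst v, 0 :: quat ^ 'q)) (act 0 (snd x)))) (at 0)"
    by (rule has_derivative_compose)
  then have "((\<lambda>t. act (fst (c t) - fst x) (snd x)) has_derivative
      (\<lambda>t. act 0 0 + rho \<theta> \<kappa> (t *\<^sub>R fst v) (act 0 (snd x)))) (at 0)"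
    by simp
  then have "((\<lambda>t. snd (c t)) has_derivative (\<lambda>t. rho \<theta> \<kappa> (t *\<^sub>R fst v) (snd x))) (at 0)"
    using sh by (simp add: theta_act_zero)
  from fun_cong[OF has_derivative_unique[OF this has_derivative_snd[OF c(3)]], of 1]
  have "snd v = rho \<theta> \<kappa> (fst v) (snd x)" by simp
  then have "v = \<xi> (fst v) x"
    by (simp add: fundamental_field_def split_def prod_eq_iff)
  then show "v \<in> {\<xi> V x | V. V \<in> L}" using L by blast
next
  fix v assume "v \<in> {\<xi> V x | V. V \<in> L}"
  then obtain V where V: "V \<in> L" "v = \<xi> V x" by blast
  let ?c = "\<lambda>t. shift (t *\<^sub>R V) x"
  have lin: "linear (\<lambda>t. t *\<^sub>R V)"
    by (intro linearI) (auto simp: scaleR_add_left)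
  have "smooth_on UNIV (\<lambda>t. (t *\<^sub>R V, snd x))"
    by (intro smooth_on_Pair smooth_on_const smooth_on_linear lin)
  from smooth_on_compose[OF smooth_on_theta_act[where \<theta> = \<theta> and \<kappa> = \<kappa>] this]
  have "smooth_on UNIV (\<lambda>t. act (t *\<^sub>R V) (snd x))" by simp
  from smooth_on_Pair[OF smooth_on_add[OF smooth_on_linear[OF lin] smooth_on_const] this]
  have "smooth_on UNIV ?c"
    unfolding shift_eq .
  moreover have "?c t \<in> orb x" for t
    unfolding L_orbit_def using subspace_scale[OF subspace_L V(1)] by blast
  ultimately show "v \<in> tangent_vectors (orb x) x"
    unfolding tangent_vectors_def V(2) using fundamental_field[of \<theta> \<kappa> V x] shift_zero[of x]
    by (intro CollectI exI[of _ ?c]) simp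
qed

lemma tangent_vectors_mono: "S \<subseteq> T \<Longrightarrow> tangent_vectors S x \<subseteq> tangent_vectors T x"
  unfolding tangent_vectors_def by blast

lemma orb_subset_M: "x \<in> M \<Longrightarrow> orb x \<subseteq> M"
  unfolding L_orbit_def using shift_in_M by blast

lemma fundamental_field_tangent: "x \<in> M \<Longrightarrow> V \<in> L \<Longrightarrow> \<xi> V x \<in> tangent_vectors M x"
  using tangent_vectors_mono[OF orb_subset_M] tangent_vectors_orb by blast

abbreviation hor :: "('m, 'q) G \<Rightarrow> ('m, 'q) G set"
  where "hor \<equiv> horizontal orb M"
abbreviation dpi :: "('m, 'q) G \<Rightarrow> ('m, 'q) G \<Rightarrow> ('m, 'q) G set derivation"
  where "dpi \<equiv> d_proj orb M"
abbreviation Q :: "('m, 'q) G set smooth_space"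
  where "Q \<equiv> quotient_space (subset_space M) orb"

text \<open>
  Horizontal vectors are those orthogonal to \<open>\<xi>\<^sub>V\<close> and all \<open>J\<^sub>a \<xi>\<^sub>V\<close>: a condition symmetric in the four
  quaternion units, which is why horizontal spaces are invariant under the complex structures.
\<close>
lemma mem_hor_iff:
  assumes "x \<in> M"
  shows "v \<in> hor x \<longleftrightarrow>
    (\<forall>V\<in>L. \<xi> V x \<bullet> v = 0 \<and> (\<forall>a\<in>{1, 2, 3}. J_G J a (\<xi> V x) \<bullet> v = 0))"
  unfolding horizontal_def tangent_vectors_M[OF assms] tangent_vectors_orb by blast

lemma hor_tangent: "v \<in> hor x \<Longrightarrow> v \<in> tangent_vectors M x"
  by (simp add: horizontal_def)

lemma hor_J_G:
  assumes x: "x \<in> M" and v: "v \<in> hor x" and b: "b \<in> {1, 2, 3}"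
  shows "J_G J b v \<in> hor x"
  unfolding mem_hor_iff[OF x]
proof
  fix V assume "V \<in> L"
  then have "\<xi> V x \<bullet> v = 0" "\<And>a. a \<in> {1, 2, 3} \<Longrightarrow> J_G J a (\<xi> V x) \<bullet> v = 0"
    using v unfolding mem_hor_iff[OF x] by blast+
  from quaternionic_triple_preserves_orthogonal[OF quaternionic_triple_J_G[OF triple] b this]
  show "\<xi> V x \<bullet> J_G J b v = 0 \<and> (\<forall>a\<in>{1, 2, 3}. J_G J a (\<xi> V x) \<bullet> J_G J b v = 0)"
    by blast
qed

lemma hor_diff: "x \<in> M \<Longrightarrow> v \<in> hor x \<Longrightarrow> w \<in> hor x \<Longrightarrow> v - w \<in> hor x"
  unfolding mem_hor_iff by (simp add: inner_diff_right)

text \<open>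
  If \<open>v\<close> and \<open>w\<close> have the same image, their difference lies in the kernel of the derivative of
  \<open>to_slice\<close>, so it is vertical as well as horizontal.
\<close>
lemma dpi_inj_hor:
  assumes x: "x \<in> M" and v: "v \<in> hor x" and w: "w \<in> hor x" and eq: "dpi x v = dpi x w"
  shows "v = w"
proof -
  let ?\<phi> = "angle (- proj frameL (fst x))"
  have "phaseG ?\<phi> (v - \<xi> (proj frameL (fst v)) x) = phaseG ?\<phi> (w - \<xi> (proj frameL (fst w)) x)"
    using d_proj_separates[OF smooth_on_to_slice to_slice_has_derivative to_slice_orb hor_tangent[OF v] hor_tangent[OF w] eq]
    by blast
  then have "v - \<xi> (proj frameL (fst v)) x = w - \<xi> (proj frameL (fst w)) x"
    by (metis phaseG_inverse(2))
  then have *: "v - w = \<xi> (proj frameL (fst v) - proj frameL (fst w)) x"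
    unfolding linear_diff[OF linear_fundamental_field] by (simp add: algebra_simps)
  have "proj frameL (fst v) - proj frameL (fst w) \<in> L"
    by (intro subspace_diff[OF subspace_L] proj_L_in_L)
  then have "(v - w) \<bullet> (v - w) = 0"
    using hor_diff[OF x v w] * unfolding mem_hor_iff[OF x] by metis
  then show ?thesis by simp
qed

lemma dpi_fundamental_field:
  assumes "x \<in> M" "V \<in> L"
  shows "dpi x (\<xi> V x) f = 0"
proof -
  have "(\<lambda>t. shift (t *\<^sub>R V) x) t \<in> M" for t
    using assms subspace_scale[OF subspace_L] shift_in_M by blast
  from d_proj_eq_velocity[OF this fundamental_field, of orb]
  have "dpi x (\<xi> V x) = velocity Q (orb \<circ> (\<lambda>t. shift (t *\<^sub>R V) x))"
    by (simp add: shift_zero)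
  moreover have "orb \<circ> (\<lambda>t. shift (t *\<^sub>R V) x) = (\<lambda>t. orb x)"
    using orb_shift subspace_scale[OF subspace_L assms(2)] by (auto simp: fun_eq_iff)
  ultimately show ?thesis by (simp add: velocity_def)
qed

text \<open>
  A smooth curve in the quotient lifts to the slice. The vertical part of the velocity of the lift
  projects to zero and can be dropped.
\<close>
lemma tangent_space_Q:
  assumes x: "x \<in> M" "to_slice x = x" and D: "D \<in> tangent_space Q (orb x)"
  obtains v where "v \<in> hor x" "D = dpi x v"
proof -
  obtain c where c: "smooth_map (subset_space (UNIV :: real set)) Q c" "c 0 = orb x" "D = velocity Q c"
    using D unfolding tangent_space_def by blast
  obtain d where d: "smooth_on UNIV d" "\<And>t. d t \<in> M" "\<And>t. orb (d t) = c t" "d 0 = x"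
  proof (rule lift_curve_to_slice[OF smooth_on_to_slice _ orb_to_slice to_slice_orb c(1) x(1) c(2)])
    show "to_slice ` M \<subseteq> M" using to_slice_in_M by blast
  qed (auto simp: x(2))
  define w where "w = frechet_derivative d (at 0) 1"
  have dw: "(d has_vector_derivative w) (at 0)"
  proof -
    have D: "(d has_derivative frechet_derivative d (at 0)) (at 0)"
      using smooth_on_has_derivative[OF d(1)] by simp
    have "frechet_derivative d (at 0) = (\<lambda>t. t *\<^sub>R w)"
    proof
      fix t
      show "frechet_derivative d (at 0) t = t *\<^sub>R w"
        using linear_scale[OF has_derivative_linear[OF D], of t 1] unfolding w_def by simp
    qed
    then show ?thesis using D by (simp add: has_vector_derivative_def)
  qed
  have "orb \<circ> d = c" using d(3) by auto
  then have Dw: "D = dpi x w"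
    using d_proj_eq_velocity[OF d(2) dw, of orb] c(3) d(4) by simp
  have wT: "w \<in> tangent_vectors M x"
    unfolding tangent_vectors_def using d dw by blast
  let ?S = "(\<lambda>V. \<xi> V x) ` L"
  have "subspace ?S"
    by (rule linear_subspace_image[OF linear_fundamental_field subspace_L])
  then have span: "span ?S = ?S" by (simp add: span_eq_iff)
  \<comment> \<open>\<open>y\<close> is the vertical and \<open>z\<close> the horizontal part of the velocity \<open>w\<close> of the lift.\<close>
  obtain y z where yz: "y \<in> span ?S" "\<And>w. w \<in> span ?S \<Longrightarrow> orthogonal z w" "w = y + z"
    using orthogonal_subspace_decomp_exists[of ?S w] by blast
  obtain V where V: "V \<in> L" "y = \<xi> V x" using yz(1) unfolding span by blast
  have "z \<in> hor x"
    unfolding mem_hor_iff[OF x(1)]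
  proof (intro ballI conjI)
    fix U assume U: "U \<in> L"
    show "\<xi> U x \<bullet> z = 0"
      using yz(2)[of "\<xi> U x"] U unfolding span orthogonal_def by (simp add: inner_commute)
    fix a assume a: "a \<in> {1, 2, 3 :: nat}"
    have "J_G J a (\<xi> U x) \<bullet> w = 0" "J_G J a (\<xi> U x) \<bullet> y = 0"
      using wT fundamental_field_tangent[OF x(1) V(1)] U a
      unfolding tangent_vectors_M[OF x(1)] V(2) by blast+
    then show "J_G J a (\<xi> U x) \<bullet> z = 0"
      unfolding yz(3) by (simp add: inner_add_right)
  qed
  moreover have "D = dpi x z"
    unfolding Dw yz(3)
    by (simp add: fun_eq_iff d_proj_add[OF x(1)] V(2) dpi_fundamental_field[OF x(1) V(1)])
  ultimately show thesis by (rule that)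
qed

section \<open>The hyper-Kaehler structure of the quotient\<close>

lemma affine_phase_derivative:
  assumes "(c has_vector_derivative v) (at t)"
  shows "((\<lambda>t. a + phaseG \<phi> (c t)) has_vector_derivative phaseG \<phi> v) (at t)"
proof -
  have "((\<lambda>t. phaseG \<phi> (c t)) has_vector_derivative phaseG \<phi> v) (at t)"
    by (rule bounded_linear.has_vector_derivative[OF _ assms])
      (simp add: linear_phaseG flip: linear_conv_bounded_linear)
  from has_vector_derivative_add[OF has_vector_derivative_const this] show ?thesis by simp
qed

text \<open>
  The maps \<open>z \<mapsto> (V, 0) + phaseG \<phi> z\<close> comprise the translations by \<open>L\<close> and the action of the torus, so that
  the lemmas on them serve both for independence of representatives and for the torus action.
\<close>
lemma dpi_affine:
  assumes A: "\<And>z. z \<in> M \<Longrightarrow> (V, 0) + phaseG \<phi> z \<in> M" and x: "x \<in> M"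
    and c: "\<And>t. c t \<in> M" "c 0 = x" "(c has_vector_derivative v) (at 0)"
  shows "dpi ((V, 0) + phaseG \<phi> x) (phaseG \<phi> v) = velocity Q (\<lambda>t. orb ((V, 0) + phaseG \<phi> (c t)))"
proof -
  have "(\<lambda>t. (V, 0) + phaseG \<phi> (c t)) t \<in> M" for t using A c(1) by blast
  from d_proj_eq_velocity[OF this affine_phase_derivative[OF c(3)], of orb] show ?thesis
    by (simp add: c(2) comp_def)
qed

text \<open>
  The fundamental fields depend only on the \<open>\<H>\<^sup>q\<close>-component of the point and are equivariant under
  phase rotations, which are isometries commuting with the complex structures.
\<close>
lemma hor_affine:
  assumes x: "x \<in> M" "(V, 0) + phaseG \<phi> x \<in> M" and v: "v \<in> hor x"
  shows "phaseG \<phi> v \<in> hor ((V, 0) + phaseG \<phi> x)"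
proof -
  have "\<xi> U ((V, 0) + phaseG \<phi> x) = phaseG \<phi> (\<xi> U x)" for U
    using fundamental_field_phase[of \<theta> \<kappa> U "V + fst x" \<phi> x] by (simp add: phaseG_def)
  then show ?thesis
    using v unfolding mem_hor_iff[OF x(1)] mem_hor_iff[OF x(2)]
    by (simp add: phaseG_inner phaseG_J_G)
qed

lemma dpi_shift:
  assumes x: "x \<in> M" and V: "V \<in> L" and v: "v \<in> hor x"
  shows "dpi (shift V x) (phaseG (angle V) v) = dpi x v"
proof -
  obtain c where c: "\<And>t. c t \<in> M" "c 0 = x" "(c has_vector_derivative v) (at 0)"
    using hor_tangent[OF v] unfolding tangent_vectors_def by blast
  have "dpi (shift V x) (phaseG (angle V) v) = velocity Q (\<lambda>t. orb (shift V (c t)))"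
    unfolding shift_eq_phaseG
    by (rule dpi_affine[OF _ x c]) (use shift_in_M[OF V] in \<open>simp add: shift_eq_phaseG\<close>)
  also have "\<dots> = dpi x v"
    using d_proj_eq_velocity[OF c(1,3), of orb] by (simp add: orb_shift[OF V] c(2) comp_def)
  finally show ?thesis .
qed

text \<open>
  Horizontal lifts at two points of the same orbit correspond under the linear part of the translation
  that joins them, an isometry commuting with the complex structures. Metric and complex structures
  of the quotient therefore do not depend on the representative.
\<close>
lemma hor_shift_unique:
  assumes x: "x \<in> M" and y: "y \<in> M" "orb x = orb y"
  obtains \<phi> where "\<And>v. v \<in> hor x \<Longrightarrow> phaseG \<phi> v \<in> hor y \<and> dpi y (phaseG \<phi> v) = dpi x v"
    "\<And>v v'. v \<in> hor x \<Longrightarrow> v' \<in> hor y \<Longrightarrow> dpi y v' = dpi x v \<Longrightarrow> v' = phaseG \<phi> v"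
proof -
  obtain V where V: "V \<in> L" "y = shift V x" using y(2) orb_eq_iff by blast
  have *: "phaseG (angle V) v \<in> hor y \<and> dpi y (phaseG (angle V) v) = dpi x v" if "v \<in> hor x" for v
    using dpi_shift[OF x V(1) that] hor_affine[of x V "angle V"] x y(1) that
    unfolding V(2) shift_eq_phaseG by blast
  show thesis
    by (rule that[of "angle V"]) (use * dpi_inj_hor[OF y(1)] in metis)+
qed

lemma hyperkaehler_quotient_structure_exists:
  "\<exists>g I. hyperkaehler_quotient_structure orb M (J_G J) g I"
proof -
  define g where "g y D D' = (SOME s. \<exists>x\<in>M. \<exists>v\<in>hor x. \<exists>w\<in>hor x.
    orb x = y \<and> dpi x v = D \<and> dpi x w = D' \<and> s = v \<bullet> w)" for y D D'
  define I where "I a y D = (SOME E. \<exists>x\<in>M. \<exists>v\<in>hor x. orb x = y \<and> dpi x v = D \<and> E = dpi x (J_G J a v))"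
    for a :: nat and y D
  have "hyperkaehler_quotient_structure orb M (J_G J) g I"
    unfolding hyperkaehler_quotient_structure_def
  proof (intro ballI conjI)
    fix x v w assume x: "x \<in> M" and v: "v \<in> hor x" and w: "w \<in> hor x"
    have "\<exists>y\<in>M. \<exists>v'\<in>hor y. \<exists>w'\<in>hor y. orb y = orb x \<and> dpi y v' = dpi x v \<and> dpi y w' = dpi x w \<and>
        g (orb x) (dpi x v) (dpi x w) = v' \<bullet> w'"
      unfolding g_def by (rule someI[where x = "v \<bullet> w"]) (use x v w in blast)
    then obtain y v' w' where y: "y \<in> M" "v' \<in> hor y" "w' \<in> hor y" "orb y = orb x"
      "dpi y v' = dpi x v" "dpi y w' = dpi x w" "g (orb x) (dpi x v) (dpi x w) = v' \<bullet> w'"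
      by blast
    obtain \<phi> where \<phi>: "\<And>v v'. v \<in> hor x \<Longrightarrow> v' \<in> hor y \<Longrightarrow> dpi y v' = dpi x v \<Longrightarrow> v' = phaseG \<phi> v"
      using hor_shift_unique[OF x y(1) y(4)[symmetric]] by metis
    have "v' = phaseG \<phi> v" "w' = phaseG \<phi> w" using \<phi> v w y by blast+
    then show "g (orb x) (dpi x v) (dpi x w) = v \<bullet> w"
      using y(7) by (simp add: phaseG_inner)
  next
    fix x v and a :: nat assume x: "x \<in> M" and v: "v \<in> hor x" and a: "a \<in> {1, 2, 3}"
    show "J_G J a v \<in> hor x" by (rule hor_J_G[OF x v a])
    have "\<exists>y\<in>M. \<exists>v'\<in>hor y. orb y = orb x \<and> dpi y v' = dpi x v \<and>
        I a (orb x) (dpi x v) = dpi y (J_G J a v')"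
      unfolding I_def by (rule someI[where x = "dpi x (J_G J a v)"]) (use x v in blast)
    then obtain y v' where y: "y \<in> M" "v' \<in> hor y" "orb y = orb x"
      "dpi y v' = dpi x v" "I a (orb x) (dpi x v) = dpi y (J_G J a v')"
      by blast
    obtain \<phi> where \<phi>: "\<And>v. v \<in> hor x \<Longrightarrow> phaseG \<phi> v \<in> hor y \<and> dpi y (phaseG \<phi> v) = dpi x v"
      "\<And>v v'. v \<in> hor x \<Longrightarrow> v' \<in> hor y \<Longrightarrow> dpi y v' = dpi x v \<Longrightarrow> v' = phaseG \<phi> v"
      using hor_shift_unique[OF x y(1) y(3)[symmetric]] by metis
    have "v' = phaseG \<phi> v" using \<phi>(2) v y by blast
    then show "I a (orb x) (dpi x v) = dpi x (J_G J a v)"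
      using y(5) \<phi>(1)[OF hor_J_G[OF x v a]] by (simp add: phaseG_J_G)
  qed
  then show ?thesis by blast
qed

lemma smooth_map_phase_quotient: "smooth_map Q Q ((`) (phaseG \<phi>))"
  by (rule smooth_map_descends[OF smooth_on_linear[OF linear_phaseG]])
    (auto simp: phaseG_in_M phaseG_orb)

text \<open>
  The torus acts on the level by linear isometries that commute with the complex structures and map
  horizontal vectors to horizontal vectors. As every tangent vector of the quotient is the image of a
  horizontal one, the defining equations of the quotient structure carry these properties over, whatever
  \<open>g\<close> and \<open>I\<close> do elsewhere.
\<close>
lemma triholomorphic_isometry_phase:
  assumes gI: "hyperkaehler_quotient_structure orb M (J_G J) g I"
  shows "triholomorphic_isometry Q g I ((`) (phaseG \<phi>))"
  unfolding triholomorphic_isometry_def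
proof (intro conjI ballI)
  let ?F = "(`) (phaseG \<phi>)" and ?F' = "(`) (phaseG (\<lambda>\<beta>. - \<phi> \<beta>))"
  show "diffeomorphism Q Q ?F"
    unfolding diffeomorphism_def
    by (intro conjI exI[of _ ?F'] smooth_map_phase_quotient) (auto simp: image_image phaseG_inverse)
next
  fix y D assume "y \<in> sp_points Q" and D: "D \<in> tangent_space Q y"
  then obtain z where z: "z \<in> M" "y = orb z" by auto
  define x where "x = to_slice z"
  have "proj frameL (fst x) = 0" unfolding x_def by (rule proj_fst_to_slice)
  then have x: "x \<in> M" "to_slice x = x" "y = orb x"
    using to_slice_in_M[OF z(1)] to_slice_fixed_iff z(2) orb_to_slice by (auto simp: x_def)
  let ?F = "(`) (phaseG \<phi>)"
  have diff: "differential Q ?F (dpi x v) = dpi (phaseG \<phi> x) (phaseG \<phi> v)" if v: "v \<in> hor x" for v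
  proof -
    obtain c where c: "\<And>t. c t \<in> M" "c 0 = x" "(c has_vector_derivative v) (at 0)"
      using hor_tangent[OF v] unfolding tangent_vectors_def by blast
    have 1: "dpi x v = velocity Q (orb \<circ> c)"
      using d_proj_eq_velocity[OF c(1,3), of orb] c(2) by simp
    have "dpi ((0, 0) + phaseG \<phi> x) (phaseG \<phi> v) = velocity Q (\<lambda>t. orb ((0, 0) + phaseG \<phi> (c t)))"
      by (rule dpi_affine[OF _ x(1) c]) (simp add: phaseG_in_M flip: zero_prod_def)
    then have "dpi (phaseG \<phi> x) (phaseG \<phi> v) = velocity Q (\<lambda>t. orb (phaseG \<phi> (c t)))"
      by (simp flip: zero_prod_def)
    moreover have "?F \<circ> (orb \<circ> c) = (\<lambda>t. orb (phaseG \<phi> (c t)))"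
      by (simp add: fun_eq_iff phaseG_orb)
    ultimately show ?thesis
      unfolding 1 differential_velocity[OF smooth_map_phase_quotient] by simp
  qed
  have hor: "phaseG \<phi> v \<in> hor (phaseG \<phi> x)" if "v \<in> hor x" for v
    using hor_affine[OF x(1), of 0 \<phi> v] phaseG_in_M[OF x(1)] that by (simp flip: zero_prod_def)
  have x': "phaseG \<phi> x \<in> M" by (rule phaseG_in_M[OF x(1)])
  have Fy: "?F y = orb (phaseG \<phi> x)" by (simp add: x(3) phaseG_orb)
  obtain v where v: "v \<in> hor x" "D = dpi x v"
    using tangent_space_Q[OF x(1,2)] D x(3) by blast
  have gI': "g (orb z) (dpi z v) (dpi z w) = v \<bullet> w"
    "a \<in> {1, 2, 3} \<Longrightarrow> I a (orb z) (dpi z v) = dpi z (J_G J a v)"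
    if "z \<in> M" "v \<in> hor z" "w \<in> hor z" for z v w a
    using gI that unfolding hyperkaehler_quotient_structure_def by blast+
  {
    fix D' assume "D' \<in> tangent_space Q y"
    then obtain w where w: "w \<in> hor x" "D' = dpi x w"
      using tangent_space_Q[OF x(1,2)] x(3) by blast
    show "g (?F y) (differential Q ?F D) (differential Q ?F D') = g y D D'"
      unfolding v(2) w(2) diff[OF v(1)] diff[OF w(1)] Fy
      unfolding x(3)
      using gI'(1)[OF x' hor[OF v(1)] hor[OF w(1)]] gI'(1)[OF x(1) v(1) w(1)]
      by (simp add: phaseG_inner)
  }
  {
    fix a assume a: "a \<in> {1, 2, 3 :: nat}"
    show "I a (?F y) (differential Q ?F D) = differential Q ?F (I a y D)"
      unfolding v(2) diff[OF v(1)] Fy unfolding x(3) gI'(2)[OF x(1) v(1) v(1) a]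
        diff[OF hor_J_G[OF x(1) v(1) a]] gI'(2)[OF x' hor[OF v(1)] hor[OF v(1)] a] phaseG_J_G ..
  }
qed

section \<open>The quotients are Euclidean spaces\<close>

lemma card_frame: "card frame = 4 * l" "card frameL = l"
  by (simp_all add: card_cartesian_product)

lemma frame_orthogonal_dim:
  assumes A: "A \<subseteq> frame"
  shows "dim {z :: ('m, 'q) G. \<forall>i\<in>A. fst z \<bullet> fvec i = 0} + card A = CARD('m) + 4 * CARD('q)"
proof -
  have "finite A" using A by (rule finite_subset) simp
  moreover have "(fvec i, 0 :: quat ^ 'q) \<bullet> (fvec j, 0) = (if i = j then 1 else 0)" if "i \<in> A" "j \<in> A" for i j
    using fvec_orthonormal[OF subsetD[OF A that(1)] subsetD[OF A that(2)]] by simp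
  ultimately show ?thesis
    using dim_orthogonal_family[of A "\<lambda>i. (fvec i, 0 :: quat ^ 'q)"] by (simp add: inner_prod_def)
qed

text \<open>
  The slice of \<open>N\<close> is given as the bijective image under \<open>h\<close> of the linear subspace orthogonal to the
  frame vectors in \<open>A\<close>, with inverse the orthogonal projection. A linear isometry from this subspace to
  \<open>\<real>\<^sup>n\<close> then supplies chart and parametrisation.
\<close>
lemma diffeomorphic_quotient_slice:
  fixes h :: "('m, 'q) G \<Rightarrow> ('m, 'q) G"
  assumes A: "A \<subseteq> frame" and dim: "CARD('n::finite) + card A = CARD('m) + 4 * CARD('q)"
    and h: "smooth_on UNIV h"
    and rN: "\<And>x. x \<in> N \<Longrightarrow> to_slice x \<in> N"
    and hN: "\<And>z. \<forall>i\<in>A. fst z \<bullet> fvec i = 0 \<Longrightarrow>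
      h z \<in> N \<and> to_slice (h z) = h z \<and> (fst (h z) - proj A (fst (h z)), snd (h z)) = z"
    and Nh: "\<And>x. x \<in> N \<Longrightarrow> to_slice x = x \<Longrightarrow> h (fst x - proj A (fst x), snd x) = x"
  shows "diffeomorphic (quotient_space (subset_space N) orb) (subset_space (UNIV :: (real ^ 'n) set))"
proof -
  define H :: "('m, 'q) G set" where "H = {z. \<forall>i\<in>A. fst z \<bullet> fvec i = 0}"
  define P :: "('m, 'q) G \<Rightarrow> ('m, 'q) G" where "P x = (fst x - proj A (fst x), snd x)" for x
  have linP: "linear P"
    unfolding P_def by (intro linearI)
      (auto simp: linear_add[OF linear_proj] linear_scale[OF linear_proj] scaleR_diff_right)
  have PH: "P x \<in> H" for x
    using proj_inner[OF A, of _ "fst x"] A by (auto simp: H_def P_def inner_diff_left)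
  have "subspace H"
    by (auto simp: H_def subspace_def inner_add_left)
  moreover have "dim H = dim (UNIV :: (real ^ 'n) set)"
    using frame_orthogonal_dim[OF A] dim by (simp add: H_def)
  ultimately obtain f :: "('m, 'q) G \<Rightarrow> real ^ 'n" and g where fg: "linear f" "linear g" "g ` UNIV = H"
    "\<And>x. x \<in> H \<Longrightarrow> g (f x) = x" "\<And>y. f (g y) = y"
    using isometries_subspaces[of H "UNIV :: (real ^ 'n) set"] by (metis UNIV_I subspace_UNIV)
  have rr: "to_slice (to_slice x) = to_slice x" for x
    using to_slice_orb[OF orb_to_slice] .
  show ?thesis
  proof (rule diffeomorphic_quotient_Euclidean[where F = "\<lambda>x. f (P (to_slice x))" and S = "\<lambda>y. h (g y)"])
    show "smooth_on UNIV (\<lambda>x. f (P (to_slice x)))"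
      by (rule smooth_on_linear_compose[OF fg(1) smooth_on_linear_compose[OF linP smooth_on_to_slice]])
    show "smooth_on UNIV (\<lambda>y. h (g y))"
      by (rule smooth_on_compose[OF h smooth_on_linear[OF fg(2)]])
    have g: "h (g y) \<in> N \<and> to_slice (h (g y)) = h (g y) \<and> P (h (g y)) = g y" for y
      unfolding P_def by (rule hN) (use fg(3) in \<open>auto simp: H_def\<close>)
    then show "h (g y) \<in> N" "f (P (to_slice (h (g y)))) = y" for y
      by (simp_all add: fg(5))
    show "orb (h (g (f (P (to_slice x))))) = orb x" if "x \<in> N" for x
      using Nh[OF rN[OF that] rr] by (simp add: fg(4) PH orb_to_slice flip: P_def)
    show "f (P (to_slice x)) = f (P (to_slice y))" if "orb x = orb y" for x y
      using to_slice_orb[OF that] by simp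
  qed
qed

lemma diffeomorphic_quotient_group:
  assumes "CARD('n::finite) + l = CARD('m) + 4 * CARD('q)"
  shows "diffeomorphic (quotient_space (subset_space UNIV) orb) (subset_space (UNIV :: (real ^ 'n) set))"
proof (rule diffeomorphic_quotient_slice[where A = frameL and h = "\<lambda>z. z"])
  show "CARD('n) + card frameL = CARD('m) + 4 * CARD('q)"
    using assms card_frame(2) by simp
  show "smooth_on UNIV (\<lambda>z :: ('m, 'q) G. z)"
    by (rule smooth_on_bounded_linear[OF bounded_linear_ident])
  show "z \<in> UNIV \<and> to_slice z = z \<and> (fst z - proj frameL (fst z), snd z) = z"
    if "\<forall>i\<in>frameL. fst z \<bullet> fvec i = 0" for z
  proof -
    have "proj frameL (fst z) = 0"
      unfolding proj_def using that by (intro sum.neutral) auto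
    then show ?thesis using to_slice_fixed_iff[of z] by simp
  qed
  show "(fst x - proj frameL (fst x), snd x) = x" if "to_slice x = x" for x
    using to_slice_fixed_iff[of x] that by (metis diff_zero prod.collapse)
  show "frameL \<subseteq> frame" by (rule frame_subsets(1))
qed simp

lemma proj_frame_split: "proj frame X = proj frameL X + proj frameJ X"
  unfolding proj_def frame_subsets(3) by (rule sum.union_disjoint) (use frame_subsets(4) in auto)

lemma fst_retract_inner:
  assumes "j \<in> frame"
  shows "fst (retract z) \<bullet> fvec j = fst z \<bullet> fvec j + (if j \<in> frameJ then mu \<theta> \<kappa> J z (e (fst j)) \<bullet> snd j else 0)"
  using inner_sum_orthonormal[of frame fvec frameJ j "\<lambda>i. mu \<theta> \<kappa> J z (e (fst i)) \<bullet> snd i"]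
    fvec_orthonormal frame_subsets(2) assms
  by (simp add: retract_def inner_add_left)

text \<open>
  Inside the level the slice is the graph over the orthogonal complement of the frame on which the
  coordinates along \<open>frameJ\<close> are the values prescribed by \<open>\<mu> = 0\<close>, that is, the image of this
  complement under \<open>retract\<close>.
\<close>
lemma diffeomorphic_quotient_M:
  assumes "CARD('n::finite) + 4 * l = CARD('m) + 4 * CARD('q)"
  shows "diffeomorphic Q (subset_space (UNIV :: (real ^ 'n) set))"
proof (rule diffeomorphic_quotient_slice[where A = frame and h = retract])
  show "CARD('n) + card frame = CARD('m) + 4 * CARD('q)"
    using assms card_frame(1) by simp
  show "retract z \<in> M \<and> to_slice (retract z) = retract z \<and> (fst (retract z) - proj frame (fst (retract z)), snd (retract z)) = z"
    if z: "\<forall>i\<in>frame. fst z \<bullet> fvec i = 0" for z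
  proof (intro conjI)
    show "retract z \<in> M" by (rule retract_in_M)
    have *: "fst (retract z) \<bullet> fvec j = (if j \<in> frameJ then mu \<theta> \<kappa> J z (e (fst j)) \<bullet> snd j else 0)"
      if "j \<in> frame" for j
      using fst_retract_inner[OF that] bspec[OF z that] by simp
    have L: "proj frameL (fst (retract z)) = 0"
      unfolding proj_def
    proof (intro sum.neutral ballI)
      fix i assume "i \<in> frameL"
      then have "i \<in> frame" "i \<notin> frameJ" using frame_subsets by blast+
      then show "(fst (retract z) \<bullet> fvec i) *\<^sub>R fvec i = 0" using * by simp
    qed
    then show "to_slice (retract z) = retract z" unfolding to_slice_fixed_iff .
    have "proj frameJ (fst (retract z)) = (\<Sum>i\<in>frameJ. (mu \<theta> \<kappa> J z (e (fst i)) \<bullet> snd i) *\<^sub>R fvec i)"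
      unfolding proj_def
    proof (rule sum.cong[OF refl])
      fix i assume i: "i \<in> frameJ"
      then have "i \<in> frame" using frame_subsets by blast
      from *[OF this] i show "(fst (retract z) \<bullet> fvec i) *\<^sub>R fvec i = (mu \<theta> \<kappa> J z (e (fst i)) \<bullet> snd i) *\<^sub>R fvec i"
        by simp
    qed
    then show "(fst (retract z) - proj frame (fst (retract z)), snd (retract z)) = z"
      unfolding proj_frame_split L by (simp add: retract_def)
  qed
  show "retract (fst x - proj frame (fst x), snd x) = x" if x: "x \<in> M" "to_slice x = x" for x
  proof -
    have "mu \<theta> \<kappa> J (fst x - proj frame (fst x), snd x) (e (fst i)) \<bullet> snd i = fst x \<bullet> fvec i"
      if i: "i \<in> frameJ" for i
    proof -
      have "i \<in> frame" using i frame_subsets by blast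
      moreover have "mu \<theta> \<kappa> J x (e (fst i)) \<bullet> snd i = 0"
        using x(1) i unfolding mem_M_iff_frame by blast
      ultimately show ?thesis
        using mu_translate[of "snd i" "fst x" "- proj frame (fst x)" "snd x" "e (fst i)"] i
          proj_inner[of frame i "fst x"]
        by (auto simp: fvec_def)
    qed
    then have "retract (fst x - proj frame (fst x), snd x) = (fst x - proj frame (fst x) + proj frameJ (fst x), snd x)"
      unfolding retract_def proj_def[of frameJ] by simp
    then show ?thesis
      using x(2) unfolding to_slice_fixed_iff proj_frame_split by simp
  qed
  show "smooth_on UNIV retract" by (rule smooth_on_retract)
  show "to_slice x \<in> M" if "x \<in> M" for x using that by (rule to_slice_in_M)
qed simp

section \<open>The fixed point of the torus\<close>

lemma torus_act_quot_phase:
  assumes "torus_act B = (phaseG \<phi> :: ('m, 'q) G \<Rightarrow> _)"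
  shows "torus_act_quot B = ((`) (phaseG \<phi>) :: ('m, 'q) G set \<Rightarrow> _)"
  by (rule ext) (simp add: torus_act_quot_def assms)

lemma zero_in_M: "0 \<in> M"
  unfolding mem_M_iff
  by (simp add: mu_comp_def omega_def zero_prod_def linear_0[OF linear_rho(1)])

text \<open>
  If the rotation by \<open>\<pi>\<close> in all components fixes the orbit of \<open>(X, W)\<close>, then \<open>(X, -W)\<close> is a translate of
  \<open>(X, W)\<close> by some \<open>V \<in> L\<close>; comparing first components gives \<open>V = 0\<close> and hence \<open>W = 0\<close>. Now \<open>\<mu> = 0\<close> kills the
  coordinates of \<open>X\<close> along \<open>frameJ\<close>, and when \<open>e\<^sub>1, \<dots>, e\<^sub>l\<close> is a quaternionic basis this means \<open>X \<in> L\<close>: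
  the orbit is that of the origin.
\<close>
lemma unique_fixed_point:
  assumes dim: "CARD('m) = 4 * l"
  shows "\<exists>!y. y \<in> orb ` M \<and> (\<forall>B\<in>torus. torus_act_quot B y = y)"
proof (rule ex1I)
  show "orb 0 \<in> orb ` M \<and> (\<forall>B\<in>torus. torus_act_quot B (orb 0) = orb 0)"
  proof (intro conjI ballI)
    show "orb 0 \<in> orb ` M" using zero_in_M by blast
    fix B :: "quat ^ 'q ^ 'q" assume "B \<in> torus"
    then obtain \<phi> where "torus_act B = (phaseG \<phi> :: ('m, 'q) G \<Rightarrow> _)" by (rule torus_act_eq_phaseG)
    then show "torus_act_quot B (orb 0) = orb 0"
      by (simp add: torus_act_quot_phase phaseG_orb linear_0[OF linear_phaseG])
  qed
next
  fix y assume y: "y \<in> orb ` M \<and> (\<forall>B\<in>torus. torus_act_quot B y = y)"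
  then obtain x where x: "x \<in> M" "y = orb x" by blast
  \<comment> \<open>The rotation by \<open>\<pi>\<close> has no eigenvalue \<open>1\<close> on \<open>\<H>\<^sup>q\<close>.\<close>
  obtain B :: "quat ^ 'q ^ 'q" where B: "B \<in> torus" "torus_act B = (phaseG (\<lambda>\<beta>. pi) :: ('m, 'q) G \<Rightarrow> _)"
    using phaseG_in_torus by blast
  have "orb (phaseG (\<lambda>\<beta>. pi) x) = orb x"
    using bspec[OF conjunct2[OF y] B(1)] unfolding torus_act_quot_phase[OF B(2)] x(2) phaseG_orb .
  then obtain V where "V \<in> L" "phaseG (\<lambda>\<beta>. pi) x = shift V x"
    using orb_eq_iff by metis
  then have "phase (\<lambda>\<beta>. pi) (snd x) = snd x"
    by (simp add: shift_eq phaseG_def theta_act_zero)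
  moreover have "phase (\<lambda>\<beta>. pi) (snd x) = - snd x"
    by (simp add: vec_eq_iff quat_eq_iff qcis_def)
  ultimately have "- snd x $ \<beta> = snd x $ \<beta>" for \<beta> by (metis vector_uminus_component)
  then have W: "snd x = 0" by (simp add: vec_eq_iff quat_eq_iff)
  have J: "fst x \<bullet> fvec i = 0" if i: "i \<in> frameJ" for i
  proof -
    have "mu \<theta> \<kappa> J x (e (fst i)) \<bullet> snd i = 0"
      using x(1) i unfolding mem_M_iff_frame by blast
    moreover have "mu \<theta> \<kappa> J (0, snd x) (e (fst i)) \<bullet> snd i = 0"
      using zero_in_M i unfolding mem_M_iff_frame zero_prod_def W by blast
    ultimately show ?thesis
      using mu_translate[of "snd i" 0 "fst x" "snd x" "e (fst i)"] i by (auto simp: fvec_def)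
  qed
  then have "proj frameJ (fst x) = 0"
    unfolding proj_def by (intro sum.neutral) auto
  then have proj: "proj frame (fst x) = proj frameL (fst x)"
    unfolding proj_frame_split by simp
  have "dim {z. \<forall>i\<in>frame. z \<bullet> fvec i = 0} + card frame = CARD('m)"
    using dim_orthogonal_family[of frame fvec] fvec_orthonormal by simp
  then have "dim {z. \<forall>i\<in>frame. z \<bullet> fvec i = 0} = 0"
    unfolding card_frame dim by simp
  then have "{z. \<forall>i\<in>frame. z \<bullet> fvec i = 0} \<subseteq> {0}"
    unfolding dim_eq_0 .
  moreover have "fst x - proj frame (fst x) \<in> {z. \<forall>i\<in>frame. z \<bullet> fvec i = 0}"
    using proj_inner[of frame _ "fst x"] by (simp add: inner_diff_left)
  ultimately have "fst x - proj frame (fst x) \<in> {0}" by (rule subsetD)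
  then have "fst x = proj frame (fst x)"
    unfolding singleton_iff right_minus_eq .
  then have "fst x \<in> L" using proj proj_L_in_L by metis
  moreover have "x = shift (fst x) 0"
    by (simp add: shift_eq theta_act_eq_phase linear_0[OF linear_phase] W prod_eq_iff)
  ultimately show "y = orb 0"
    unfolding x(2) by (metis orb_shift)
qed

section \<open>The moment map in quaternionic coordinates\<close>

lemma proj_k_e: "proj_k \<kappa> (e \<alpha>) = axis (en \<alpha>) 1"
  using inj_coords by (auto simp: proj_k_def e_vec_def axis_def vec_eq_iff inj_def)

lemma J_H_rho_inner:
  "J_H a (rho \<theta> \<kappa> (e \<alpha>) W) \<bullet> W =
    (\<Sum>\<beta>\<in>UNIV. \<theta> $ \<beta> $ en \<alpha> * ((qcnj (W $ \<beta>) * qi * W $ \<beta>) \<bullet> qunit a))"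
proof -
  have "(qi * w * qunit a) \<bullet> w = - ((qcnj w * qi * w) \<bullet> qunit a)" for w
    by (simp add: qunit_def qcnj_def inner_quat_def algebra_simps)
  then show ?thesis
    by (simp add: inner_vec_def[of _ W] J_H_def rho_def proj_k_e inner_axis')
qed

text \<open>
  Both sides are compared along each quaternion unit. Along \<open>i\<^sub>a\<close> the linear part is \<open>J\<^sub>a e\<^sub>\<alpha> \<bullet> X\<close>, which is
  minus the coordinate of \<open>X\<close> along \<open>e\<^sub>\<alpha> i\<^sub>a\<close>; the quadratic part rests on the identity
  \<open>\<langle>i w (-i\<^sub>a), w\<rangle> = \<langle>w\<^sup>* i w, i\<^sub>a\<rangle>\<close>, with \<open>w\<^sup>*\<close> the conjugate of \<open>w\<close>.
\<close>
lemma moment_map_formula: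
  assumes b: "quaternionic_basis J e l p b" and lp: "l \<le> p"
    and X: "X = (\<Sum>\<alpha> = 1..p. qscale J (b \<alpha>) (x \<alpha>))" and \<alpha>: "\<alpha> \<in> {1..l}"
  shows "mu \<theta> \<kappa> J (X, W) (e \<alpha>) =
    - qIm (x \<alpha>) + (1 / 2) *\<^sub>R (\<Sum>\<beta>\<in>UNIV. (\<theta> $ \<beta> $ en \<alpha>) *\<^sub>R (qcnj (W $ \<beta>) * qi * W $ \<beta>))"
proof (rule euclidean_eqI)
  fix h :: quat assume h: "h \<in> Basis"
  define v where "v i = qscale J (b (fst i)) (snd i)" for i
  let ?I = "{1..p} \<times> (Basis :: quat set)"
  have on: "v i \<bullet> v j = (if i = j then 1 else 0)" if "i \<in> ?I" "j \<in> ?I" for i j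
    using b that unfolding quaternionic_basis_def v_def Basis_quat_def mem_Times_iff prod_eq_iff
    by blast
  have decomp: "qscale J w y = (\<Sum>h\<in>Basis. (y \<bullet> h) *\<^sub>R qscale J w h)" for w y
    by (simp add: Basis_quat_def one_quat_def qscale_def inner_quat_def)
  have "X = (\<Sum>\<alpha> = 1..p. \<Sum>h\<in>Basis. (x \<alpha> \<bullet> h) *\<^sub>R v (\<alpha>, h))"
    unfolding X v_def fst_conv snd_conv by (intro sum.cong refl decomp)
  then have "X = (\<Sum>i\<in>?I. (x (fst i) \<bullet> snd i) *\<^sub>R v i)"
    by (simp add: sum.cartesian_product split_def)
  then have X_inner: "X \<bullet> v (\<alpha>, h) = x \<alpha> \<bullet> h"
    using inner_sum_orthonormal[of ?I v ?I "(\<alpha>, h)" "\<lambda>i. x (fst i) \<bullet> snd i"] on h \<alpha> lp by simp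
  have b\<alpha>: "b \<alpha> = e \<alpha>" using b \<alpha> unfolding quaternionic_basis_def by blast
  show "mu \<theta> \<kappa> J (X, W) (e \<alpha>) \<bullet> h = (- qIm (x \<alpha>) +
      (1 / 2) *\<^sub>R (\<Sum>\<beta>\<in>UNIV. (\<theta> $ \<beta> $ en \<alpha>) *\<^sub>R (qcnj (W $ \<beta>) * qi * W $ \<beta>))) \<bullet> h"
  proof (cases "h = 1")
    case True
    have "(qcnj w * qi * w) \<bullet> 1 = 0" for w
      by (simp add: qcnj_def inner_quat_def algebra_simps)
    moreover have "mu \<theta> \<kappa> J (X, W) (e \<alpha>) \<bullet> 1 = 0" "qIm (x \<alpha>) \<bullet> 1 = 0"
      by (simp_all add: mu_def qIm_def inner_quat_def)
    ultimately show ?thesis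
      by (simp only: True inner_add_left inner_minus_left inner_scaleR_left inner_sum_left) simp
  next
    case False
    have "h \<in> {qi, qj, qk}" using h False by (simp add: Basis_quat_def)
    also have "{qi, qj, qk} = qunit ` {1, 2, 3}" by (auto simp: qunit_def)
    finally obtain a where a: "a \<in> {1, 2, 3}" "h = qunit a" by blast
    have "J a (e \<alpha>) = - v (\<alpha>, h)"
      unfolding v_def a(2) fst_conv snd_conv b\<alpha> qscale_qunit[OF a(1)] by simp
    then have "J a (e \<alpha>) \<bullet> X = - (x \<alpha> \<bullet> h)"
      using X_inner by (simp add: inner_commute)
    moreover have "qIm (x \<alpha>) \<bullet> h = x \<alpha> \<bullet> h"
      using a by (auto simp: qunit_def qIm_def inner_quat_def)
    ultimately show ?thesis
      unfolding a(2) mu_inner_qunit[OF a(1)]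
      by (simp add: mu_comp_def omega_def J_H_rho_inner inner_diff_left inner_sum_left)
  qed
qed

end

theorem theorem6p1:
  fixes \<theta> :: "real ^ 'k ^ 'q"
    and \<kappa> :: "'k \<Rightarrow> 'm::finite"
    and en :: "nat \<Rightarrow> 'k"
    and J :: "nat \<Rightarrow> real ^ 'm \<Rightarrow> real ^ 'm"
    and s p l :: nat
  assumes dim: "CARD('m) = s + CARD('k)" "s + CARD('k) = 4 * p"
    and coords: "inj \<kappa>" "bij_betw en {1..CARD('k)} UNIV"
    and rank: "rank \<theta> = CARD('k)"
    and triple: "quaternionic_triple J"
    and l_le: "l \<le> CARD('k)"
    and isotropic: "isotropic J (L_set \<kappa> en l)"
  shows
    "let M = mu_zero \<theta> \<kappa> en l J :: ('m, 'q) G set;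
         \<pi> = L_orbit \<theta> \<kappa> en l :: ('m, 'q) G \<Rightarrow> ('m, 'q) G set;
         Q = L_quotient \<theta> \<kappa> en l M
     in
     (\<exists>b. quaternionic_basis J (e_vec \<kappa> en) l p b) \<and>
     (\<forall>b. quaternionic_basis J (e_vec \<kappa> en) l p b \<longrightarrow>
        (\<forall>X (x :: nat \<Rightarrow> quat) W. X = (\<Sum>\<alpha> = 1..p. qscale J (b \<alpha>) (x \<alpha>)) \<longrightarrow>
          (\<forall>\<alpha>\<in>{1..l}. mu \<theta> \<kappa> J (X, W) (e_vec \<kappa> en \<alpha>) =
             - qIm (x \<alpha>) + (1 / 2) *\<^sub>R (\<Sum>\<beta>\<in>UNIV. (\<theta> $ \<beta> $ en \<alpha>) *\<^sub>R (qcnj (W $ \<beta>) * qi * W $ \<beta>)))))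
   \<and>
     (CARD('n1::finite) = 4 * p + 4 * CARD('q) - 4 * l \<longrightarrow>
        diffeomorphic Q (subset_space (UNIV :: (real ^ 'n1) set))) \<and>
     (CARD('n2::finite) = 4 * p + 4 * CARD('q) - l \<longrightarrow>
        diffeomorphic (L_quotient \<theta> \<kappa> en l (UNIV :: ('m, 'q) G set))
          (subset_space (UNIV :: (real ^ 'n2) set)))
   \<and>
     (\<forall>B\<in>torus. \<forall>x\<in>M. torus_act B x \<in> M \<and> torus_act_quot B (\<pi> x) = \<pi> (torus_act B x)) \<and>
     (\<forall>y\<in>sp_points Q. torus_act_quot (mat 1) y = y \<and>
        (\<forall>B\<in>torus. \<forall>B'\<in>torus. torus_act_quot (B ** B') y = torus_act_quot B (torus_act_quot B' y))) \<and>
     (\<exists>g I. hyperkaehler_quotient_structure \<pi> M (J_G J) g I) \<and>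
     (\<forall>g I. hyperkaehler_quotient_structure \<pi> M (J_G J) g I \<longrightarrow>
        (\<forall>B\<in>torus. triholomorphic_isometry Q g I (torus_act_quot B))) \<and>
     (l = p \<and> p = CARD('q) \<longrightarrow>
        (\<exists>!y. y \<in> sp_points Q \<and> (\<forall>B\<in>torus. torus_act_quot B y = y)))"
proof -
  interpret isotropic_translations \<theta> \<kappa> en J l
    using coords triple l_le isotropic by unfold_locales
  have dim_m: "CARD('m) = 4 * p" using dim by simp
  have frame: "l \<le> p" "\<exists>b. quaternionic_basis J e l p b"
  proof -
    have "DIM(real ^ 'm) = 4 * p" by (simp add: dim_m)
    from quaternionic_basis_exists[OF triple this e_inner e_J_e]
    show "l \<le> p" "\<exists>b. quaternionic_basis J e l p b" by blast+
  qed
  have Q: "L_quotient \<theta> \<kappa> en l M = Q"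
    "L_quotient \<theta> \<kappa> en l UNIV = quotient_space (subset_space UNIV) orb"
    by (simp_all add: L_quotient_def)
  have torus: "torus_act B x \<in> M \<and> torus_act_quot B (orb x) = orb (torus_act B x)"
    if B: "B \<in> torus" and x: "x \<in> M" for B x
  proof -
    obtain \<phi> where "torus_act B = (phaseG \<phi> :: ('m, 'q) G \<Rightarrow> _)"
      by (rule torus_act_eq_phaseG[OF B])
    then show ?thesis using phaseG_in_M[OF x] by (simp add: torus_act_quot_def phaseG_orb)
  qed
  have action: "torus_act_quot (mat 1) y = y"
    "torus_act_quot (B ** B') y = torus_act_quot B (torus_act_quot B' y)"
    for B B' :: "quat ^ 'q ^ 'q" and y :: "('m, 'q) G set"
    by (simp_all add: torus_act_quot_def torus_act_def split_def image_image matrix_vector_mul_assoc)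
  have isometry: "triholomorphic_isometry Q g I (torus_act_quot B)"
    if gI: "hyperkaehler_quotient_structure orb M (J_G J) g I" and B: "B \<in> torus" for g I B
  proof -
    obtain \<phi> where "torus_act B = (phaseG \<phi> :: ('m, 'q) G \<Rightarrow> _)"
      by (rule torus_act_eq_phaseG[OF B])
    from torus_act_quot_phase[OF this] triholomorphic_isometry_phase[OF gI] show ?thesis by simp
  qed
  have n1: "diffeomorphic Q (subset_space (UNIV :: (real ^ 'n1) set))"
    if "CARD('n1) = 4 * p + 4 * CARD('q) - 4 * l"
    using diffeomorphic_quotient_M[where 'n = 'n1] that frame(1) dim_m by simp
  have n2: "diffeomorphic (quotient_space (subset_space UNIV) orb) (subset_space (UNIV :: (real ^ 'n2) set))"
    if "CARD('n2) = 4 * p + 4 * CARD('q) - l"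
    using diffeomorphic_quotient_group[where 'n = 'n2] that frame(1) dim_m by simp
  have points: "sp_points Q = orb ` M" by simp
  have fixed: "\<exists>!y. y \<in> sp_points Q \<and> (\<forall>B\<in>torus. torus_act_quot B y = y)" if "l = p"
    unfolding points by (rule unique_fixed_point) (simp add: dim_m that)
  have formula: "\<forall>b. quaternionic_basis J e l p b \<longrightarrow>
      (\<forall>X (x :: nat \<Rightarrow> quat) W. X = (\<Sum>\<alpha> = 1..p. qscale J (b \<alpha>) (x \<alpha>)) \<longrightarrow>
        (\<forall>\<alpha>\<in>{1..l}. mu \<theta> \<kappa> J (X, W) (e \<alpha>) =
           - qIm (x \<alpha>) + (1 / 2) *\<^sub>R (\<Sum>\<beta>\<in>UNIV. (\<theta> $ \<beta> $ en \<alpha>) *\<^sub>R (qcnj (W $ \<beta>) * qi * W $ \<beta>))))"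
    using moment_map_formula[OF _ frame(1)] by (intro allI impI ballI)
  show ?thesis
    unfolding Let_def Q
  proof (intro conjI)
    show "\<forall>B\<in>torus. \<forall>x\<in>M. torus_act B x \<in> M \<and> torus_act_quot B (orb x) = orb (torus_act B x)"
      using torus by (intro ballI)
    show "\<forall>y\<in>sp_points Q. torus_act_quot (mat 1) y = y \<and>
        (\<forall>B\<in>torus. \<forall>B'\<in>torus. torus_act_quot (B ** B') y = torus_act_quot B (torus_act_quot B' y))"
      using action by (intro ballI conjI)
    show "\<forall>g I. hyperkaehler_quotient_structure orb M (J_G J) g I \<longrightarrow>
        (\<forall>B\<in>torus. triholomorphic_isometry Q g I (torus_act_quot B))"
      using isometry by (intro allI impI ballI)
    show "l = p \<and> p = CARD('q) \<longrightarrow> (\<exists>!y. y \<in> sp_points Q \<and> (\<forall>B\<in>torus. torus_act_quot B y = y))"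
      by (intro impI, rule fixed[OF conjunct1])
  qed (intro impI frame(2) formula n1 n2 hyperkaehler_quotient_structure_exists; assumption)+
qed

end
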